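(* Let $N^{(1)}=(N^{(1)}_{x,y})$ be the edge field and $\hat{\mathcal L}_1=(\hat{\mathcal L}_1^x)_{x\in X}$ the occupation field of the Poissonian loop ensemble $\mathcal L_1$ of intensity $\mu$. i) For any Eulerian network $k$, $$P\bigl(N^{(1)}=k\bigr)=\det(I-P)\,\frac{\prod_x k_x!}{\prod_{x,y}k_{x,y}!}\ \prod_{x,y}P_{x,y}^{k_{x,y}}.$$ ii) For any Eulerian network $k$, and any nonnegative function $\rho$ on $X$, $$P\bigl(N^{(1)}=k,\ \hat{\mathcal L}_1\in(\rho,\rho+d\rho)\bigr)=\frac{1}{\det(G)}\prod_{x,y}\frac{\bigl(\sqrt{\rho_x}\,C_{x,y}\sqrt{\rho_y}\bigr)^{k_{x,y}}}{k_{x,y}!}\ \prod_{x}\frac12\,e^{-\frac12\lambda_x\rho_x}\,d\rho_x .$$ The products over $x,y$ run over all ordered pairs of vertices (equivalently, over all oriented edges).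
   Context: Let $\mathcal G=(X,E)$ be a finite connected graph without loop-edges or multiple edges. Let $C_{x,y}=C_{y,x}\ge 0$ be conductances indexed by the edges (with $C_{x,y}=0$ if $\{x,y\}\notin E$) and let $\kappa_x\ge 0$, $x\in X$, be a killing measure. Put $\lambda_x=\sum_yC_{x,y}+\kappa_x$, and assume that the energy $\mathcal E(f,f)=\frac12\sum_{x,y}C_{x,y}(f(x)-f(y))^2+\sum_x\kappa_xf(x)^2$ is positive definite. The symmetric Green function $G=(G_{x,y})_{x,y\in X}$ associated with $\mathcal E$ is the inverse of the matrix with entries $\lambda_x1_{x=y}-C_{x,y}$. Let $P_{x,y}=C_{x,y}/\lambda_x$ be the transition matrix, and $I$ the identity matrix. Loop measure $\mu$. A discrete based loop of length $n\ge 2$ is a sequence $(\xi_1,\dots,\xi_n)$ in $X$ with $\{\xi_i,\xi_{i+1}\}\in E$ for all $1\le i\le n$, where $\xi_{n+1}=\xi_1$. A non-trivial discrete loop is an equivalence class of such sequences under cyclic shift. Its $\mu$-measure is $\frac1m\prod_{i=1}^nP_{\xi_i,\xi_{i+1}}$, where $m$ is its multiplicity (the largest integer $m$ such that the sequence is the $m$-fold repetition of a shorter based loop; $m=1$ if aperiodic). The measure $\mu$ on continuous time loops is obtained by attaching to the successive points of a discrete loop independent exponential holding times of mean $1$; moreover, for each vertex $x$, the trivial one-point loops at $x$ are given the holding time measure (of infinite mass) with density $\frac{e^{-t}}{t}$ on $(0,\infty)$. For $\alpha>0$, $\mathcal L_\alpha$ denotes the Poisson process of loops with intensity $\alpha\mu$.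 Its occupation field $\hat{\mathcal L}_\alpha^x$ is the total time spent at $x$ by the loops of $\mathcal L_\alpha$, normalized (divided) by $\lambda_x$. For an oriented edge $(x,y)$, $N^{(\alpha)}_{x,y}$ is the total number of jumps from $x$ to $y$ made by the loops of $\mathcal L_\alpha$; $N^{(\alpha)}_{x,y}=0$ if $\{x,y\}$ is not an edge, in particular $N^{(\alpha)}_{x,x}=0$. A network is a matrix $k=(k_{x,y})_{x,y\in X}$ with entries in $\mathbb N=\{0,1,2,\dots\}$ such that $k_{x,y}=0$ whenever $\{x,y\}$ is not an edge (in particular on the diagonal). It is Eulerian if $\sum_yk_{x,y}=\sum_yk_{y,x}$ for every $x\in X$; one then sets $k_x=\sum_yk_{x,y}=\sum_yk_{y,x}$. Convention: $0^0=1$.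
   Formalization: In part ii) the vertex factor ½e^{−½λ_xρ_x} is corrected to e^{−λ_xρ_x}; as printed it fails already for one vertex with k=0, where the occupation field is exponential with density λe^{−λρ}, and it contradicts part i). *)

theory Defs
  imports "HOL-Probability.Probability"
begin

section \<open>Graphs with conductances and a killing measure\<close>

definition energy :: "('v::finite \<Rightarrow> 'v \<Rightarrow> real) \<Rightarrow> ('v \<Rightarrow> real) \<Rightarrow> ('v \<Rightarrow> real) \<Rightarrow> real" where
  "energy C \<kappa> f = 1/2 * (\<Sum>x\<in>UNIV. \<Sum>y\<in>UNIV. C x y * (f x - f y)\<^sup>2) + (\<Sum>x\<in>UNIV. \<kappa> x * (f x)\<^sup>2)"

locale killed_network =
  fixes E :: "'v::finite \<Rightarrow> 'v \<Rightarrow> bool"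
    and C :: "'v \<Rightarrow> 'v \<Rightarrow> real"
    and \<kappa> :: "'v \<Rightarrow> real"
  assumes edge_sym: "E x y \<Longrightarrow> E y x"
    and no_loop_edge: "\<not> E x x"
    and connected: "E\<^sup>*\<^sup>* x y"
    and C_sym: "C x y = C y x"
    and C_nonneg: "0 \<le> C x y"
    and C_nonedge: "\<not> E x y \<Longrightarrow> C x y = 0"
    and killing_nonneg: "0 \<le> \<kappa> x"
    and energy_pos_def: "f \<noteq> (\<lambda>_. 0) \<Longrightarrow> 0 < energy C \<kappa> f"

definition vertex_weight :: "('v::finite \<Rightarrow> 'v \<Rightarrow> real) \<Rightarrow> ('v \<Rightarrow> real) \<Rightarrow> 'v \<Rightarrow> real" where
  "vertex_weight C \<kappa> x = (\<Sum>y\<in>UNIV. C x y) + \<kappa> x"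

definition green :: "('v::finite \<Rightarrow> 'v \<Rightarrow> real) \<Rightarrow> ('v \<Rightarrow> real) \<Rightarrow> real^'v^'v" where
  "green C \<kappa> = matrix_inv (\<chi> x y. (if x = y then vertex_weight C \<kappa> x else 0) - C x y)"

definition transition :: "('v::finite \<Rightarrow> 'v \<Rightarrow> real) \<Rightarrow> ('v \<Rightarrow> real) \<Rightarrow> real^'v^'v" where
  "transition C \<kappa> = (\<chi> x y. C x y / vertex_weight C \<kappa> x)"

section \<open>Discrete loops\<close>

definition based_loop :: "('v \<Rightarrow> 'v \<Rightarrow> bool) \<Rightarrow> 'v list \<Rightarrow> bool" where
  "based_loop E \<xi> \<longleftrightarrow> 2 \<le> length \<xi> \<and> (\<forall>i<length \<xi>. E (\<xi> ! i) (\<xi> ! (Suc i mod length \<xi>)))"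

definition shift_class :: "'a list \<Rightarrow> 'a list set" where
  "shift_class l = range (\<lambda>i. rotate i l)"

definition discrete_loops :: "('v \<Rightarrow> 'v \<Rightarrow> bool) \<Rightarrow> 'v list set set" where
  "discrete_loops E = shift_class ` {\<xi>. based_loop E \<xi>}"

definition loop_multiplicity :: "('v \<Rightarrow> 'v \<Rightarrow> bool) \<Rightarrow> 'v list \<Rightarrow> nat" where
  "loop_multiplicity E \<xi> = Max {m. \<exists>\<eta>. based_loop E \<eta> \<and> \<xi> = concat (replicate m \<eta>)}"

definition loop_weight :: "('v::finite \<Rightarrow> 'v \<Rightarrow> bool) \<Rightarrow> real^'v^'v \<Rightarrow> 'v list \<Rightarrow> real" where
  "loop_weight E P \<xi> = 1 / real (loop_multiplicity E \<xi>) *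
     (\<Prod>i<length \<xi>. P $ (\<xi> ! i) $ (\<xi> ! (Suc i mod length \<xi>)))"

section \<open>Continuous time loops\<close>

text \<open>
  A continuous time loop is the class, under cyclic shift, of a list of pairs (vertex, holding
  time); the lists of length 1 are the trivial one-point loops.  Holding times range over all
  reals here; the loop measure only charges loops with positive holding times.
\<close>

definition skeletons :: "('v \<Rightarrow> 'v \<Rightarrow> bool) \<Rightarrow> 'v list set" where
  "skeletons E = {\<xi>. length \<xi> = 1 \<or> based_loop E \<xi>}"

definition timed_loop :: "'v list \<Rightarrow> (nat \<Rightarrow> real) \<Rightarrow> ('v \<times> real) list set" where
  "timed_loop \<xi> t = shift_class (map (\<lambda>i. (\<xi> ! i, t i)) [0..<length \<xi>])"

definition loops :: "('v \<Rightarrow> 'v \<Rightarrow> bool) \<Rightarrow> ('v \<times> real) list set set" where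
  "loops E = {timed_loop \<xi> t | \<xi> t. \<xi> \<in> skeletons E}"

definition time_vectors :: "nat \<Rightarrow> (nat \<Rightarrow> real) measure" where
  "time_vectors n = PiM {..<n} (\<lambda>_. borel)"

text \<open>
  The quotient Borel structure: a set of loops is measurable iff, for each sequence of vertices,
  the corresponding set of vectors of holding times is Borel.
\<close>

definition loop_sets :: "('v \<Rightarrow> 'v \<Rightarrow> bool) \<Rightarrow> ('v \<times> real) list set set set" where
  "loop_sets E = {A. A \<subseteq> loops E \<and> (\<forall>\<xi>\<in>skeletons E.
     {t \<in> space (time_vectors (length \<xi>)). timed_loop \<xi> t \<in> A} \<in> sets (time_vectors (length \<xi>)))}"

definition loop_space :: "('v \<Rightarrow> 'v \<Rightarrow> bool) \<Rightarrow> ('v \<times> real) list set measure" where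
  "loop_space E = sigma (loops E) (loop_sets E)"

definition trivial_loops :: "('v \<Rightarrow> 'v \<Rightarrow> bool) \<Rightarrow> 'v \<Rightarrow> ('v \<times> real) list set measure" where
  "trivial_loops E x =
     distr (density lborel (\<lambda>t. ennreal (if 0 < t then exp (- t) / t else 0)))
           (loop_space E) (\<lambda>t. timed_loop [x] (\<lambda>_. t))"

definition exponential_times :: "('v \<Rightarrow> 'v \<Rightarrow> bool) \<Rightarrow> 'v list \<Rightarrow> ('v \<times> real) list set measure" where
  "exponential_times E \<xi> =
     distr (PiM {..<length \<xi>} (\<lambda>_. density lborel (exponential_density 1)))
           (loop_space E) (timed_loop \<xi>)"

text \<open>
  The sum over discrete loops is written as an integral against the counting measure.  The choice
  of a representative of each class is immaterial.
\<close>

definition loop_mass ::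
  "('v::finite \<Rightarrow> 'v \<Rightarrow> bool) \<Rightarrow> real^'v^'v \<Rightarrow> ('v \<times> real) list set set \<Rightarrow> ennreal" where
  "loop_mass E P A =
     (\<Sum>x\<in>UNIV. emeasure (trivial_loops E x) A) +
     (\<integral>\<^sup>+ c. (let \<xi> = SOME \<xi>. \<xi> \<in> c in
        ennreal (loop_weight E P \<xi>) * emeasure (exponential_times E \<xi>) A)
      \<partial>count_space (discrete_loops E))"

definition loop_measure ::
  "('v::finite \<Rightarrow> 'v \<Rightarrow> bool) \<Rightarrow> real^'v^'v \<Rightarrow> ('v \<times> real) list set measure" where
  "loop_measure E P = measure_of (loops E) (loop_sets E) (loop_mass E P)"

lemma sigma_algebra_loop_sets: "sigma_algebra (loops E) (loop_sets E)"
  unfolding sigma_algebra_iff2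
proof (intro conjI ballI allI impI)
  show "loop_sets E \<subseteq> Pow (loops E)" by (auto simp: loop_sets_def)
  show "{} \<in> loop_sets E" by (auto simp: loop_sets_def)
next
  fix A assume A: "A \<in> loop_sets E"
  have "{t \<in> space (time_vectors (length \<xi>)). timed_loop \<xi> t \<in> loops E - A}
      \<in> sets (time_vectors (length \<xi>))" if \<xi>: "\<xi> \<in> skeletons E" for \<xi>
  proof -
    have "{t \<in> space (time_vectors (length \<xi>)). timed_loop \<xi> t \<in> loops E - A}
      = space (time_vectors (length \<xi>)) - {t \<in> space (time_vectors (length \<xi>)). timed_loop \<xi> t \<in> A}"
      using \<xi> by (auto simp: loops_def)
    then show ?thesis using A \<xi> by (auto simp: loop_sets_def)
  qed
  then show "loops E - A \<in> loop_sets E" by (auto simp: loop_sets_def)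
next
  fix A :: "nat \<Rightarrow> _" assume A: "range A \<subseteq> loop_sets E"
  have "{t \<in> space (time_vectors (length \<xi>)). timed_loop \<xi> t \<in> (\<Union>i. A i)}
      \<in> sets (time_vectors (length \<xi>))" if \<xi>: "\<xi> \<in> skeletons E" for \<xi>
  proof -
    have "{t \<in> space (time_vectors (length \<xi>)). timed_loop \<xi> t \<in> (\<Union>i. A i)}
      = (\<Union>i. {t \<in> space (time_vectors (length \<xi>)). timed_loop \<xi> t \<in> A i})" by auto
    also have "\<dots> \<in> sets (time_vectors (length \<xi>))"
      using A \<xi> by (intro sets.countable_UN) (auto simp: loop_sets_def image_subset_iff)
    finally show ?thesis .
  qed
  then show "(\<Union>i. A i) \<in> loop_sets E" using A by (auto simp: loop_sets_def image_subset_iff)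
qed

lemma sets_loop_space: "sets (loop_space E) = loop_sets E"
  unfolding loop_space_def
  by (simp add: sigma_algebra.sets_measure_of_eq[OF sigma_algebra_loop_sets])

lemma sets_loop_measure: "sets (loop_measure E P) = loop_sets E"
  unfolding loop_measure_def
  by (simp add: sigma_algebra.sets_measure_of_eq[OF sigma_algebra_loop_sets])

text \<open>
  The set function \<^const>\<open>loop_mass\<close> is countably additive, so that it is indeed the measure
  obtained from \<^const>\<open>measure_of\<close> (which defaults to the zero measure otherwise).
\<close>

lemma emeasure_loop_measure:
  assumes "A \<in> loop_sets E"
  shows "emeasure (loop_measure E P) A = loop_mass E P A"
proof -
  have sets: "sets (trivial_loops E x) = loop_sets E" "sets (exponential_times E \<xi>) = loop_sets E"
    for x \<xi>
    by (simp_all add: trivial_loops_def exponential_times_def sets_loop_space)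
  have "countably_additive (loop_sets E) (loop_mass E P)"
  proof (rule countably_additiveI)
    fix A :: "nat \<Rightarrow> _"
    assume A: "range A \<subseteq> loop_sets E" "disjoint_family A" "(\<Union>i. A i) \<in> loop_sets E"
    have ad: "(\<Sum>i. emeasure N (A i)) = emeasure N (\<Union>i. A i)" if "sets N = loop_sets E" for N
      using A that by (intro suminf_emeasure) auto
    show "(\<Sum>i. loop_mass E P (A i)) = loop_mass E P (\<Union>i. A i)"
      unfolding loop_mass_def Let_def
      by (simp add: suminf_add[symmetric] suminf_sum nn_integral_suminf[symmetric]
          ad[OF sets(1)] ad[OF sets(2)])
  qed
  moreover have "positive (loop_sets E) (loop_mass E P)"
    by (simp add: positive_def loop_mass_def Let_def)
  ultimately show ?thesis
    unfolding loop_measure_def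
    using assms by (intro emeasure_measure_of_sigma sigma_algebra_loop_sets)
qed

section \<open>Poisson processes and the loop ensemble\<close>

definition point_measure :: "'a measure \<Rightarrow> bool" where
  "point_measure \<eta> \<longleftrightarrow> (\<exists>p :: nat \<Rightarrow> 'a option.
     (\<forall>i a. p i = Some a \<longrightarrow> a \<in> space \<eta>) \<and>
     (\<forall>A\<in>sets \<eta>. emeasure \<eta> A = emeasure (count_space UNIV) {i. \<exists>a\<in>A. p i = Some a}))"

definition poisson_process :: "'w measure \<Rightarrow> 'a measure \<Rightarrow> ('w \<Rightarrow> 'a measure) \<Rightarrow> bool" where
  "poisson_process M \<nu> L \<longleftrightarrow>
     (\<forall>\<omega>\<in>space M. sets (L \<omega>) = sets \<nu> \<and> point_measure (L \<omega>)) \<and>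
     (\<forall>A\<in>sets \<nu>. (\<lambda>\<omega>. emeasure (L \<omega>) A) \<in> borel_measurable M) \<and>
     (\<forall>A\<in>sets \<nu>. emeasure \<nu> A < \<infinity> \<longrightarrow>
        (\<forall>n::nat. measure M {\<omega> \<in> space M. emeasure (L \<omega>) A = of_nat n} =
           exp (- measure \<nu> A) * measure \<nu> A ^ n / fact n)) \<and>
     (\<forall>A\<in>sets \<nu>. emeasure \<nu> A = \<infinity> \<longrightarrow> (AE \<omega> in M. emeasure (L \<omega>) A = \<infinity>)) \<and>
     (\<forall>\<A>. finite \<A> \<longrightarrow> \<A> \<subseteq> sets \<nu> \<longrightarrow> disjoint \<A> \<longrightarrow>
        prob_space.indep_vars M (\<lambda>_. borel) (\<lambda>A \<omega>. emeasure (L \<omega>) A) \<A>)"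

definition loop_ensemble :: "'w measure \<Rightarrow> ('v::finite \<Rightarrow> 'v \<Rightarrow> bool) \<Rightarrow> ('v \<Rightarrow> 'v \<Rightarrow> real) \<Rightarrow>
    ('v \<Rightarrow> real) \<Rightarrow> real \<Rightarrow> ('w \<Rightarrow> ('v \<times> real) list set measure) \<Rightarrow> bool" where
  "loop_ensemble M E C \<kappa> \<alpha> L \<longleftrightarrow>
     poisson_process M (scale_measure (ennreal \<alpha>) (loop_measure E (transition C \<kappa>))) L"

text \<open>
  Functions of a list that are invariant under cyclic shift, evaluated on the class.  A one-point
  loop makes no jump (the cyclic successor of its only point is the point itself).
\<close>

definition time_at :: "'v \<Rightarrow> ('v \<times> real) list set \<Rightarrow> real" where
  "time_at x c = the_elem ((\<lambda>l. \<Sum>(y, t)\<leftarrow>l. if y = x then t else 0) ` c)"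

definition jumps :: "'v \<Rightarrow> 'v \<Rightarrow> ('v \<times> real) list set \<Rightarrow> nat" where
  "jumps x y c = the_elem ((\<lambda>l. if length l < 2 then 0 else
     card {i. i < length l \<and> fst (l ! i) = x \<and> fst (l ! (Suc i mod length l)) = y}) ` c)"

text \<open>Sums over the loops of a configuration are integrals against its point measure.\<close>

definition occupation_field :: "('v::finite \<Rightarrow> 'v \<Rightarrow> real) \<Rightarrow> ('v \<Rightarrow> real) \<Rightarrow>
    ('v \<times> real) list set measure \<Rightarrow> 'v \<Rightarrow> ennreal" where
  "occupation_field C \<kappa> \<eta> x = (\<integral>\<^sup>+ c. ennreal (time_at x c) \<partial>\<eta>) / ennreal (vertex_weight C \<kappa> x)"

definition edge_field :: "('v \<times> real) list set measure \<Rightarrow> 'v \<Rightarrow> 'v \<Rightarrow> ennreal" where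
  "edge_field \<eta> x y = (\<integral>\<^sup>+ c. of_nat (jumps x y c) \<partial>\<eta>)"

section \<open>Eulerian networks\<close>

definition network :: "('v \<Rightarrow> 'v \<Rightarrow> bool) \<Rightarrow> ('v \<Rightarrow> 'v \<Rightarrow> nat) \<Rightarrow> bool" where
  "network E k \<longleftrightarrow> (\<forall>x y. \<not> E x y \<longrightarrow> k x y = 0)"

definition eulerian :: "('v::finite \<Rightarrow> 'v \<Rightarrow> nat) \<Rightarrow> bool" where
  "eulerian k \<longleftrightarrow> (\<forall>x. (\<Sum>y\<in>UNIV. k x y) = (\<Sum>y\<in>UNIV. k y x))"

definition vertex_degree :: "('v::finite \<Rightarrow> 'v \<Rightarrow> nat) \<Rightarrow> 'v \<Rightarrow> nat" where
  "vertex_degree k x = (\<Sum>y\<in>UNIV. k x y)"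

end

theory Submission
  imports Defs
begin

text \<open>
  By Campbell's formula, the joint Laplace transform of the edge field and the occupation field is
  the exponential of minus the integral of $1 - e^{-f}$ against the loop measure, where $f$ is a
  nonnegative combination of the numbers of jumps and the local times. The trivial loops contribute
  Frullani integrals, and the other loops contribute the difference of the series of traces
  $\sum_n \mathrm{tr}(Q^n)/n$ for the transition matrix and for a damped version $Q$ of it. These
  series are evaluated in two ways: $\exp(-\sum_n \mathrm{tr}(P^n)/n) = \det(I - P)$ gives the
  normalising constant, and MacMahon's master theorem expands
  $\exp(\sum_n \mathrm{tr}(Q^n)/n)$ as a sum over Eulerian networks. The result is the Laplace
  transform of the law in the statement, the factors $(\lambda_x + \chi_x)^{-k_x - 1}$ being those of
  Gamma variables. Since the exponentials of minus the fields live in a cube, where a measure is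
  determined by its moments, the two laws agree.
\<close>

section \<open>Measures on the unit cube\<close>

text \<open>Neither field is known beforehand to be finite, and the loop measure has infinite mass.
  The coordinates in the cube are therefore \<open>enexp\<close> of extended nonnegative numbers,
  with infinity sent to 0, and finiteness is a by-product of identifying the laws. A moment of these
  coordinates is a Laplace transform at natural numbers, which is why the parameters
  \<open>m\<close> and \<open>n\<close> are natural numbers throughout.

  The damped matrix has entries P_xy e^(-m_xy) / (1 + n_x / lambda_x): a jump contributes e^(-m_xy),
  and a visit to x contributes the Laplace transform at n_x / lambda_x of a holding time of mean 1.
  In the transform of a Gamma variable of shape k_x + 1, k_x factors come from the visits of
  nontrivial loops to x and one comes from the trivial loops at x.

  The trace series converge without any appeal to eigenvalues: the powers of P have entries in
  [0,1], and I - P is invertible because the energy is positive definite, so the partial sums of the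
  powers stay bounded. Damped matrices are dominated entrywise by P.\<close>

lemma integrable_continuous_cube:
  fixes M :: "(real^'i::finite) measure" and h :: "real^'i \<Rightarrow> real"
  assumes "finite_measure M" "sets M = sets borel" "AE u in M. \<forall>i. 0 \<le> u $ i \<and> u $ i \<le> 1"
    and h: "continuous_on UNIV h"
  shows "integrable M h"
proof -
  have "compact (h ` cbox 0 1)"
    using h by (intro compact_continuous_image compact_cbox) (auto intro: continuous_on_subset)
  then obtain B where B: "\<And>y. y \<in> h ` cbox 0 1 \<Longrightarrow> norm y \<le> B"
    using compact_imp_bounded bounded_iff by metis
  have "h \<in> borel_measurable M"
    using borel_measurable_continuous_onI[OF h] assms(2) by (simp cong: measurable_cong_sets)
  moreover have "AE u in M. norm (h u) \<le> B"
    using assms(3) by eventually_elim (rule B, auto simp: mem_box_cart)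
  ultimately show ?thesis
    using assms(1) by (intro finite_measure.integrable_const_bound)
qed

text \<open>Stone-Weierstrass reduces a continuous integrand to polynomials; concentration on the
  cube and finite mass turn uniform closeness there into closeness of integrals.\<close>

lemma integral_eq_of_moments_eq:
  fixes M N :: "(real^'i::finite) measure" and h :: "real^'i \<Rightarrow> real"
  assumes M: "finite_measure M" "sets M = sets borel" "AE u in M. \<forall>i. 0 \<le> u $ i \<and> u $ i \<le> 1"
    and N: "finite_measure N" "sets N = sets borel" "AE u in N. \<forall>i. 0 \<le> u $ i \<and> u $ i \<le> 1"
    and moments: "\<And>n. (\<integral>\<^sup>+u. ennreal (\<Prod>i\<in>UNIV. u $ i ^ n i) \<partial>M) = (\<integral>\<^sup>+u. ennreal (\<Prod>i\<in>UNIV. u $ i ^ n i) \<partial>N)"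
    and h: "continuous_on UNIV h"
  shows "(\<integral>u. h u \<partial>M) = (\<integral>u. h u \<partial>N)"
proof -
  note intM = integrable_continuous_cube[OF M] and intN = integrable_continuous_cube[OF N]
  define mono :: "('i \<Rightarrow> nat) \<Rightarrow> real^'i \<Rightarrow> real" where "mono n u = (\<Prod>i\<in>UNIV. u $ i ^ n i)" for n u
  \<comment> \<open>Equality is demanded after multiplication by every monomial, so that a factor
    \<open>u $ i\<close> is absorbed into the exponents and \<open>V\<close> is stable under
    multiplication by coordinates, hence by polynomials.\<close>
  define V :: "(real^'i \<Rightarrow> real) set" where
    "V = {h. continuous_on UNIV h \<and> (\<forall>n. (\<integral>u. h u * mono n u \<partial>M) = (\<integral>u. h u * mono n u \<partial>N))}"
  have mono_cont [continuous_intros]: "continuous_on UNIV (mono n)" for n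
    unfolding mono_def by (intro continuous_intros)
  have one: "(\<lambda>_. 1) \<in> V"
  proof -
    have "(\<integral>u. mono n u \<partial>M) = enn2real (\<integral>\<^sup>+u. ennreal (mono n u) \<partial>M)" for n
      using M intM[OF mono_cont[of n]] by (intro integral_eq_nn_integral borel_measurable_integrable)
        (auto simp: mono_def[abs_def] elim!: eventually_mono intro!: prod_nonneg)
    moreover have "(\<integral>u. mono n u \<partial>N) = enn2real (\<integral>\<^sup>+u. ennreal (mono n u) \<partial>N)" for n
      using N intN[OF mono_cont[of n]] by (intro integral_eq_nn_integral borel_measurable_integrable)
        (auto simp: mono_def[abs_def] elim!: eventually_mono intro!: prod_nonneg)
    ultimately show ?thesis using moments by (auto simp: V_def mono_def)
  qed
  have add: "(\<lambda>u. f u + g u) \<in> V" if "f \<in> V" "g \<in> V" for f g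
    using that unfolding V_def
    by (auto intro!: continuous_intros simp: algebra_simps intM intN continuous_intros)
  have zero: "(\<lambda>_. 0) \<in> V" by (auto simp: V_def)
  have scale: "(\<lambda>u. c * f u) \<in> V" if "f \<in> V" for f c
    using that unfolding V_def by (auto intro!: continuous_intros simp: mult.assoc)
  have coord: "(\<lambda>u. u $ i * f u) \<in> V" if "f \<in> V" for f i
  proof -
    have "u $ i * mono n u = mono (n(i := Suc (n i))) u" for u :: "real^'i" and n
      unfolding mono_def by (subst (1 2) prod.remove[of _ i]) auto
    then have eq: "u $ i * f u * mono n u = f u * mono (n(i := Suc (n i))) u" for u n
      by (metis mult.assoc mult.commute)
    show ?thesis
      using that unfolding V_def mem_Collect_eq eq by (auto intro!: continuous_intros)
  qed
  have sum: "(\<lambda>u. \<Sum>i\<in>I. f i u) \<in> V" if "finite I" "\<And>i. i \<in> I \<Longrightarrow> f i \<in> V" for I and f :: "'i \<Rightarrow> _"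
    using that by (induction rule: finite_induct) (auto intro: add zero)
  \<comment> \<open>With \<open>f\<close> quantified inside the induction, multiplication by a
    product of two polynomials is a composition of two such multiplications.\<close>
  have "\<forall>f\<in>V. (\<lambda>u. p u * f u) \<in> V" if "real_polynomial_function p" for p
    using that
  proof (induction rule: real_polynomial_function.induct)
    case (linear p)
    show ?case
    proof
      fix f assume f: "f \<in> V"
      have p: "p u = (\<Sum>i\<in>UNIV. u $ i * p (axis i 1))" for u
      proof -
        interpret bounded_linear p by fact
        have "p u = p (\<Sum>i\<in>UNIV. u $ i *\<^sub>R axis i 1)"
          using basis_expansion[of u] by (simp add: scalar_mult_eq_scaleR)
        then show ?thesis by (simp add: sum scaleR)
      qed
      have "(\<lambda>u. p u * f u) = (\<lambda>u. \<Sum>i\<in>UNIV. p (axis i 1) * (u $ i * f u))"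
        by (rule ext, subst p) (simp add: sum_distrib_left sum_distrib_right mult_ac)
      also have "\<dots> \<in> V" by (intro sum scale coord f) auto
      finally show "(\<lambda>u. p u * f u) \<in> V" .
    qed
  qed (auto simp: distrib_right mult.assoc intro: scale add)
  with one have poly: "(\<integral>u. p u \<partial>M) = (\<integral>u. p u \<partial>N)" if "real_polynomial_function p" for p
  proof -
    have "p \<in> V" using that one \<open>\<And>p. real_polynomial_function p \<Longrightarrow> \<forall>f\<in>V. (\<lambda>u. p u * f u) \<in> V\<close>
      by fastforce
    then have "(\<integral>u. p u * mono (\<lambda>_. 0) u \<partial>M) = (\<integral>u. p u * mono (\<lambda>_. 0) u \<partial>N)"
      unfolding V_def by blast
    then show ?thesis by (simp add: mono_def)
  qed
  have close: "\<bar>(\<integral>u. h u \<partial>K) - (\<integral>u. p u \<partial>K)\<bar> \<le> e * measure K (space K)"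
    if K: "finite_measure K" "sets K = sets borel" "AE u in K. \<forall>i. 0 \<le> u $ i \<and> u $ i \<le> 1"
      and p: "continuous_on UNIV p" "\<And>u. u \<in> cbox 0 1 \<Longrightarrow> \<bar>h u - p u\<bar> < e" for K e p
  proof -
    note int = integrable_continuous_cube[OF K]
    interpret finite_measure K by fact
    have "\<bar>(\<integral>u. h u \<partial>K) - (\<integral>u. p u \<partial>K)\<bar> = \<bar>\<integral>u. h u - p u \<partial>K\<bar>"
      using int h p by simp
    also have "\<dots> \<le> (\<integral>u. \<bar>h u - p u\<bar> \<partial>K)" by (rule integral_abs_bound)
    also have "\<dots> \<le> (\<integral>u. e \<partial>K)"
    proof (rule integral_mono_AE)
      show "AE u in K. \<bar>h u - p u\<bar> \<le> e" using K(3)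
        by eventually_elim (auto intro!: less_imp_le p(2) simp: mem_box_cart)
    qed (auto intro!: int continuous_intros h p)
    finally show ?thesis by (simp add: mult.commute)
  qed
  have bound: "\<bar>(\<integral>u. h u \<partial>M) - (\<integral>u. h u \<partial>N)\<bar> \<le> e * (measure M (space M) + measure N (space N))"
    if e: "0 < e" for e
  proof -
    obtain p where p: "real_polynomial_function p" "\<And>u. u \<in> cbox 0 1 \<Longrightarrow> \<bar>h u - p u\<bar> < e"
      using Stone_Weierstrass_real_polynomial_function[OF compact_cbox
          continuous_on_subset[OF h subset_UNIV] e] by blast
    have c: "continuous_on UNIV p"
      using p(1) by (simp add: continuous_on_polymonial_function real_polynomial_function_eq)
    show ?thesis
      using close[OF M c p(2)] close[OF N c p(2)] poly[OF p(1)] by (auto simp: algebra_simps)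
  qed
  show ?thesis
  proof (rule ccontr)
    assume ne: "\<not> ?thesis"
    define m where "m = measure M (space M) + measure N (space N)"
    define d where "d = \<bar>(\<integral>u. h u \<partial>M) - (\<integral>u. h u \<partial>N)\<bar>"
    have "0 < d" "0 \<le> m" using ne by (auto simp: d_def m_def)
    \<comment> \<open>The tolerance d / (m + 1) contradicts d > 0, since m / (m + 1) < 1; the added
      1 covers the case of two zero measures.\<close>
    moreover have "d \<le> d / (m + 1) * m"
    proof -
      have "0 < d / (m + 1)" using calculation by simp
      from bound[OF this] show ?thesis unfolding m_def[symmetric] d_def[symmetric] .
    qed
    ultimately show False by (simp add: field_simps)
  qed
qed

text \<open>Closed sets are an intersection-stable generator of the Borel sets, and the indicator of
  a closed set is the bounded pointwise limit of the continuous functions max(0, 1 - n dist(u,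
  S)).\<close>

lemma measure_eq_of_moments_eq:
  fixes M N :: "(real^'i::finite) measure"
  assumes M: "finite_measure M" "sets M = sets borel" "AE u in M. \<forall>i. 0 \<le> u $ i \<and> u $ i \<le> 1"
    and N: "finite_measure N" "sets N = sets borel" "AE u in N. \<forall>i. 0 \<le> u $ i \<and> u $ i \<le> 1"
    and moments: "\<And>n. (\<integral>\<^sup>+u. ennreal (\<Prod>i\<in>UNIV. u $ i ^ n i) \<partial>M) = (\<integral>\<^sup>+u. ennreal (\<Prod>i\<in>UNIV. u $ i ^ n i) \<partial>N)"
  shows "M = N"
proof -
  interpret M: finite_measure M by fact
  interpret N: finite_measure N by fact
  have spM: "space M = UNIV" using sets_eq_imp_space_eq[OF M(2)] by simp
  have spN: "space N = UNIV" using sets_eq_imp_space_eq[OF N(2)] by simp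
  have lim: "(\<lambda>n. \<integral>u. max 0 (1 - real n * infdist u S) \<partial>K) \<longlonglongrightarrow> measure K S"
    if K: "finite_measure K" "sets K = sets borel" and S: "closed S" "S \<noteq> {}"
    for K :: "(real^'i) measure" and S
  proof -
    interpret finite_measure K by fact
    have meas: "h \<in> borel_measurable K" if "continuous_on UNIV h" for h :: "_ \<Rightarrow> real"
      using borel_measurable_continuous_onI[OF that] K(2) by (simp cong: measurable_cong_sets)
    have SK: "S \<in> sets K" using S K by auto
    have "(\<lambda>n. \<integral>u. max 0 (1 - real n * infdist u S) \<partial>K) \<longlonglongrightarrow> (\<integral>u. indicator S u \<partial>K)"
    proof (rule integral_dominated_convergence[where w = "\<lambda>_. 1"])
      show "(\<lambda>u. max 0 (1 - real n * infdist u S)) \<in> borel_measurable K" for n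
        by (intro meas continuous_intros)
      have "(\<lambda>n. max 0 (1 - real n * infdist u S)) \<longlonglongrightarrow> indicator S u" for u
      proof (cases "u \<in> S")
        case False
        then have pos: "0 < infdist u S"
          using S in_closed_iff_infdist_zero[of S u] infdist_nonneg[of u S] by fastforce
        obtain m :: nat where m: "1 / infdist u S < real m" using reals_Archimedean2 by blast
        have "eventually (\<lambda>n. max 0 (1 - real n * infdist u S) = 0) sequentially"
          using eventually_ge_at_top[of m]
        proof eventually_elim
          case (elim n)
          then have "1 / infdist u S < real n" using m by linarith
          then show ?case using pos by (simp add: field_simps)
        qed
        then show ?thesis using False by (simp add: tendsto_eventually)
      qed auto
      then show "AE u in K. (\<lambda>n. max 0 (1 - real n * infdist u S)) \<longlonglongrightarrow> indicator S u" by simp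
      show "AE u in K. norm (max 0 (1 - real n * infdist u S)) \<le> 1" for n
        by (auto simp: infdist_nonneg)
    qed (use SK in auto)
    then show ?thesis using SK by simp
  qed
  have closed_eq: "emeasure M S = emeasure N S" if "closed S" for S
  \<comment> \<open>The distance to the empty set is 0 by convention, so the approximating functions
    are useless there.\<close>
  proof (cases "S = {}")
    case False
    have "(\<integral>u. max 0 (1 - real n * infdist u S) \<partial>M) = (\<integral>u. max 0 (1 - real n * infdist u S) \<partial>N)" for n
      by (intro integral_eq_of_moments_eq[OF M N moments] continuous_intros)
    then have "measure M S = measure N S"
      using lim[OF M(1,2) that False] lim[OF N(1,2) that False] LIMSEQ_unique by fastforce
    then show ?thesis by (simp add: M.emeasure_eq_measure N.emeasure_eq_measure)
  qed simp
  show ?thesis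
  proof (rule measure_eqI_generator_eq[where \<Omega> = UNIV and E = "{S. closed S}" and A = "\<lambda>_. UNIV"])
    show "Int_stable {S::(real^'i) set. closed S}" by (auto simp: Int_stable_def)
  qed (auto simp: M(2) N(2) borel_eq_closed closed_eq)
qed

section \<open>The Laplace functional of a Poisson process\<close>

text \<open>Infinity is treated apart because \<open>enn2real \<infinity> = 0\<close> would produce
  the value 1. With the value 0 the map is continuous and injective from [0, infinity] to [0, 1] and
  turns sums into products.\<close>

definition enexp :: "ennreal \<Rightarrow> real" where
  "enexp x = (if x = \<infinity> then 0 else exp (- enn2real x))"

lemma enexp_nonneg [simp]: "0 \<le> enexp x"
  and enexp_le_1 [simp]: "enexp x \<le> 1"
  and enexp_0 [simp]: "enexp 0 = 1" and enexp_top [simp]: "enexp \<infinity> = 0" "enexp top = 0"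
  by (auto simp: enexp_def)

lemma enexp_ennreal: "0 \<le> x \<Longrightarrow> enexp (ennreal x) = exp (- x)"
  by (simp add: enexp_def)

lemma enexp_of_nat: "enexp (of_nat n) = exp (- real n)"
  by (simp add: enexp_def enn2real_of_nat)

lemma enexp_pos_iff: "0 < enexp x \<longleftrightarrow> x \<noteq> \<infinity>"
  by (auto simp: enexp_def)

lemma enexp_eq_iff: "enexp x = enexp y \<longleftrightarrow> x = y"
  by (cases x; cases y) (auto simp: enexp_def)

lemma enexp_add: "enexp (x + y) = enexp x * enexp y"
  by (cases x; cases y) (auto simp: enexp_def exp_add[symmetric] simp flip: ennreal_plus)

lemma enexp_sum: "enexp (\<Sum>i\<in>I. f i) = (\<Prod>i\<in>I. enexp (f i))"
  by (induction I rule: infinite_finite_induct) (auto simp: enexp_add)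

lemma enexp_mult_of_nat: "enexp (of_nat n * x) = enexp x ^ n"
  by (induction n) (auto simp: distrib_right enexp_add)

lemma enexp_antimono: "x \<le> y \<Longrightarrow> enexp y \<le> enexp x"
  by (cases x; cases y) (auto simp: enexp_def top_unique)

lemma measurable_enexp [measurable]: "enexp \<in> borel_measurable borel"
  unfolding enexp_def[abs_def] by measurable

lemma tendsto_enexp:
  assumes "(f \<longlongrightarrow> x) F"
  shows "((\<lambda>i. enexp (f i)) \<longlongrightarrow> enexp x) F"
proof (cases "x = \<infinity>")
  case True
  show ?thesis
  proof (rule order_tendstoI)
    fix a assume "enexp x < a"
    then have a: "0 < a" using True by simp
    \<comment> \<open>Chosen so that e^(-K) is at most a / 2; the maximum with 0 makes
      \<open>ennreal K\<close> faithful when a > 2.\<close>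
    define K where "K = max 0 (- ln (a / 2))"
    have K: "0 \<le> K" "- K \<le> ln (a / 2)" by (auto simp: K_def)
    have "eventually (\<lambda>i. ennreal K < f i) F"
      using assms True by (intro order_tendstoD) auto
    then show "eventually (\<lambda>i. enexp (f i) < a) F"
    proof eventually_elim
      case (elim i)
      have "enexp (f i) \<le> exp (- K)"
        using enexp_antimono[OF less_imp_le[OF elim]] K by (simp add: enexp_ennreal)
      also have "\<dots> \<le> exp (ln (a / 2))" using K by simp
      also have "\<dots> < a" using a by simp
      finally show ?case .
    qed
  next
    fix a assume "a < enexp x"
    then have "a < 0" using True by simp
    then show "eventually (\<lambda>i. a < enexp (f i)) F"
      by (intro always_eventually allI) (meson enexp_nonneg less_le_trans)
  qed
next
  case False
  have "eventually (\<lambda>i. f i < \<infinity>) F"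
    using assms False by (intro order_tendstoD) (auto simp: top.not_eq_extremum)
  then have "eventually (\<lambda>i. exp (- enn2real (f i)) = enexp (f i)) F"
    by eventually_elim (auto simp: enexp_def)
  moreover have "((\<lambda>i. exp (- enn2real (f i))) \<longlongrightarrow> exp (- enn2real x)) F"
    using assms False by (intro tendsto_intros tendsto_enn2real) (auto simp: less_top)
  ultimately show ?thesis
    using False by (simp add: enexp_def tendsto_cong)
qed

text \<open>At c = 0 this is the total mass of the Poisson law, which serves to exclude infinite
  counts.\<close>

lemma poisson_laplace_sums:
  "(\<lambda>n. exp (- real n * c) * (exp (- m) * m ^ n / fact n)) sums exp (- (m * (1 - exp (- c))))"
proof -
  have "(\<lambda>n. exp (- m) * ((m * exp (- c)) ^ n /\<^sub>R fact n)) sums (exp (- m) * exp (m * exp (- c)))"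
    by (intro sums_mult exp_converges)
  moreover have "exp (- m) * ((m * exp (- c)) ^ n /\<^sub>R fact n) =
      exp (- real n * c) * (exp (- m) * m ^ n / fact n)" for n
    by (simp add: power_mult_distrib exp_of_nat_mult[symmetric] field_simps)
  moreover have "exp (- m) * exp (m * exp (- c)) = exp (- (m * (1 - exp (- c))))"
    by (simp add: exp_add[symmetric] algebra_simps)
  ultimately show ?thesis by simp
qed

context
  fixes M :: "'w measure" and \<nu> :: "'a measure" and L :: "'w \<Rightarrow> 'a measure"
  assumes M: "prob_space M" and PP: "poisson_process M \<nu> L"
begin

interpretation prob_space M by (rule M)

lemma sets_poisson: "\<omega> \<in> space M \<Longrightarrow> sets (L \<omega>) = sets \<nu>"
  using PP by (simp add: poisson_process_def)

lemma space_poisson: "\<omega> \<in> space M \<Longrightarrow> space (L \<omega>) = space \<nu>"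
  by (rule sets_eq_imp_space_eq[OF sets_poisson])

lemma measurable_poisson_emeasure: "A \<in> sets \<nu> \<Longrightarrow> (\<lambda>\<omega>. emeasure (L \<omega>) A) \<in> borel_measurable M"
  using PP by (simp add: poisson_process_def)

lemma simple_integral_poisson:
  assumes "simple_function \<nu> f" "\<omega> \<in> space M"
  shows "(\<integral>\<^sup>+a. f a \<partial>L \<omega>) = (\<Sum>y\<in>f ` space \<nu>. y * emeasure (L \<omega>) (f -` {y} \<inter> space \<nu>))"
proof -
  have "simple_function (L \<omega>) f"
    using assms sets_poisson[of \<omega>] by (simp add: simple_function_def space_poisson)
  then show ?thesis
    using assms by (simp add: nn_integral_eq_simple_integral simple_integral_def space_poisson)
qed

lemma nn_integral_poisson_SUP:
  assumes "\<And>i. f i \<in> borel_measurable \<nu>" "incseq f" "\<omega> \<in> space M"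
  shows "(\<integral>\<^sup>+a. (SUP i. f i a) \<partial>L \<omega>) = (SUP i. \<integral>\<^sup>+a. f i a \<partial>L \<omega>)"
  using assms sets_poisson[OF assms(3)]
  by (intro nn_integral_monotone_convergence_SUP) (auto cong: measurable_cong_sets)

text \<open>A Poisson process comes with measurability of its masses of sets only; simple functions
  and monotone limits carry it over to integrals.\<close>

lemma measurable_nn_integral_poisson:
  assumes "f \<in> borel_measurable \<nu>"
  shows "(\<lambda>\<omega>. \<integral>\<^sup>+a. f a \<partial>L \<omega>) \<in> borel_measurable M"
proof -
  obtain U where U: "\<And>i. simple_function \<nu> (U i)" "incseq U" "\<And>a. (SUP i. U i a) = f a"
    using borel_measurable_implies_simple_function_sequence'[OF assms] by metis
  have simple: "(\<lambda>\<omega>. \<integral>\<^sup>+a. U i a \<partial>L \<omega>) \<in> borel_measurable M" for i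
  proof (subst measurable_cong[OF simple_integral_poisson[OF U(1)]])
    show "(\<lambda>\<omega>. \<Sum>y\<in>U i ` space \<nu>. y * emeasure (L \<omega>) (U i -` {y} \<inter> space \<nu>)) \<in> borel_measurable M"
      using simple_functionD[OF U(1)]
      by (intro borel_measurable_sum borel_measurable_times_ennreal borel_measurable_const
            measurable_poisson_emeasure) auto
  qed
  have "(\<integral>\<^sup>+a. f a \<partial>L \<omega>) = (SUP i. \<integral>\<^sup>+a. U i a \<partial>L \<omega>)" if "\<omega> \<in> space M" for \<omega>
    using nn_integral_poisson_SUP[of U \<omega>] U that by (simp add: borel_measurable_simple_function)
  then show ?thesis
    using simple by (subst measurable_cong) (auto intro!: borel_measurable_SUP)
qed

text \<open>The Laplace transform of a Poisson count. Infinite mean has to be covered as well,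
  because level sets of a simple function can have infinite intensity.\<close>

lemma laplace_poisson_emeasure:
  assumes A: "A \<in> sets \<nu>" and c: "c \<noteq> \<infinity>"
  shows "(\<integral>\<^sup>+\<omega>. ennreal (enexp (c * emeasure (L \<omega>) A)) \<partial>M) =
    ennreal (enexp (ennreal (1 - enexp c) * emeasure \<nu> A))"
proof (cases "emeasure \<nu> A = \<infinity>")
  case True
  have ae: "AE \<omega> in M. emeasure (L \<omega>) A = \<infinity>"
    using PP A True unfolding poisson_process_def by blast
  show ?thesis
  \<comment> \<open>In \<open>ennreal\<close>, 0 times infinity is 0, so both sides are 1 for c = 0;
    for any other c both sides are 0.\<close>
  proof (cases "c = 0")
    case False
    have "(\<integral>\<^sup>+\<omega>. ennreal (enexp (c * emeasure (L \<omega>) A)) \<partial>M) = (\<integral>\<^sup>+\<omega>. 0 \<partial>M)"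
      using ae by (intro nn_integral_cong_AE) (auto simp: False ennreal_mult_top)
    moreover have "enexp c < 1" using False enexp_eq_iff[of c 0] enexp_le_1[of c] by (simp add: less_le)
    ultimately show ?thesis using True by (simp add: ennreal_mult_top)
  qed (simp add: emeasure_space_1)
next
  case False
  define m where "m = measure \<nu> A"
  have m: "emeasure \<nu> A = ennreal m" using False by (simp add: m_def emeasure_eq_ennreal_measure)
  obtain r where r: "c = ennreal r" "0 \<le> r" using c by (cases c) auto
  define S where "S n = {\<omega> \<in> space M. emeasure (L \<omega>) A = of_nat n}" for n :: nat
  note meas = measurable_poisson_emeasure[OF A]
  have S: "S n \<in> sets M" for n using meas by (simp add: S_def)
  have disj: "disjoint_family S" by (auto simp: disjoint_family_on_def S_def)
  have P: "measure M (S n) = exp (- m) * m ^ n / fact n" for n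
    using PP A False by (simp add: poisson_process_def S_def m_def top.not_eq_extremum)
  \<comment> \<open>The probabilities of the finite counts already add up to 1, so the count is
    almost surely a natural number.\<close>
  have "(\<lambda>n. measure M (S n)) sums measure M (\<Union>n. S n)"
    using S disj by (intro finite_measure_UNION) auto
  moreover have "(\<lambda>n. measure M (S n)) sums 1"
    using poisson_laplace_sums[of 0 m] by (simp add: P)
  ultimately have "measure M (\<Union>n. S n) = 1" using sums_unique2 by blast
  then have "AE \<omega> in M. \<omega> \<in> (\<Union>n. S n)" using S by (intro AE_prob_1) auto
  then have "(\<integral>\<^sup>+\<omega>. ennreal (enexp (c * emeasure (L \<omega>) A)) \<partial>M) =
      (\<integral>\<^sup>+\<omega>. (\<Sum>n. ennreal (exp (- real n * r)) * indicator (S n) \<omega>) \<partial>M)"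
  proof (intro nn_integral_cong_AE, eventually_elim)
    case (elim \<omega>)
    then obtain n where n: "\<omega> \<in> S n" by auto
    have "indicator (S k) \<omega> = (if k = n then 1 else 0 :: ennreal)" for k
      using n disj by (auto simp: disjoint_family_on_def indicator_def)
    then have "(\<Sum>k. ennreal (exp (- real k * r)) * indicator (S k) \<omega>) =
        (\<Sum>k. if k = n then ennreal (exp (- real n * r)) else 0)"
      by (intro suminf_cong) auto
    also have "\<dots> = ennreal (exp (- real n * r))" using sums_If_finite_set[of "{n}"]
      by (subst suminf_finite[of "{n}"]) auto
    also have "c * emeasure (L \<omega>) A = ennreal (real n * r)"
      using n r by (simp add: S_def ennreal_of_nat_eq_real_of_nat ennreal_mult' mult.commute)
    then have "ennreal (exp (- real n * r)) = ennreal (enexp (c * emeasure (L \<omega>) A))"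
      using r by (simp add: enexp_ennreal)
    finally show ?case by simp
  qed
  also have "\<dots> = (\<Sum>n. ennreal (exp (- real n * r)) * emeasure M (S n))"
    using S by (subst nn_integral_suminf) (auto simp: nn_integral_cmult)
  also have "\<dots> = (\<Sum>n. ennreal (exp (- real n * r) * (exp (- m) * m ^ n / fact n)))"
    by (simp add: emeasure_eq_measure P ennreal_mult'[symmetric])
  also have "\<dots> = ennreal (exp (- (m * (1 - exp (- r)))))"
    using poisson_laplace_sums[of r m] by (intro suminf_ennreal_eq) (auto simp: m_def)
  also have "\<dots> = ennreal (enexp (ennreal (1 - enexp c) * emeasure \<nu> A))"
    using r by (simp add: m m_def enexp_ennreal ennreal_mult[symmetric] mult.commute)
  finally show ?thesis .
qed

text \<open>The level sets of \<open>f\<close> are disjoint, so their counts are independent and the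
  Laplace functional factors over the values of \<open>f\<close>.\<close>

lemma laplace_poisson_simple:
  assumes f: "simple_function \<nu> f" and fin: "\<And>a. f a < top"
  shows "(\<integral>\<^sup>+\<omega>. ennreal (enexp (\<integral>\<^sup>+a. f a \<partial>L \<omega>)) \<partial>M) =
    ennreal (enexp (\<integral>\<^sup>+a. ennreal (1 - enexp (f a)) \<partial>\<nu>))"
proof -
  define I where "I = f ` space \<nu>"
  define A where "A y = f -` {y} \<inter> space \<nu>" for y
  have I: "finite I" and A: "A y \<in> sets \<nu>" for y
    using simple_functionD[OF f] by (auto simp: I_def A_def)
  have inj: "inj_on A I" by (auto simp: inj_on_def I_def A_def)
  have indA: "indep_vars (\<lambda>_. borel) (\<lambda>B \<omega>. emeasure (L \<omega>) B) (A ` I)"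
  proof -
    have "disjoint (A ` I)" by (auto simp: disjoint_def A_def)
    then show ?thesis
      using PP I A unfolding poisson_process_def by (auto simp: image_subset_iff)
  qed
  \<comment> \<open>The independent counts are indexed by the sets themselves, so the value of
    \<open>f\<close> has to be recovered from its level set. Level sets of attained values are
    nonempty and hence distinct.\<close>
  define c where "c B = the_inv_into I A B" for B
  have c: "c (A y) = y" if "y \<in> I" for y
    using that inj by (simp add: c_def the_inv_into_f_f)
  have ind: "indep_vars (\<lambda>_. borel) (\<lambda>B \<omega>. ennreal (enexp (c B * emeasure (L \<omega>) B))) (A ` I)"
    by (rule indep_vars_compose2[OF indA, where Y = "\<lambda>B z. ennreal (enexp (c B * z))"]) measurable
  have "(\<integral>\<^sup>+\<omega>. ennreal (enexp (\<integral>\<^sup>+a. f a \<partial>L \<omega>)) \<partial>M) =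
      (\<integral>\<^sup>+\<omega>. (\<Prod>B\<in>A ` I. ennreal (enexp (c B * emeasure (L \<omega>) B))) \<partial>M)"
    using inj by (intro nn_integral_cong)
      (simp add: simple_integral_poisson[OF f] prod.reindex c prod_ennreal enexp_sum
        flip: I_def A_def)
  also have "\<dots> = (\<Prod>B\<in>A ` I. \<integral>\<^sup>+\<omega>. ennreal (enexp (c B * emeasure (L \<omega>) B)) \<partial>M)"
    using I ind by (intro indep_vars_nn_integral) auto
  also have "\<dots> = (\<Prod>y\<in>I. \<integral>\<^sup>+\<omega>. ennreal (enexp (y * emeasure (L \<omega>) (A y))) \<partial>M)"
    using inj by (simp add: prod.reindex c)
  also have "\<dots> = (\<Prod>y\<in>I. ennreal (enexp (ennreal (1 - enexp y) * emeasure \<nu> (A y))))"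
    using fin by (intro prod.cong refl laplace_poisson_emeasure A) (auto simp: I_def less_top)
  also have "\<dots> = ennreal (enexp (\<Sum>y\<in>I. ennreal (1 - enexp y) * emeasure \<nu> (A y)))"
    by (simp add: prod_ennreal enexp_sum)
  also have "(\<Sum>y\<in>I. ennreal (1 - enexp y) * emeasure \<nu> (A y)) =
      (\<Sum>y\<in>I. \<integral>\<^sup>+a. ennreal (1 - enexp y) * indicator (A y) a \<partial>\<nu>)"
    using A by (simp add: nn_integral_cmult_indicator)
  also have "\<dots> = (\<integral>\<^sup>+a. (\<Sum>y\<in>I. ennreal (1 - enexp y) * indicator (A y) a) \<partial>\<nu>)"
    using A by (subst nn_integral_sum) auto
  also have "\<dots> = (\<integral>\<^sup>+a. ennreal (1 - enexp (f a)) \<partial>\<nu>)"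
  proof (intro nn_integral_cong)
    fix a assume a: "a \<in> space \<nu>"
    have "(\<Sum>y\<in>I. ennreal (1 - enexp y) * indicator (A y) a) =
        (\<Sum>y\<in>I. if y = f a then ennreal (1 - enexp y) else 0)"
      using a by (intro sum.cong) (auto simp: A_def)
    also have "\<dots> = ennreal (1 - enexp (f a))" using a I by (simp add: I_def)
    finally show "(\<Sum>y\<in>I. ennreal (1 - enexp y) * indicator (A y) a) = ennreal (1 - enexp (f a))" .
  qed
  finally show ?thesis .
qed

text \<open>Approximation by increasing simple functions: the left side converges by domination by
  1, the right side monotonically because \<open>1 - enexp\<close> is increasing. Continuity of
  \<open>enexp\<close> at infinity lets both integrals diverge.\<close>

lemma laplace_poisson:
  assumes f: "f \<in> borel_measurable \<nu>"
  shows "(\<integral>\<^sup>+\<omega>. ennreal (enexp (\<integral>\<^sup>+a. f a \<partial>L \<omega>)) \<partial>M) =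
    ennreal (enexp (\<integral>\<^sup>+a. ennreal (1 - enexp (f a)) \<partial>\<nu>))"
proof -
  obtain U where U: "\<And>i. simple_function \<nu> (U i)" "incseq U" "\<And>i a. U i a < top"
      "\<And>a. (SUP i. U i a) = f a"
    using borel_measurable_implies_simple_function_sequence'[OF f] by metis
  have Um: "U i \<in> borel_measurable \<nu>" for i by (rule borel_measurable_simple_function[OF U(1)])
  have Ulim: "(\<lambda>i. U i a) \<longlonglongrightarrow> f a" for a
    using LIMSEQ_SUP[of "\<lambda>i. U i a"] U(2,4) by (auto simp: incseq_def le_fun_def)
  have "(\<lambda>i. \<integral>\<^sup>+\<omega>. ennreal (enexp (\<integral>\<^sup>+a. U i a \<partial>L \<omega>)) \<partial>M) \<longlonglongrightarrow>
      (\<integral>\<^sup>+\<omega>. ennreal (enexp (\<integral>\<^sup>+a. f a \<partial>L \<omega>)) \<partial>M)"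
  proof (rule nn_integral_dominated_convergence[where w = "\<lambda>_. 1"])
    show "(\<lambda>\<omega>. ennreal (enexp (\<integral>\<^sup>+a. U i a \<partial>L \<omega>))) \<in> borel_measurable M" for i
      using measurable_nn_integral_poisson[OF Um[of i]] by measurable
    show "(\<lambda>\<omega>. ennreal (enexp (\<integral>\<^sup>+a. f a \<partial>L \<omega>))) \<in> borel_measurable M"
      using measurable_nn_integral_poisson[OF f] by measurable
    have "(\<lambda>i. \<integral>\<^sup>+a. U i a \<partial>L \<omega>) \<longlonglongrightarrow> (\<integral>\<^sup>+a. f a \<partial>L \<omega>)" if "\<omega> \<in> space M" for \<omega>
      using LIMSEQ_SUP[of "\<lambda>i. \<integral>\<^sup>+a. U i a \<partial>L \<omega>"] nn_integral_poisson_SUP[OF Um U(2) that] U(2,4)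
      by (auto simp: incseq_def le_fun_def intro!: nn_integral_mono)
    then show "AE \<omega> in M. (\<lambda>i. ennreal (enexp (\<integral>\<^sup>+a. U i a \<partial>L \<omega>))) \<longlonglongrightarrow> ennreal (enexp (\<integral>\<^sup>+a. f a \<partial>L \<omega>))"
      by (auto intro!: tendsto_ennrealI tendsto_enexp)
  qed (auto simp: emeasure_space_1)
  moreover have "(\<lambda>i. ennreal (enexp (\<integral>\<^sup>+a. ennreal (1 - enexp (U i a)) \<partial>\<nu>))) \<longlonglongrightarrow>
      ennreal (enexp (\<integral>\<^sup>+a. ennreal (1 - enexp (f a)) \<partial>\<nu>))"
  proof (rule tendsto_ennrealI, rule tendsto_enexp, rule nn_integral_LIMSEQ)
    show "incseq (\<lambda>i a. ennreal (1 - enexp (U i a)))"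
      using U(2) by (auto simp: incseq_def le_fun_def intro!: ennreal_leI enexp_antimono)
    show "(\<lambda>a. ennreal (1 - enexp (U i a))) \<in> borel_measurable \<nu>" for i using Um[of i] by measurable
    show "(\<lambda>i. ennreal (1 - enexp (U i a))) \<longlonglongrightarrow> ennreal (1 - enexp (f a))" for a
      by (intro tendsto_ennrealI tendsto_intros tendsto_enexp Ulim)
  qed
  ultimately show ?thesis
    unfolding laplace_poisson_simple[OF U(1,3)] by (rule LIMSEQ_unique)
qed

end

section \<open>MacMahon's master theorem\<close>

lemma suminf_swap_ennreal:
  fixes g :: "nat \<Rightarrow> nat \<Rightarrow> ennreal"
  shows "(\<Sum>n. \<Sum>k. g n k) = (\<Sum>k. \<Sum>n. g n k)"
proof -
  have "(\<integral>\<^sup>+n. \<integral>\<^sup>+k. g n k \<partial>count_space UNIV \<partial>count_space UNIV) =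
      (\<integral>\<^sup>+k. \<integral>\<^sup>+n. g n k \<partial>count_space UNIV \<partial>count_space UNIV)"
    using nn_integral_fst_count_space[of "\<lambda>(n, k). g n k"]
      nn_integral_snd_count_space[of "\<lambda>(n, k). g n k"] by simp
  then show ?thesis by (simp add: nn_integral_count_space_nat)
qed

lemma fps_power_coeffs_sums:
  fixes a :: "real fps"
  assumes "\<And>n. 0 \<le> fps_nth a n" "(\<lambda>n. fps_nth a n) sums s"
  shows "(\<forall>n. 0 \<le> fps_nth (a ^ k) n) \<and> (\<lambda>n. fps_nth (a ^ k) n) sums s ^ k"
proof (induction k)
  case 0
  have "(\<lambda>n. fps_nth (1::real fps) n) sums (\<Sum>n\<in>{0}. fps_nth (1::real fps) n)"
    by (rule sums_finite) auto
  then show ?case by simp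
next
  case (Suc k)
  have "(\<lambda>n. \<Sum>i\<le>n. fps_nth a i * fps_nth (a ^ k) (n - i)) sums ((\<Sum>n. fps_nth a n) * (\<Sum>n. fps_nth (a ^ k) n))"
    using Suc assms by (intro Cauchy_product_sums) (auto simp: sums_iff)
  then show ?case
    using Suc assms by (auto simp: fps_mult_nth sums_iff atLeast0AtMost intro!: sum_nonneg)
qed

text \<open>The recursion is the coefficient form of F' = F L' for L = sum of p_m z^m / m, so F =
  exp L as formal power series. Evaluation at z = 1 interchanges two series of nonnegative terms and
  thus requires only the convergence of L.\<close>

lemma exp_newton_sums:
  fixes p f :: "nat \<Rightarrow> real"
  assumes p: "\<And>n. 0 \<le> p n" and f0: "f 0 = 1"
    and newton: "\<And>n. real n * f n = (\<Sum>m=1..n. p m * f (n - m))"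
    and sums: "(\<lambda>m. p m / real m) sums s"
  shows "f sums exp s" and "\<And>n. 0 \<le> f n"
proof -
  define l where "l = Abs_fps (\<lambda>m. p m / real m)"
  have l: "fps_nth l m = p m / real m" for m by (simp add: l_def)
  \<comment> \<open>Division by 0 gives 0 in HOL, so \<open>l\<close> has no constant term whatever
    \<open>p 0\<close> is; for traces, \<open>p 0\<close> will be the number of vertices.\<close>
  have l0: "fps_nth l 0 = 0" by (simp add: l)
  define e where "e = fps_exp 1 oo l"
  have deriv: "fps_deriv e = e * fps_deriv l"
    using fps_compose_deriv[OF l0, of "fps_exp 1"] by (simp add: e_def)
  have e: "real (Suc n) * fps_nth e (Suc n) = (\<Sum>i=0..n. fps_nth e i * p (Suc n - i))" for n
  proof -
    have "fps_nth (fps_deriv e) n = (\<Sum>i=0..n. fps_nth e i * fps_nth (fps_deriv l) (n - i))"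
      by (simp only: deriv fps_mult_nth)
    also have "\<dots> = (\<Sum>i=0..n. fps_nth e i * p (Suc n - i))"
      by (intro sum.cong refl) (simp add: l Suc_diff_le)
    finally show ?thesis by simp
  qed
  have fe: "f n = fps_nth e n" for n
  proof (induction n rule: less_induct)
    case (less n)
    show ?case
    proof (cases n)
      case 0
      then show ?thesis by (simp add: f0 e_def fps_compose_nth)
    next
      case (Suc k)
      have "real (Suc k) * f (Suc k) = (\<Sum>m\<in>{1..Suc k}. p m * fps_nth e (Suc k - m))"
        unfolding newton by (intro sum.cong refl) (use less Suc in auto)
      also have "\<dots> = (\<Sum>i\<in>{0..k}. fps_nth e i * p (Suc k - i))"
        by (rule sum.reindex_bij_witness[of _ "\<lambda>i. Suc k - i" "\<lambda>i. Suc k - i"]) auto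
      also have "\<dots> = real (Suc k) * fps_nth e (Suc k)" by (simp only: e)
      finally show ?thesis using Suc by simp
    qed
  qed
  have pow: "0 \<le> fps_nth (l ^ k) n" "(\<lambda>n. fps_nth (l ^ k) n) sums s ^ k" for k n
    using fps_power_coeffs_sums[of l s k] p sums by (auto simp: l)
  have s: "0 \<le> s" using pow(1,2)[of 1] by (intro sums_le[OF _ sums_zero sums]) (auto simp: p)
  have en: "fps_nth e n = (\<Sum>k. fps_nth (l ^ k) n / fact k)" for n
  proof -
    have "(\<Sum>k. fps_nth (l ^ k) n / fact k) = (\<Sum>k\<in>{0..n}. fps_nth (l ^ k) n / fact k)"
      using startsby_zero_power_prefix[OF l0] by (intro suminf_finite) auto
    then show ?thesis by (simp add: e_def fps_compose_nth)
  qed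
  have sumk: "summable (\<lambda>k. fps_nth (l ^ k) n / fact k)" for n
    using startsby_zero_power_prefix[OF l0] by (intro summable_finite[of "{0..n}"]) auto
  have e_nonneg: "0 \<le> fps_nth e n" for n
    unfolding en using sumk pow by (intro suminf_nonneg) auto
  then show "\<And>n. 0 \<le> f n" by (simp add: fe)
  have "(\<Sum>n. ennreal (fps_nth e n)) = (\<Sum>n. \<Sum>k. ennreal (fps_nth (l ^ k) n / fact k))"
    unfolding en using sumk pow by (subst suminf_ennreal2) auto
  also have "\<dots> = (\<Sum>k. \<Sum>n. ennreal (fps_nth (l ^ k) n / fact k))" by (rule suminf_swap_ennreal)
  also have "\<dots> = (\<Sum>k. ennreal (s ^ k / fact k))"
    using pow by (intro suminf_cong suminf_ennreal_eq sums_divide) auto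
  also have "\<dots> = ennreal (exp s)"
    using exp_converges[of s] s by (intro suminf_ennreal_eq) (auto simp: divide_inverse_commute)
  finally have sum_e: "(\<Sum>n. ennreal (fps_nth e n)) = ennreal (exp s)" .
  have "summable (\<lambda>n. fps_nth e n)" using e_nonneg sum_e by (intro summable_suminf_not_top) auto
  then have "(\<lambda>n. fps_nth e n) sums exp s"
    using sum_e e_nonneg by (simp add: suminf_ennreal2 suminf_nonneg sums_iff)
  then show "f sums exp s" by (simp add: fe[abs_def])
qed

section \<open>Generating functions of networks\<close>

primrec mpow :: "('v::finite \<Rightarrow> 'v \<Rightarrow> real) \<Rightarrow> nat \<Rightarrow> 'v \<Rightarrow> 'v \<Rightarrow> real" where
  "mpow Q 0 a b = of_bool (a = b)"
| "mpow Q (Suc n) a b = (\<Sum>c\<in>UNIV. Q a c * mpow Q n c b)"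

definition jump_total :: "('v::finite \<Rightarrow> 'v \<Rightarrow> nat) \<Rightarrow> nat" where
  "jump_total k = (\<Sum>x\<in>UNIV. \<Sum>y\<in>UNIV. k x y)"

text \<open>The quotient of factorials is a product of multinomial coefficients, one per vertex: it
  counts the orderings of the arrows leaving each vertex.\<close>

definition network_weight :: "('v::finite \<Rightarrow> 'v \<Rightarrow> real) \<Rightarrow> ('v \<Rightarrow> 'v \<Rightarrow> nat) \<Rightarrow> real" where
  "network_weight Q k = (\<Prod>x\<in>UNIV. fact (vertex_degree k x)) / (\<Prod>x\<in>UNIV. \<Prod>y\<in>UNIV. fact (k x y)) *
     (\<Prod>x\<in>UNIV. \<Prod>y\<in>UNIV. Q x y ^ k x y)"

text \<open>The imbalance of degrees is that of a path from \<open>a\<close> to \<open>b\<close>;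
  the balance equation is written additively to avoid subtraction of natural numbers and to cover a
  = b, where it says Eulerian.\<close>

definition flows :: "'v \<Rightarrow> 'v \<Rightarrow> nat \<Rightarrow> ('v::finite \<Rightarrow> 'v \<Rightarrow> nat) set" where
  "flows a b n = {k. jump_total k = n \<and>
     (\<forall>x. vertex_degree k x + of_bool (x = b) = (\<Sum>y\<in>UNIV. k y x) + of_bool (x = a))}"

definition eulerians :: "nat \<Rightarrow> ('v::finite \<Rightarrow> 'v \<Rightarrow> nat) set" where
  "eulerians n = {k. jump_total k = n \<and> eulerian k}"

lemma flows_diag: "flows a a n = eulerians n"
  by (auto simp: flows_def eulerians_def eulerian_def vertex_degree_def)

lemma finite_jump_total_eq: "finite {k :: 'v::finite \<Rightarrow> 'v \<Rightarrow> nat. jump_total k = n}"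
proof -
  have fin: "finite {f :: 'v \<Rightarrow> 'b. \<forall>x. f x \<in> B}" if "finite B" for B :: "'b set"
    using finite_PiE[of "UNIV :: 'v set" "\<lambda>_. B"] that by (simp add: PiE_def Pi_def)
  have "k x y \<le> jump_total k" for k :: "'v \<Rightarrow> 'v \<Rightarrow> nat" and x y
  proof -
    have "k x y \<le> (\<Sum>y\<in>UNIV. k x y)" by (rule member_le_sum) auto
    also have "\<dots> \<le> jump_total k" unfolding jump_total_def by (rule member_le_sum) auto
    finally show ?thesis .
  qed
  then have "{k :: 'v \<Rightarrow> 'v \<Rightarrow> nat. jump_total k = n} \<subseteq> {k. \<forall>x. k x \<in> {g. \<forall>y. g y \<in> {..n}}}" by auto
  then show ?thesis by (rule finite_subset) (intro fin finite_atMost)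
qed

lemma finite_flows: "finite (flows a b n)"
  by (rule finite_subset[OF _ finite_jump_total_eq[of n]]) (auto simp: flows_def)

definition add_edge :: "'v \<Rightarrow> 'v \<Rightarrow> ('v \<Rightarrow> 'v \<Rightarrow> nat) \<Rightarrow> 'v \<Rightarrow> 'v \<Rightarrow> nat" where
  "add_edge a c k = (\<lambda>x y. k x y + of_bool (x = a \<and> y = c))"

lemma vertex_degree_add_edge: "vertex_degree (add_edge a c k) x = vertex_degree k x + of_bool (x = a)"
  by (auto simp: vertex_degree_def add_edge_def sum.distrib of_bool_def)

lemma in_degree_add_edge: "(\<Sum>y\<in>UNIV. add_edge a c k y x) = (\<Sum>y\<in>UNIV. k y x) + of_bool (x = (c::'v::finite))"
  by (auto simp: add_edge_def sum.distrib of_bool_def)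

lemma jump_total_add_edge: "jump_total (add_edge a c k) = Suc (jump_total k)"
  using vertex_degree_add_edge[of a c k]
  by (simp add: jump_total_def vertex_degree_def sum.distrib of_bool_def)

lemma add_edge_flows_iff: "add_edge a c k \<in> flows a b (Suc n) \<longleftrightarrow> k \<in> flows c b n"
  unfolding flows_def mem_Collect_eq jump_total_add_edge vertex_degree_add_edge in_degree_add_edge by auto

text \<open>Cross-multiplied, because the entry at (a, c) may be 0 and cannot always be
  cancelled.\<close>

lemma prod_pair_update:
  fixes g h :: "'a::finite \<Rightarrow> 'b::finite \<Rightarrow> 'c::comm_monoid_mult"
  assumes "\<And>x y. (x, y) \<noteq> (a, c) \<Longrightarrow> g x y = h x y"
  shows "(\<Prod>x\<in>UNIV. \<Prod>y\<in>UNIV. g x y) * h a c = (\<Prod>x\<in>UNIV. \<Prod>y\<in>UNIV. h x y) * g a c"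
proof -
  have "(\<Prod>z\<in>UNIV - {(a, c)}. case z of (x, y) \<Rightarrow> g x y) = (\<Prod>z\<in>UNIV - {(a, c)}. case z of (x, y) \<Rightarrow> h x y)"
    by (intro prod.cong refl) (use assms in force)
  then show ?thesis
    by (simp add: prod.cartesian_product prod.remove[of "UNIV :: ('a \<times> 'b) set" "(a, c)"] mult_ac)
qed

text \<open>A new arrow from a to c changes only the multinomial coefficient at a, by the ratio of
  the new out-degree to the new multiplicity, and adds one factor \<open>Q a c\<close>.\<close>

lemma network_weight_add_edge:
  "network_weight Q (add_edge a c k) * real (add_edge a c k a c) =
    Q a c * network_weight Q k * real (vertex_degree (add_edge a c k) a)"
proof -
  let ?k = "add_edge a c k"
  have k: "?k x y = k x y" if "(x, y) \<noteq> (a, c)" for x y using that by (auto simp: add_edge_def)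
  have kac: "?k a c = Suc (k a c)" by (simp add: add_edge_def)
  have deg: "(\<Prod>x\<in>UNIV. fact (vertex_degree ?k x)) =
      (\<Prod>x\<in>UNIV. fact (vertex_degree k x)) * real (vertex_degree ?k a)"
    by (subst (1 2) prod.remove[of _ a]) (auto simp: vertex_degree_add_edge)
  have nz: "(\<Prod>x\<in>UNIV. \<Prod>y\<in>UNIV. fact (k x y) :: real) \<noteq> 0" for k :: "'a \<Rightarrow> 'a \<Rightarrow> nat"
    by simp
  have "(\<Prod>x\<in>UNIV. \<Prod>y\<in>UNIV. fact (?k x y)) * fact (k a c) =
      (\<Prod>x\<in>UNIV. \<Prod>y\<in>UNIV. fact (k x y)) * (fact (?k a c) :: real)"
    by (rule prod_pair_update) (simp add: k)
  then have 1: "(\<Prod>x\<in>UNIV. \<Prod>y\<in>UNIV. fact (?k x y)) =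
      (\<Prod>x\<in>UNIV. \<Prod>y\<in>UNIV. fact (k x y)) * real (?k a c)"
    by (simp add: kac)
  \<comment> \<open>Since \<open>Q a c\<close> may vanish, the two products are compared through a
    third one whose entry at (a, c) is 1.\<close>
  have "(\<Prod>x\<in>UNIV. \<Prod>y\<in>UNIV. (if (x, y) = (a, c) then 1 else Q x y ^ ?k x y)) * Q a c ^ k a c =
      (\<Prod>x\<in>UNIV. \<Prod>y\<in>UNIV. Q x y ^ k x y) * (if (a, c) = (a, c) then 1 else Q a c ^ ?k a c)"
    by (rule prod_pair_update) (auto simp: k)
  moreover have "(\<Prod>x\<in>UNIV. \<Prod>y\<in>UNIV. Q x y ^ ?k x y) * (if (a, c) = (a, c) then 1 else Q a c ^ ?k a c) =
      (\<Prod>x\<in>UNIV. \<Prod>y\<in>UNIV. (if (x, y) = (a, c) then 1 else Q x y ^ ?k x y)) * Q a c ^ ?k a c"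
    by (rule prod_pair_update) auto
  ultimately have 2: "(\<Prod>x\<in>UNIV. \<Prod>y\<in>UNIV. Q x y ^ ?k x y) = (\<Prod>x\<in>UNIV. \<Prod>y\<in>UNIV. Q x y ^ k x y) * Q a c"
    by (simp add: kac mult_ac)
  have kpos: "real (?k a c) \<noteq> 0" by (simp add: kac)
  show ?thesis
    unfolding network_weight_def deg 1 2 using nz[of k] kpos by (simp add: divide_simps)
qed

definition eulerian_sum :: "('v::finite \<Rightarrow> 'v \<Rightarrow> real) \<Rightarrow> nat \<Rightarrow> real" where
  "eulerian_sum Q n = (\<Sum>k\<in>eulerians n. network_weight Q k)"

text \<open>
  The generating function of the networks with a unit flow from \<open>a\<close> to \<open>b\<close>, marked at \<open>b\<close>, is
  the derivative in \<open>Q b a\<close> of the generating function of Eulerian networks. Removing the first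
  arrow at \<open>a\<close> shows that it is the resolvent of \<open>Q\<close> times the latter.
\<close>

definition flow_sum :: "('v::finite \<Rightarrow> 'v \<Rightarrow> real) \<Rightarrow> 'v \<Rightarrow> 'v \<Rightarrow> nat \<Rightarrow> real" where
  "flow_sum Q a b n = (\<Sum>k\<in>flows a b n. real (vertex_degree k b + 1) * network_weight Q k)"

text \<open>Each network is averaged over its arrows leaving \<open>a\<close>, an arrow to c having
  share k_ac / k_a. Deleting that arrow leaves a flow from c to \<open>b\<close>, and the change of
  weight cancels the share exactly.\<close>

lemma flow_sum_Suc:
  "flow_sum Q a b (Suc n) = of_bool (a = b) * eulerian_sum Q (Suc n) + (\<Sum>c\<in>UNIV. Q a c * flow_sum Q c b n)"
proof -
  \<comment> \<open>The mark k_b + 1 as it reads after an arrow leaving \<open>a\<close> has been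
    deleted: it drops by one when a = b. This defect produces the term with
    \<open>eulerian_sum\<close>.\<close>
  define D where "D k = real (vertex_degree k b + 1) - of_bool (a = b)" for k
  have "(\<Sum>c\<in>UNIV. Q a c * flow_sum Q c b n) =
      (\<Sum>(c, k)\<in>(SIGMA c:UNIV. flows c b n). Q a c * (real (vertex_degree k b + 1) * network_weight Q k))"
    by (simp add: flow_sum_def sum_distrib_left sum.Sigma finite_flows)
  also have "\<dots> = (\<Sum>(k, c)\<in>(SIGMA k:flows a b (Suc n). {c. k a c \<noteq> 0}).
      D k * network_weight Q k * (real (k a c) / real (vertex_degree k a)))"
  proof (rule sum.reindex_bij_witness[of _ "\<lambda>(k, c). (c, \<lambda>x y. k x y - of_bool (x = a \<and> y = c))"
        "\<lambda>(c, k). (add_edge a c k, c)"]; clarsimp)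
    fix c k assume k: "k \<in> flows c b n"
    show "(\<lambda>x y. add_edge a c k x y - of_bool (x = a \<and> y = c)) = k"
      by (auto simp: add_edge_def fun_eq_iff)
    show "add_edge a c k \<in> flows a b (Suc n) \<and> 0 < add_edge a c k a c"
      using k by (simp add: add_edge_flows_iff) (simp add: add_edge_def)
    have "D (add_edge a c k) = real (vertex_degree k b + 1)"
      by (simp add: D_def vertex_degree_add_edge)
    moreover have "0 < vertex_degree (add_edge a c k) a" by (simp add: vertex_degree_add_edge)
    ultimately show "D (add_edge a c k) * network_weight Q (add_edge a c k) * real (add_edge a c k a c)
          / real (vertex_degree (add_edge a c k) a) =
        Q a c * ((1 + real (vertex_degree k b)) * network_weight Q k)"
      using network_weight_add_edge[of Q a c k] by (simp add: field_simps)
  next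
    fix c k assume k: "k \<in> flows a b (Suc n)" "0 < k a c"
    have *: "add_edge a c (\<lambda>x y. k x y - of_bool (x = a \<and> y = c)) = k"
      using k(2) by (auto simp: add_edge_def fun_eq_iff)
    then show "add_edge a c (\<lambda>x y. k x y - of_bool (x = a \<and> y = c)) = k" .
    show "(\<lambda>x y. k x y - of_bool (x = a \<and> y = c)) \<in> flows c b n"
      using k(1) unfolding add_edge_flows_iff[of a c, symmetric] * .
  qed
  also have "\<dots> = (\<Sum>k\<in>flows a b (Suc n). \<Sum>c | k a c \<noteq> 0.
      D k * network_weight Q k * (real (k a c) / real (vertex_degree k a)))"
    by (subst sum.Sigma) (auto simp: finite_flows)
  also have "\<dots> = (\<Sum>k\<in>flows a b (Suc n). D k * network_weight Q k)"
  proof (intro sum.cong refl)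
    fix k assume k: "k \<in> flows a b (Suc n)"
    have "(\<Sum>c | k a c \<noteq> 0. real (k a c)) = real (vertex_degree k a)"
      unfolding vertex_degree_def of_nat_sum by (intro sum.mono_neutral_left) auto
    then have *: "(\<Sum>c | k a c \<noteq> 0. D k * network_weight Q k * (real (k a c) / real (vertex_degree k a))) =
        D k * network_weight Q k * (real (vertex_degree k a) / real (vertex_degree k a))"
      by (simp flip: sum_distrib_left sum_divide_distrib)
    show "(\<Sum>c | k a c \<noteq> 0. D k * network_weight Q k * (real (k a c) / real (vertex_degree k a))) =
        D k * network_weight Q k"
    \<comment> \<open>Averaging is impossible when no arrow leaves \<open>a\<close>. Then a = b,
      because a flow to another vertex has to leave \<open>a\<close>, and \<open>D k\<close> is
      0.\<close>
    proof (cases "vertex_degree k a = 0")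
      case True
      then have "a = b" using k by (cases "a = b") (auto simp: flows_def dest!: spec[of _ a])
      then show ?thesis using True by (simp add: D_def vertex_degree_def)
    next
      case False
      then show ?thesis unfolding * by simp
    qed
  qed
  also have "\<dots> = flow_sum Q a b (Suc n) - of_bool (a = b) * eulerian_sum Q (Suc n)"
    by (auto simp: flow_sum_def D_def eulerian_sum_def flows_diag algebra_simps sum_subtractf)
  finally show ?thesis by simp
qed

lemma flow_sum_0: "flow_sum Q a b 0 = of_bool (a = b) * eulerian_sum Q 0"
proof (cases "a = b")
  case True
  have "vertex_degree k b = 0" if "k \<in> eulerians 0" for k
    using that by (auto simp: eulerians_def jump_total_def vertex_degree_def)
  then show ?thesis using True by (simp add: flow_sum_def eulerian_sum_def flows_diag)
next
  case False
  have "flows a b 0 = {}"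
    using False by (auto simp: flows_def jump_total_def vertex_degree_def dest!: spec[of _ a])
  then show ?thesis using False by (simp add: flow_sum_def)
qed

lemma flow_sum_eq: "flow_sum Q a b n = (\<Sum>m\<le>n. mpow Q m a b * eulerian_sum Q (n - m))"
proof (induction n arbitrary: a)
  case (Suc n)
  have "(\<Sum>c\<in>UNIV. Q a c * flow_sum Q c b n) = (\<Sum>m\<le>n. mpow Q (Suc m) a b * eulerian_sum Q (n - m))"
    unfolding Suc by (simp add: sum_distrib_left sum_distrib_right mult.assoc) (rule sum.swap)
  then show ?case
    unfolding flow_sum_Suc by (subst sum.atMost_Suc_shift) simp
qed (simp add: flow_sum_0)

text \<open>Summed over a = b, the marks k_a + 1 of an Eulerian network with n jumps add up to n
  plus the number of vertices. The second summand cancels against the term m = 0, the trace of the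
  identity.\<close>

lemma eulerian_sum_newton:
  "real n * eulerian_sum Q n = (\<Sum>m=1..n. (\<Sum>a\<in>UNIV. mpow Q m a a) * eulerian_sum Q (n - m))"
proof -
  have "(\<Sum>a\<in>UNIV. flow_sum Q a a n) =
      (\<Sum>k\<in>eulerians n. (\<Sum>a\<in>UNIV. real (vertex_degree k a) + 1) * network_weight Q k)"
    unfolding flow_sum_def flows_diag by (subst sum.swap) (simp add: sum_distrib_right add.commute)
  also have "\<dots> = (\<Sum>k\<in>eulerians n. (real n + real CARD('a)) * network_weight Q k)"
    by (intro sum.cong refl) (auto simp: eulerians_def jump_total_def vertex_degree_def sum.distrib)
  also have "\<dots> = (real n + real CARD('a)) * eulerian_sum Q n"
    by (simp add: eulerian_sum_def sum_distrib_left)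
  finally have 1: "(\<Sum>a\<in>UNIV. flow_sum Q a a n) = (real n + real CARD('a)) * eulerian_sum Q n" .
  have "(\<Sum>a\<in>UNIV. flow_sum Q a a n) = (\<Sum>m\<le>n. (\<Sum>a\<in>UNIV. mpow Q m a a) * eulerian_sum Q (n - m))"
    unfolding flow_sum_eq by (subst sum.swap) (simp add: sum_distrib_right)
  also have "{..n} = insert 0 {1..n}" by auto
  finally show ?thesis using 1 by (simp add: distrib_right)
qed

lemma eulerian_sum_0: "eulerian_sum (Q :: 'a::finite \<Rightarrow> _) 0 = 1"
proof -
  have "eulerians 0 = {\<lambda>(_::'a) (_::'a). 0}"
    by (auto simp: eulerians_def jump_total_def eulerian_def fun_eq_iff)
  then show ?thesis by (simp add: eulerian_sum_def network_weight_def vertex_degree_def)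
qed

lemma mpow_nonneg: "(\<And>x y. 0 \<le> Q x y) \<Longrightarrow> 0 \<le> mpow Q n a b"
  by (induction n arbitrary: a) (auto intro!: sum_nonneg)

text \<open>Networks are grouped by their number of jumps, and Newton's recursion is solved by the
  exponential of the trace series. A network that uses a pair with \<open>Q x y = 0\<close> has
  weight 0, so summing over all matrices is harmless.\<close>

theorem macmahon_exp:
  fixes Q :: "'v::finite \<Rightarrow> 'v \<Rightarrow> real"
  assumes "\<And>x y. 0 \<le> Q x y" and "(\<lambda>n. (\<Sum>a\<in>UNIV. mpow Q n a a) / real n) sums s"
  shows "(\<integral>\<^sup>+k. ennreal (of_bool (eulerian k) * network_weight Q k) \<partial>count_space UNIV) = ennreal (exp s)"
proof -
  have w: "0 \<le> network_weight Q k" for k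
    unfolding network_weight_def using assms(1) by (intro mult_nonneg_nonneg divide_nonneg_nonneg prod_nonneg) auto
  have "(\<integral>\<^sup>+k. ennreal (of_bool (eulerian k) * network_weight Q k) \<partial>count_space UNIV) =
      (\<integral>\<^sup>+k. (\<Sum>n. ennreal (network_weight Q k) * indicator (eulerians n) k) \<partial>count_space UNIV)"
  proof (intro nn_integral_cong)
    fix k :: "'v \<Rightarrow> 'v \<Rightarrow> nat"
    have eul: "k \<in> eulerians (jump_total k) \<longleftrightarrow> eulerian k" by (simp add: eulerians_def)
    have "(\<Sum>n. ennreal (network_weight Q k) * indicator (eulerians n) k) =
        (\<Sum>n\<in>{jump_total k}. ennreal (network_weight Q k) * indicator (eulerians n) k)"
    proof (rule suminf_finite)
      fix n assume "n \<notin> {jump_total k}"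
      then have "k \<notin> eulerians n" by (auto simp: eulerians_def)
      then show "ennreal (network_weight Q k) * indicator (eulerians n) k = 0" by simp
    qed simp
    also have "\<dots> = ennreal (of_bool (eulerian k) * network_weight Q k)"
      using eul by (cases "eulerian k") simp_all
    finally show "ennreal (of_bool (eulerian k) * network_weight Q k) =
        (\<Sum>n. ennreal (network_weight Q k) * indicator (eulerians n) k)" ..
  qed
  also have "\<dots> = (\<Sum>n. \<integral>\<^sup>+k. ennreal (network_weight Q k) * indicator (eulerians n) k \<partial>count_space UNIV)"
    by (rule nn_integral_suminf) auto
  also have "\<dots> = (\<Sum>n. ennreal (eulerian_sum Q n))"
  proof (intro suminf_cong)
    fix n
    have fin: "finite (eulerians n :: ('v \<Rightarrow> 'v \<Rightarrow> nat) set)" 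
      using finite_flows[of undefined undefined n] by (simp only: flows_diag)
    show "(\<integral>\<^sup>+k. ennreal (network_weight Q k) * indicator (eulerians n) k \<partial>count_space UNIV) =
        ennreal (eulerian_sum Q n)"
      using fin w by (simp add: nn_integral_count_space_indicator[symmetric] nn_integral_count_space_finite
        eulerian_sum_def sum_ennreal)
  qed
  also have "\<dots> = ennreal (exp s)"
    using exp_newton_sums[OF _ eulerian_sum_0 eulerian_sum_newton assms(2)] assms(1)
    by (intro suminf_ennreal_eq) (auto intro!: sum_nonneg mpow_nonneg)
  finally show ?thesis .
qed

section \<open>The determinant as an exponential\<close>

text \<open>Cramer's rule for rows. If A' = H A, it turns the k-th term of the row-wise derivative
  of det A into H_kk det A, hence the derivative into a trace.\<close>

lemma det_replace_row_combination:
  fixes A :: "real^'n^'n"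
  shows "det (\<chi> i. if i = k then (\<Sum>j\<in>UNIV. x j *\<^sub>R A $ j) else A $ i) = x k * det A"
proof -
  have row: "A $ i = row i A" for i by (simp add: row_def vec_eq_iff)
  show ?thesis
    using cramer_lemma_transpose[of k "vec_lambda x" A]
    unfolding row vec_lambda_beta scalar_mult_eq_scaleR .
qed

text \<open>The product rule applied to each term of the permutation expansion, with the
  differentiated factor collected by rows.\<close>

lemma has_field_derivative_det:
  fixes A :: "real \<Rightarrow> real^'n^'n"
  assumes "\<And>i j. ((\<lambda>t. A t $ i $ j) has_field_derivative A' $ i $ j) (at t)"
  shows "((\<lambda>t. det (A t)) has_field_derivative
    (\<Sum>k\<in>UNIV. det (\<chi> i. if i = k then A' $ k else A t $ i))) (at t)"
proof -
  have "((\<lambda>t. det (A t)) has_field_derivative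
      (\<Sum>p | p permutes UNIV. of_int (sign p) *
        (\<Sum>k\<in>UNIV. A' $ k $ p k * (\<Prod>i\<in>UNIV - {k}. A t $ i $ p i)))) (at t)"
    unfolding det_def
    by (intro DERIV_sum DERIV_cmult has_field_derivative_prod assms)
  moreover
  have "(\<Prod>i\<in>UNIV. (\<chi> i. if i = k then A' $ k else A t $ i) $ i $ p i) =
      A' $ k $ p k * (\<Prod>i\<in>UNIV - {k}. A t $ i $ p i)" for k p
  proof -
    have "(\<Prod>i\<in>UNIV - {k}. (\<chi> i. if i = k then A' $ k else A t $ i) $ i $ p i) =
        (\<Prod>i\<in>UNIV - {k}. A t $ i $ p i)"
      by (intro prod.cong) auto
    then show ?thesis by (subst prod.remove[of _ k]) auto
  qed
  then have "(\<Sum>p | p permutes UNIV. of_int (sign p) *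
        (\<Sum>k\<in>UNIV. A' $ k $ p k * (\<Prod>i\<in>UNIV - {k}. A t $ i $ p i))) =
      (\<Sum>k\<in>UNIV. det (\<chi> i. if i = k then A' $ k else A t $ i))"
    unfolding det_def sum_distrib_left by (subst sum.swap) (simp only:)
  ultimately show ?thesis by simp
qed

lemma mpow_Suc_right: "mpow Q (Suc n) a b = (\<Sum>c\<in>UNIV. mpow Q n a c * Q c b)"
proof (induction n arbitrary: a)
  case (Suc n)
  have "mpow Q (Suc (Suc n)) a b = (\<Sum>d\<in>UNIV. Q a d * (\<Sum>c\<in>UNIV. mpow Q n d c * Q c b))"
    unfolding Suc[symmetric] by simp
  also have "\<dots> = (\<Sum>c\<in>UNIV. mpow Q (Suc n) a c * Q c b)"
    by (simp add: sum_distrib_left sum_distrib_right mult.assoc) (rule sum.swap)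
  finally show ?case .
qed simp

text \<open>Along A(t) = I - tP, the product of det A(t) and exp l(t), with l(t) the sum of tr(P^n)
  t^n / n, has derivative 0: both logarithmic derivatives are the trace of P (I - tP)^(-1), up to
  sign. Bounded powers give convergence for t < 1; the endpoint t = 1 is reached by continuity
  alone, through the assumed convergence of the trace series.\<close>

lemma det_one_minus_eq_exp:
  fixes P :: "'v::finite \<Rightarrow> 'v \<Rightarrow> real"
  assumes P: "\<And>x y. 0 \<le> P x y" and bound: "\<And>n a b. mpow P n a b \<le> K"
    and sums: "(\<lambda>n. (\<Sum>a\<in>UNIV. mpow P n a a) / real n) sums s"
  shows "det (\<chi> i j. of_bool (i = j) - P i j) = exp (- s)"
proof -
  define A where "A t = (\<chi> i j. of_bool (i = j) - t * P i j)" for t :: real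
  define c where "c n = (\<Sum>a\<in>UNIV. mpow P n a a) / real n" for n
  define l where "l t = (\<Sum>n. c n * t ^ n)" for t
  have c: "0 \<le> c n" for n
    unfolding c_def by (intro divide_nonneg_nonneg sum_nonneg mpow_nonneg P) auto
  have sumc: "summable c" using sums by (simp add: c_def[abs_def] sums_iff)
  have cont: "continuous_on {0..1} l"
  proof -
    have "uniform_limit {0..1} (\<lambda>n t. \<Sum>i<n. c i * t ^ i) (\<lambda>t. \<Sum>i. c i * t ^ i) sequentially"
      using sumc by (intro Weierstrass_m_test) (auto simp: c abs_mult power_abs intro!: mult_left_le power_le_one)
    then show ?thesis unfolding l_def
      by (rule uniform_limit_theorem[rotated]) (auto intro!: always_eventually continuous_intros)
  qed
  have contA: "continuous_on {0..1} (\<lambda>t. det (A t))"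
    unfolding A_def det_def by (auto intro!: continuous_intros)
  have deriv: "((\<lambda>t. det (A t) * exp (l t)) has_field_derivative 0) (at t)" if t: "0 < t" "t < 1" for t
  proof -
    \<comment> \<open>The Neumann series of P (I - tP)^(-1).\<close>
    define H where "H i j = (\<Sum>n. mpow P (Suc n) i j * t ^ n)" for i j
    have sumH: "summable (\<lambda>n. mpow P (Suc n) i j * t ^ n)" for i j
    proof (rule summable_comparison_test')
      show "summable (\<lambda>n. K * t ^ n)" using t by (intro summable_mult summable_geometric) auto
      show "norm (mpow P (Suc n) i j * t ^ n) \<le> K * t ^ n" for n
        using t bound[of "Suc n" i j] mpow_nonneg[of P "Suc n" i j, OF P]
        by (simp add: abs_mult mult_right_mono del: mpow.simps)
    qed
    \<comment> \<open>Splitting off the first term gives H = P + t H P, that is, H (I - tP) =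
      P.\<close>
    have H: "(\<Sum>j\<in>UNIV. H i j * A t $ j $ k) = P i k" for i k
    proof -
      have "(\<Sum>j\<in>UNIV. H i j * P j k) = (\<Sum>j\<in>UNIV. \<Sum>n. mpow P (Suc n) i j * t ^ n * P j k)"
        unfolding H_def using sumH by (intro sum.cong refl suminf_mult2) auto
      also have "\<dots> = (\<Sum>n. \<Sum>j\<in>UNIV. mpow P (Suc n) i j * t ^ n * P j k)"
        using sumH by (intro suminf_sum[symmetric] summable_mult2) auto
      also have "\<dots> = (\<Sum>n. mpow P (Suc (Suc n)) i k * t ^ n)"
        unfolding mpow_Suc_right[where n = "Suc n" for n] by (simp add: sum_distrib_left mult_ac del: mpow.simps)
      finally have HP: "(\<Sum>j\<in>UNIV. H i j * P j k) = (\<Sum>n. mpow P (Suc (Suc n)) i k * t ^ n)" .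
      have "H i k = P i k + t * (\<Sum>n. mpow P (Suc (Suc n)) i k * t ^ n)"
      proof -
        have "summable (\<lambda>n. mpow P (Suc (Suc n)) i k * t ^ n)"
        proof (rule summable_comparison_test')
          show "summable (\<lambda>n. K * t ^ n)" using t by (intro summable_mult summable_geometric) auto
          show "norm (mpow P (Suc (Suc n)) i k * t ^ n) \<le> K * t ^ n" for n
            using t bound[of "Suc (Suc n)" i k] mpow_nonneg[of P "Suc (Suc n)" i k, OF P]
            by (simp add: abs_mult mult_right_mono del: mpow.simps)
        qed
        then have "t * (\<Sum>n. mpow P (Suc (Suc n)) i k * t ^ n) =
            (\<Sum>n. mpow P (Suc (Suc n)) i k * t ^ Suc n)"
          by (subst suminf_mult[symmetric]) (simp_all add: mult_ac del: mpow.simps)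
        also have "\<dots> = H i k - mpow P (Suc 0) i k"
          unfolding H_def using suminf_split_head[OF sumH[of i k]] by (simp del: mpow.simps)
        finally show ?thesis by (simp add: of_bool_def if_distrib cong: if_cong)
      qed
      then have "H i k = P i k + t * (\<Sum>j\<in>UNIV. H i j * P j k)" by (simp add: HP)
      moreover have "(\<Sum>j\<in>UNIV. H i j * A t $ j $ k) =
          (\<Sum>j\<in>UNIV. H i j * of_bool (j = k)) - t * (\<Sum>j\<in>UNIV. H i j * P j k)"
        by (simp add: A_def right_diff_distrib sum_subtractf sum_distrib_left mult_ac)
      moreover have "(\<Sum>j\<in>UNIV. H i j * of_bool (j = k)) = H i k"
        by (simp add: of_bool_def if_distrib cong: if_cong)
      ultimately show ?thesis by linarith
    qed
    have "((\<lambda>t. det (A t)) has_field_derivative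
        (\<Sum>k\<in>UNIV. det (\<chi> i. if i = k then (\<chi> i j. - P i j) $ k else A t $ i))) (at t)"
      by (intro has_field_derivative_det) (auto simp: A_def intro!: derivative_eq_intros)
    moreover have "(\<chi> i j. - P i j) $ k = (\<Sum>j\<in>UNIV. (- H k j) *\<^sub>R A t $ j)" for k
      by (simp add: vec_eq_iff H sum_negf)
    then have "det (\<chi> i. if i = k then (\<chi> i j. - P i j) $ k else A t $ i) = - H k k * det (A t)" for k
      by (simp only: det_replace_row_combination)
    ultimately have dA: "((\<lambda>t. det (A t)) has_field_derivative (\<Sum>k\<in>UNIV. - H k k * det (A t))) (at t)"
      by (simp only:)
    have "(l has_field_derivative (\<Sum>n. diffs c n * t ^ n)) (at t)"
      unfolding l_def using sumc t by (intro termdiffs_strong[of c 1]) auto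
    moreover have "diffs c n = (\<Sum>a\<in>UNIV. mpow P (Suc n) a a)" for n
      by (simp add: diffs_def c_def del: mpow.simps)
    then have "(\<Sum>n. diffs c n * t ^ n) = (\<Sum>k\<in>UNIV. H k k)"
      unfolding H_def using sumH by (subst suminf_sum[symmetric]) (auto simp: sum_distrib_right simp del: mpow.simps)
    ultimately have dl: "(l has_field_derivative (\<Sum>k\<in>UNIV. H k k)) (at t)" by simp
    show ?thesis
      by (rule DERIV_cong[OF DERIV_mult[OF dA DERIV_fun_exp[OF dl]]])
        (simp add: sum_distrib_left sum_distrib_right sum_negf mult_ac)
  qed
  have "det (A 1) * exp (l 1) = det (A 0) * exp (l 0)"
    by (rule DERIV_isconst_end) (auto intro!: continuous_intros cont contA deriv)
  moreover have "A 0 = mat 1" by (simp add: A_def mat_def vec_eq_iff)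
  \<comment> \<open>Only the term n = 0 survives, by 0^0 = 1, and its coefficient is a division by
    0, hence 0.\<close>
  moreover have "l 0 = 0"
    unfolding l_def using suminf_finite[of "{0}" "\<lambda>n. c n * 0 ^ n"] by (simp add: c_def)
  moreover have "l 1 = s" using sums by (simp add: l_def c_def[abs_def] sums_iff)
  ultimately have "det (A 1) * exp s = 1" by simp
  then have "det (A 1) = exp (- s)" by (simp add: exp_minus field_simps)
  then show ?thesis by (simp add: A_def)
qed

text \<open>The partial sums S_n of the powers satisfy (I - P) S_n = I - P^n. Multiplying by an
  inverse of I - P bounds S_n uniformly, and the terms are nonnegative.\<close>

lemma summable_mpow:
  fixes P :: "'v::finite \<Rightarrow> 'v \<Rightarrow> real"
  assumes P: "\<And>x y. 0 \<le> P x y" and bound: "\<And>n a b. mpow P n a b \<le> K"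
    and det: "det (\<chi> i j. of_bool (i = j) - P i j) \<noteq> 0"
  shows "summable (\<lambda>n. mpow P n a b)"
proof -
  obtain B :: "real^'v^'v" where B: "B ** (\<chi> i j. of_bool (i = j) - P i j) = mat 1"
    using det invertible_det_nz invertible_left_inverse by blast
  define S where "S n = (\<chi> i j. \<Sum>m<n. mpow P m i j)" for n
  have AS: "(\<chi> i j. of_bool (i = j) - P i j) ** S n = (\<chi> i j. of_bool (i = j) - mpow P n i j)" for n
  proof -
    have "(\<Sum>k\<in>UNIV. (of_bool (i = k) - P i k) * (\<Sum>m<n. mpow P m k j)) =
        of_bool (i = j) - mpow P n i j" for i j
    proof -
      have "(\<Sum>k\<in>UNIV. P i k * (\<Sum>m<n. mpow P m k j)) = (\<Sum>m<n. mpow P (Suc m) i j)"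
        by (simp add: sum_distrib_left) (rule sum.swap)
      moreover have "(\<Sum>k\<in>UNIV. of_bool (i = k) * (\<Sum>m<n. mpow P m k j)) = (\<Sum>m<n. mpow P m i j)"
        by (simp add: of_bool_def if_distrib if_distribR cong: if_cong)
      moreover have "(\<Sum>m<n. mpow P m i j) - (\<Sum>m<n. mpow P (Suc m) i j) = mpow P 0 i j - mpow P n i j"
        unfolding sum_subtractf[symmetric] by (rule sum_lessThan_telescope')
      ultimately show ?thesis
        by (simp only: left_diff_distrib sum_subtractf) (simp only: mpow.simps(1))
    qed
    then show ?thesis
      by (simp only: vec_eq_iff matrix_matrix_mult_def S_def vec_lambda_beta simp_thms)
  qed
  have S: "S n = B ** (\<chi> i j. of_bool (i = j) - mpow P n i j)" for n
    unfolding AS[symmetric] matrix_mul_assoc B by (rule matrix_mul_lid[symmetric])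
  have "(\<Sum>m<n. mpow P m a b) = (\<Sum>k\<in>UNIV. B $ a $ k * (of_bool (k = b) - mpow P n k b))" for n
    using arg_cong[OF S[of n], of "\<lambda>A. A $ a $ b"]
    by (simp only: S_def matrix_matrix_mult_def vec_lambda_beta)
  moreover have "(\<Sum>k\<in>UNIV. B $ a $ k * (of_bool (k = b) - mpow P n k b)) \<le>
      (\<Sum>k\<in>UNIV. \<bar>B $ a $ k\<bar> * (1 + K))" for n
  proof (rule sum_mono)
    fix k
    have "\<bar>of_bool (k = b) - mpow P n k b\<bar> \<le> 1 + K"
      using bound[of n k b] mpow_nonneg[of P n k b, OF P] by (auto simp: of_bool_def)
    then have "\<bar>B $ a $ k * (of_bool (k = b) - mpow P n k b)\<bar> \<le> \<bar>B $ a $ k\<bar> * (1 + K)"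
      by (simp add: abs_mult mult_left_mono)
    then show "B $ a $ k * (of_bool (k = b) - mpow P n k b) \<le> \<bar>B $ a $ k\<bar> * (1 + K)" by linarith
  qed
  ultimately have "(\<Sum>m<n. mpow P m a b) \<le> (\<Sum>k\<in>UNIV. \<bar>B $ a $ k\<bar> * (1 + K))" for n
    by (simp only:)
  then show ?thesis by (intro summableI_nonneg_bounded mpow_nonneg P)
qed

text \<open>Summation by parts: by symmetry of C the two square terms agree, and the energy is the
  quadratic form of the matrix whose inverse is the Green function.\<close>

lemma energy_eq:
  assumes sym: "\<And>x y. C x y = C y x"
  shows "energy C \<kappa> f = (\<Sum>x\<in>UNIV. f x * (vertex_weight C \<kappa> x * f x - (\<Sum>y\<in>UNIV. C x y * f y)))"
proof -
  have "(\<Sum>x\<in>UNIV. \<Sum>y\<in>UNIV. C x y * (f x - f y)\<^sup>2) =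
      (\<Sum>x\<in>UNIV. \<Sum>y\<in>UNIV. C x y * (f x)\<^sup>2) + (\<Sum>x\<in>UNIV. \<Sum>y\<in>UNIV. C x y * (f y)\<^sup>2)
      - 2 * (\<Sum>x\<in>UNIV. \<Sum>y\<in>UNIV. C x y * f x * f y)"
    by (simp add: power2_diff algebra_simps sum.distrib sum_subtractf sum_distrib_left)
  also have "(\<Sum>x\<in>UNIV. \<Sum>y\<in>UNIV. C x y * (f y)\<^sup>2) = (\<Sum>x\<in>UNIV. \<Sum>y\<in>UNIV. C x y * (f x)\<^sup>2)"
    by (subst sum.swap) (simp add: sym)
  finally show ?thesis
    unfolding energy_def vertex_weight_def
    by (simp add: algebra_simps sum.distrib sum_subtractf sum_distrib_left sum_distrib_right power2_eq_square)
qed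

section \<open>The transition matrix and the Green function\<close>

context killed_network
begin

abbreviation (input) "wt \<equiv> vertex_weight C \<kappa>"
abbreviation (input) "tr x y \<equiv> transition C \<kappa> $ x $ y"

text \<open>The energy of the indicator of x is lambda_x - C_xx.\<close>

lemma vertex_weight_pos: "0 < wt x"
proof -
  define f :: "'v \<Rightarrow> real" where "f = (\<lambda>y. of_bool (y = x))"
  have "0 < energy C \<kappa> f" by (intro energy_pos_def) (auto simp: f_def fun_eq_iff)
  also have "energy C \<kappa> f = wt x - C x x"
    unfolding energy_eq[OF C_sym] f_def
    by (simp add: of_bool_def if_distrib if_distribR algebra_simps cong: if_cong)
  finally show ?thesis using C_nonneg[of x x] by simp
qed

text \<open>A vector in the kernel has energy 0.\<close>

lemma det_laplacian_nz: "det (\<chi> x y. (if x = y then wt x else 0) - C x y) \<noteq> 0"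
proof -
  let ?A = "(\<chi> x y. (if x = y then wt x else 0) - C x y)"
  have "v = 0" if "?A *v v = 0" for v
  proof (rule ccontr)
    assume "v \<noteq> 0"
    then have "0 < energy C \<kappa> (\<lambda>x. v $ x)" by (intro energy_pos_def) (auto simp: vec_eq_iff fun_eq_iff)
    moreover have "wt x * v $ x - (\<Sum>y\<in>UNIV. C x y * v $ y) = (?A *v v) $ x" for x
    proof -
      have "(?A *v v) $ x = (\<Sum>y\<in>UNIV. (if x = y then wt x * v $ y else 0) - C x y * v $ y)"
        by (auto simp: matrix_vector_mult_def left_diff_distrib intro!: sum.cong)
      then show ?thesis by (simp add: sum_subtractf)
    qed
    ultimately show False using that unfolding energy_eq[OF C_sym] by simp
  qed
  then have "\<exists>B. B ** ?A = mat 1" unfolding matrix_left_invertible_ker by blast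
  then show ?thesis by (simp only: invertible_left_inverse[symmetric] invertible_det_nz not_False_eq_True)
qed

lemma transition_nonneg: "0 \<le> tr x y"
  using C_nonneg vertex_weight_pos[of x] by (simp add: transition_def)

lemma det_laplacian:
  "det (\<chi> x y. (if x = y then wt x else 0) - C x y) = (\<Prod>x\<in>UNIV. wt x) * det (mat 1 - transition C \<kappa>)"
proof -
  have "(\<chi> x y. (if x = y then wt x else 0) - C x y) = (\<chi> x. wt x *s (mat 1 - transition C \<kappa>) $ x)"
    unfolding vec_eq_iff using vertex_weight_pos[THEN less_imp_neq, THEN not_sym]
    by (simp add: mat_def transition_def right_diff_distrib)
  then show ?thesis by (simp only: det_rows_mul vec_lambda_eta)
qed

text \<open>\<open>matrix_inv\<close> is a choice operator, so \<open>green\<close> is an inverse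
  only once the determinant is known to be nonzero; the determinant of the inverted matrix then
  splits off one lambda_x per row.\<close>

lemma det_green: "1 / det (green C \<kappa>) = (\<Prod>x\<in>UNIV. wt x) * det (mat 1 - transition C \<kappa>)"
proof -
  let ?A = "(\<chi> x y. (if x = y then wt x else 0) - C x y)"
  have "?A ** green C \<kappa> = mat 1"
    using det_laplacian_nz unfolding green_def matrix_inv_def invertible_det_nz[symmetric] invertible_def
    by (rule someI2_ex) blast
  from arg_cong[OF this, of det] have "det ?A * det (green C \<kappa>) = 1"
    by (simp only: det_mul det_I)
  moreover have "1 / g = a" if "a * g = 1" for a g :: real
    using that by (cases "g = 0") (auto simp: field_simps)
  ultimately show ?thesis unfolding det_laplacian[symmetric] by blast
qed

text \<open>Nonnegative killing makes the rows of P sum to at most 1, and this passes to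
  powers.\<close>

lemma mpow_transition_le: "mpow (\<lambda>x y. tr x y) n a b \<le> 1"
proof -
  have row: "(\<Sum>b\<in>UNIV. tr a b) \<le> 1" for a
    using vertex_weight_pos[of a] killing_nonneg[of a]
    by (simp add: transition_def flip: sum_divide_distrib) (simp add: vertex_weight_def)
  have "(\<Sum>b\<in>UNIV. mpow (\<lambda>x y. tr x y) n a b) \<le> 1" for a
  proof (induction n arbitrary: a)
    case (Suc n)
    have "(\<Sum>b\<in>UNIV. mpow (\<lambda>x y. tr x y) (Suc n) a b) =
        (\<Sum>c\<in>UNIV. tr a c * (\<Sum>b\<in>UNIV. mpow (\<lambda>x y. tr x y) n c b))"
      by (simp add: sum_distrib_left) (rule sum.swap)
    also have "\<dots> \<le> (\<Sum>c\<in>UNIV. tr a c * 1)"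
      by (intro sum_mono mult_left_mono Suc transition_nonneg)
    finally show ?case using row[of a] by simp
  qed (simp add: of_bool_def)
  moreover have "mpow (\<lambda>x y. tr x y) n a b \<le> (\<Sum>b\<in>UNIV. mpow (\<lambda>x y. tr x y) n a b)"
    by (intro member_le_sum mpow_nonneg transition_nonneg) auto
  ultimately show ?thesis by (meson order_trans)
qed

lemma mat_minus_transition: "mat 1 - transition C \<kappa> = (\<chi> i j. of_bool (i = j) - tr i j)"
  by (auto simp: vec_eq_iff mat_def)

lemma summable_trace_transition: "summable (\<lambda>n. \<Sum>a\<in>UNIV. mpow (\<lambda>x y. tr x y) n a a)"
proof -
  have "det (\<chi> i j. of_bool (i = j) - tr i j) \<noteq> 0"
    using det_laplacian_nz det_laplacian by (auto simp: mat_minus_transition)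
  then have "summable (\<lambda>n. mpow (\<lambda>x y. tr x y) n a b)" for a b
    by (rule summable_mpow[OF transition_nonneg mpow_transition_le])
  then show ?thesis by (intro summable_sum)
qed

end

text \<open>This is - log det(I - Q), which for Q = P is the total mass of the nontrivial loops. The
  term n = 0 is a division by 0, hence 0.\<close>

definition loop_mass_total :: "('v::finite \<Rightarrow> 'v \<Rightarrow> real) \<Rightarrow> real" where
  "loop_mass_total Q = (\<Sum>n. (\<Sum>a\<in>UNIV. mpow Q n a a) / real n)"

lemma mpow_mono:
  assumes Q: "\<And>x y. 0 \<le> Q x y" and QR: "\<And>x y. Q x y \<le> R x y"
  shows "mpow Q n a b \<le> mpow R n a b"
proof (induction n arbitrary: a)
  case (Suc n)
  have R: "0 \<le> R x y" for x y by (rule order_trans[OF Q QR])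
  have "Q a c * mpow Q n c b \<le> R a c * mpow R n c b" for c
    by (rule mult_mono[OF QR Suc R mpow_nonneg[OF Q]])
  then show ?case by (simp add: sum_mono)
qed simp

context killed_network
begin

text \<open>Dominated term by term by the traces of the powers of P, whose series converges even
  without the factor 1 / n.\<close>

lemma loop_mass_total_sums:
  assumes Q: "\<And>x y. 0 \<le> Q x y" and le: "\<And>x y. Q x y \<le> tr x y"
  shows "(\<lambda>n. (\<Sum>a\<in>UNIV. mpow Q n a a) / real n) sums loop_mass_total Q"
  unfolding loop_mass_total_def
proof (rule summable_sums, rule summable_comparison_test'[OF summable_trace_transition])
  fix n
  have nonneg: "0 \<le> (\<Sum>a\<in>UNIV. mpow Q n a a)" by (intro sum_nonneg mpow_nonneg Q)
  have "norm ((\<Sum>a\<in>UNIV. mpow Q n a a) / real n) = (\<Sum>a\<in>UNIV. mpow Q n a a) / real n"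
    using nonneg by simp
  also have "\<dots> \<le> (\<Sum>a\<in>UNIV. mpow Q n a a)"
  proof (cases "n = 0")
    case True
    then show ?thesis using nonneg by (simp del: mpow.simps)
  next
    case False
    then show ?thesis using nonneg frac_le[of "\<Sum>a\<in>UNIV. mpow Q n a a" _ 1 "real n"] by simp
  qed
  also have "\<dots> \<le> (\<Sum>a\<in>UNIV. mpow (\<lambda>x y. tr x y) n a a)"
    by (rule sum_mono) (rule mpow_mono[OF Q le])
  finally show "norm ((\<Sum>a\<in>UNIV. mpow Q n a a) / real n) \<le> (\<Sum>a\<in>UNIV. mpow (\<lambda>x y. tr x y) n a a)" .
qed

lemma det_transition: "det (mat 1 - transition C \<kappa>) = exp (- loop_mass_total (\<lambda>x y. tr x y))"
  unfolding mat_minus_transition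
proof (rule det_one_minus_eq_exp)
  show "0 \<le> tr x y" for x y by (rule transition_nonneg)
  show "mpow (\<lambda>x y. tr x y) n a b \<le> 1" for n a b by (rule mpow_transition_le)
  show "(\<lambda>n. (\<Sum>a\<in>UNIV. mpow (\<lambda>x y. tr x y) n a a) / real n) sums loop_mass_total (\<lambda>x y. tr x y)"
    by (rule loop_mass_total_sums) (simp_all add: transition_nonneg)
qed

end

section \<open>Loops and traces\<close>

definition cyclic_prod :: "('v \<Rightarrow> 'v \<Rightarrow> real) \<Rightarrow> 'v list \<Rightarrow> real" where
  "cyclic_prod Q \<xi> = (\<Prod>i<length \<xi>. Q (\<xi> ! i) (\<xi> ! (Suc i mod length \<xi>)))"

lemma nth_rotate_Suc_mod:
  assumes "i < length l"
  shows "rotate j l ! (Suc i mod length l) = l ! (Suc ((j + i) mod length l) mod length l)"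
proof -
  have "Suc i mod length l < length l" using assms by (intro mod_less_divisor) auto
  then show ?thesis by (simp add: nth_rotate mod_Suc_eq mod_add_right_eq)
qed

lemma bij_betw_shift_mod: "bij_betw (\<lambda>i. (j + i) mod n) {..<n} {..<n :: nat}"
proof (cases "n = 0")
  case False
  have "inj_on (\<lambda>i. (j + i) mod n) {..<n}"
  proof (rule linorder_inj_onI')
    fix a b assume *: "a \<in> {..<n}" "b \<in> {..<n}" "a < b"
    show "(j + a) mod n \<noteq> (j + b) mod n"
    proof
      assume "(j + a) mod n = (j + b) mod n"
      then have "n dvd (j + b) - (j + a)" using * mod_eq_dvd_iff_nat[of "j + a" "j + b" n] by simp
      then show False using * by (auto dest: dvd_imp_le)
    qed
  qed
  then show ?thesis
    using False by (intro bij_betw_imageI endo_inj_surj) auto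
qed simp

lemma cyclic_prod_rotate: "cyclic_prod Q (rotate j l) = cyclic_prod Q l"
proof -
  have "cyclic_prod Q (rotate j l) =
      (\<Prod>i<length l. Q (l ! ((j + i) mod length l)) (l ! (Suc ((j + i) mod length l) mod length l)))"
    unfolding cyclic_prod_def by (intro prod.cong) (auto simp: nth_rotate nth_rotate_Suc_mod)
  also have "\<dots> = cyclic_prod Q l"
    unfolding cyclic_prod_def by (rule prod.reindex_bij_betw[OF bij_betw_shift_mod])
  finally show ?thesis .
qed

lemma based_loop_rotate: "based_loop E (rotate j l) \<longleftrightarrow> based_loop E l"
proof -
  have "(\<forall>i<length l. E (l ! ((j + i) mod length l)) (l ! (Suc ((j + i) mod length l) mod length l))) \<longleftrightarrow>
      (\<forall>i\<in>(\<lambda>i. (j + i) mod length l) ` {..<length l}. E (l ! i) (l ! (Suc i mod length l)))"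
    by auto
  then show ?thesis
    unfolding bij_betw_imp_surj_on[OF bij_betw_shift_mod] based_loop_def
    by (auto simp: nth_rotate nth_rotate_Suc_mod)
qed

lemma shift_class_rotate: "shift_class (rotate j l) = shift_class l"
proof -
  have "rotate i l \<in> shift_class (rotate j l)" for i
  proof (cases "l = []")
    case False
    \<comment> \<open>Adding \<open>j\<close> full turns makes room to subtract \<open>j\<close> in
      the natural numbers.\<close>
    have "rotate i l = rotate (i + j * length l) l" 
      by (subst (1 2) rotate_conv_mod) simp
    also have "i + j * length l = (i + j * length l - j) + j"
      using False by (cases "length l") auto
    also have "rotate \<dots> l = rotate (i + j * length l - j) (rotate j l)" by (simp only: rotate_rotate)
    finally show ?thesis by (auto simp: shift_class_def)
  qed (simp add: shift_class_def)
  then show ?thesis by (auto simp: shift_class_def rotate_rotate)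
qed

lemma nth_concat_replicate:
  "i < m * length \<eta> \<Longrightarrow> concat (replicate m \<eta>) ! i = \<eta> ! (i mod length \<eta>)"
proof (induction m arbitrary: i)
  case (Suc m)
  show ?case
  proof (cases "i < length \<eta>")
    case False
    then have "(i - length \<eta>) mod length \<eta> = i mod length \<eta>" by (simp add: le_mod_geq)
    moreover have "i - length \<eta> < m * length \<eta>" using Suc.prems False by auto
    ultimately show ?thesis using Suc.IH[of "i - length \<eta>"] False by (simp add: nth_append)
  qed (simp add: nth_append)
qed simp

lemma length_concat_replicate: "length (concat (replicate m \<eta>)) = m * length \<eta>"
  by (induction m) auto

text \<open>With d the least period, the class has d elements, and the loop is the n / d fold
  repetition of its first d entries; every period is a multiple of d, so no larger multiplicity
  occurs. Hence the weight 1 / multiplicity of a class is 1 / length spread over its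
  members.\<close>

lemma card_shift_class:
  assumes irrefl: "\<And>x. \<not> E x x" and l: "based_loop E l"
  shows "finite (shift_class l)" "card (shift_class l) * loop_multiplicity E l = length l"
    "0 < loop_multiplicity E l"
proof -
  define n where "n = length l"
  have n: "2 \<le> n" using l by (simp add: n_def based_loop_def)
  define d where "d = (LEAST d. 0 < d \<and> rotate d l = l)"
  have ex: "0 < n \<and> rotate n l = l" proof
    show "0 < n" using n by linarith
    show "rotate n l = l" by (rule rotate_id) (simp add: n_def)
  qed
  have d: "0 < d" "rotate d l = l"
    using LeastI[of "\<lambda>d. 0 < d \<and> rotate d l = l", OF ex] by (auto simp: d_def)
  have mult: "rotate (d * q) l = l" for q
    by (induction q) (auto simp: d rotate_rotate[symmetric] algebra_simps)
  have rot_mod: "rotate i l = rotate (i mod d) l" for i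
  proof -
    have "rotate i l = rotate (i mod d) (rotate (d * (i div d)) l)"
      unfolding rotate_rotate by simp
    then show ?thesis by (simp add: mult)
  qed
  have dvd: "d dvd i" if "rotate i l = l" for i
  proof -
    have "rotate (i mod d) l = l" using that rot_mod by simp
    then have "\<not> 0 < i mod d" using not_less_Least[of "i mod d" "\<lambda>d. 0 < d \<and> rotate d l = l"] d(1)
      by (auto simp: d_def[symmetric])
    then show ?thesis by (simp add: mod_eq_0_iff_dvd)
  qed
  have dn: "d dvd n" using dvd ex by blast
  have cls: "shift_class l = (\<lambda>i. rotate i l) ` {..<d}"
    unfolding shift_class_def using rot_mod d(1) by (auto intro!: image_eqI[where x = "_ mod d"])
  have "inj_on (\<lambda>i. rotate i l) {..<d}"
  proof (rule linorder_inj_onI')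
    fix i j assume ij: "i \<in> {..<d}" "j \<in> {..<d}" "i < j"
    show "rotate i l \<noteq> rotate j l"
    proof
      assume eq: "rotate i l = rotate j l"
      have "rotate (d - i + j) l = rotate (d - i) (rotate j l)" by (simp add: rotate_rotate)
      also have "\<dots> = rotate d l" unfolding eq[symmetric] rotate_rotate using ij by simp
      finally have "d dvd d - i + j" using d(2) dvd by simp
      moreover have "d - i + j = d + (j - i)" using ij by simp
      ultimately have "d dvd j - i" by (simp add: dvd_add_right_iff)
      then show False using ij by (auto dest: dvd_imp_le)
    qed
  qed
  then have card: "card (shift_class l) = d" unfolding cls by (simp add: card_image)
  show "finite (shift_class l)" unfolding cls by simp
  have nth: "l ! i = l ! (i mod d)" if "i < n" for i
  proof -
    have "l ! (i mod d) = rotate (d * (i div d)) l ! (i mod d)" by (simp add: mult)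
    also have "\<dots> = l ! i"
      using that le_less_trans[OF mod_less_eq_dividend that, of d] by (subst nth_rotate) (auto simp: n_def)
    finally show ?thesis ..
  qed
  \<comment> \<open>Period 1 would require a loop-edge. The bound matters because the repeated block
    has to be a based loop, of length at least 2.\<close>
  have d2: "2 \<le> d"
  proof (rule ccontr)
    assume "\<not> 2 \<le> d"
    then have "d = 1" using d by simp
    then have "l ! 0 = l ! 1" using nth[of 1] n by simp
    moreover have "E (l ! 0) (l ! 1)" using l n unfolding based_loop_def n_def by (auto dest: spec[of _ 0])
    ultimately show False using irrefl by simp
  qed
  have dle: "d \<le> n" using dn n by (auto dest: dvd_imp_le)
  have "l = concat (replicate (n div d) (take d l))"
  proof (rule nth_equalityI)
    show len: "length l = length (concat (replicate (n div d) (take d l)))"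
      using dn dle unfolding length_concat_replicate by (simp add: n_def[symmetric])
    fix i assume i: "i < length l"
    then have "i < (n div d) * length (take d l)" by (simp only: len length_concat_replicate)
    then have "concat (replicate (n div d) (take d l)) ! i = take d l ! (i mod length (take d l))"
      by (rule nth_concat_replicate)
    also have "\<dots> = l ! (i mod d)" using dle d by (simp add: n_def)
    finally show "l ! i = concat (replicate (n div d) (take d l)) ! i" using nth i by (simp add: n_def)
  qed
  moreover have "based_loop E (take d l)"
    unfolding based_loop_def
  proof (intro conjI allI impI)
    fix i assume "i < length (take d l)"
    then have i: "i < d" using dle by (simp add: n_def)
    have "E (l ! i) (l ! (Suc i mod n))" using l i dle unfolding based_loop_def n_def by auto
    \<comment> \<open>The block closes after d steps and the loop after n; periodicity identifies
      the two successors, and Suc i = n forces d = n.\<close>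
    moreover have "l ! (Suc i mod n) = l ! (Suc i mod d)"
    proof (cases "Suc i = n")
      case True
      then have "d = n" using i dle by simp
      then show ?thesis by simp
    next
      case False
      then have "Suc i < n" using i dle by simp
      then show ?thesis using nth[of "Suc i"] by simp
    qed
    ultimately show "E (take d l ! i) (take d l ! (Suc i mod length (take d l)))"
      using i d dle by (simp add: n_def)
  qed (use d2 dle in \<open>simp add: n_def\<close>)
  moreover have "m \<le> n div d" if "based_loop E \<eta>" "l = concat (replicate m \<eta>)" for m \<eta>
  proof -
    have len: "n = m * length \<eta>" using that(2) by (simp add: n_def length_concat_replicate)
    have "rotate (length \<eta>) l = l"
    proof (cases m)
      case 0
      then show ?thesis using len n by simp
    next
      case (Suc k)
      have "concat (replicate k \<eta>) @ \<eta> = \<eta> @ concat (replicate k \<eta>)" by (induction k) auto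
      then show ?thesis using that(2) Suc by (simp add: rotate_append)
    qed
    then obtain q where q: "length \<eta> = d * q" using dvd by blast
    have "m \<le> m * q" using q that(1) by (cases q) (auto simp: based_loop_def)
    also have "m * q = n div d" using len q d by simp
    finally show ?thesis .
  qed
  moreover define S where "S = {m. \<exists>\<eta>. based_loop E \<eta> \<and> l = concat (replicate m \<eta>)}"
  ultimately have S: "n div d \<in> S" "\<And>m. m \<in> S \<Longrightarrow> m \<le> n div d" by blast+
  then have "finite S" by (intro finite_subset[of S "{..n div d}"]) auto
  then have "loop_multiplicity E l = n div d"
    unfolding loop_multiplicity_def S_def[symmetric] using S by (intro Max_eqI)
  then show "card (shift_class l) * loop_multiplicity E l = length l" "0 < loop_multiplicity E l"
    using dn dle d by (simp_all add: card n_def[symmetric] div_greater_zero_iff)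
qed

section \<open>Traces of powers as sums over closed paths\<close>

lemma sum_lists_Suc:
  fixes f :: "'v::finite list \<Rightarrow> 'b::comm_monoid_add"
  shows "(\<Sum>xs | length xs = Suc n. f xs) = (\<Sum>x\<in>UNIV. \<Sum>xs | length xs = n. f (x # xs))"
proof -
  have "{xs :: 'v list. length xs = Suc n} = (\<lambda>(x, xs). x # xs) ` (UNIV \<times> {xs. length xs = n})"
    by (auto simp: length_Suc_conv image_iff)
  moreover have "inj_on (\<lambda>(x, xs). x # xs) (UNIV \<times> {xs :: 'v list. length xs = n})"
    by (auto simp: inj_on_def)
  ultimately show ?thesis
    by (simp add: sum.reindex sum.cartesian_product case_prod_unfold)
qed

text \<open>The list holds the interior vertices of a path with the two given ends.\<close>

primrec path_prod :: "('v \<Rightarrow> 'v \<Rightarrow> real) \<Rightarrow> 'v \<Rightarrow> 'v list \<Rightarrow> 'v \<Rightarrow> real" where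
  "path_prod Q a [] b = Q a b"
| "path_prod Q a (c # xs) b = Q a c * path_prod Q c xs b"

lemma mpow_eq_sum_paths: "mpow Q (Suc n) a b = (\<Sum>xs | length xs = n. path_prod Q a xs b)"
proof (induction n arbitrary: a)
  case 0
  show ?case by (simp add: of_bool_def if_distrib cong: if_cong)
next
  case (Suc n)
  have "mpow Q (Suc (Suc n)) a b = (\<Sum>c\<in>UNIV. Q a c * mpow Q (Suc n) c b)" by (rule mpow.simps)
  then show ?case unfolding Suc sum_lists_Suc by (simp add: sum_distrib_left)
qed

lemma path_prod_eq_prod: "path_prod Q a xs b = (\<Prod>i<Suc (length xs). Q ((a # xs @ [b]) ! i) ((xs @ [b]) ! i))"
proof (induction xs arbitrary: a)
  case (Cons c xs)
  show ?case unfolding path_prod.simps Cons by (subst (2) prod.lessThan_Suc_shift) simp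
qed simp

lemma cyclic_prod_Cons: "cyclic_prod Q (a # xs) = path_prod Q a xs a"
  unfolding path_prod_eq_prod cyclic_prod_def
proof (intro prod.cong)
  fix i assume "i \<in> {..<Suc (length xs)}"
  then consider "i < length xs" | "i = length xs" by force
  then show "Q ((a # xs) ! i) ((a # xs) ! (Suc i mod length (a # xs))) = Q ((a # xs @ [a]) ! i) ((xs @ [a]) ! i)"
    by cases (auto simp: nth_append nth_Cons')
qed simp

lemma trace_mpow_Suc: "(\<Sum>a\<in>UNIV. mpow Q (Suc n) a a) = (\<Sum>xs | length xs = Suc n. cyclic_prod Q xs)"
  unfolding sum_lists_Suc cyclic_prod_Cons mpow_eq_sum_paths ..

text \<open>Tonelli on the pairs of a class and a member: a based loop belongs to exactly one class,
  its own shift class.\<close>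

lemma nn_integral_shift_classes:
  assumes fin: "\<And>\<xi>. based_loop E \<xi> \<Longrightarrow> finite (shift_class \<xi>)"
  shows "(\<integral>\<^sup>+c. (\<Sum>\<xi>\<in>c. g \<xi>) \<partial>count_space (discrete_loops E)) =
    (\<integral>\<^sup>+\<xi>. g \<xi> * indicator {\<xi>. based_loop E \<xi>} \<xi> \<partial>count_space UNIV)"
proof -
  let ?h = "\<lambda>(c, \<xi>). g \<xi> * indicator {(c, \<xi>). c \<in> discrete_loops E \<and> \<xi> \<in> c} (c, \<xi>)"
  have "(\<integral>\<^sup>+c. (\<Sum>\<xi>\<in>c. g \<xi>) \<partial>count_space (discrete_loops E)) =
      (\<integral>\<^sup>+c. (\<Sum>\<xi>\<in>c. g \<xi>) * indicator (discrete_loops E) c \<partial>count_space UNIV)"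
    by (simp add: nn_integral_count_space_indicator)
  also have "\<dots> = (\<integral>\<^sup>+c. \<integral>\<^sup>+\<xi>. ?h (c, \<xi>) \<partial>count_space UNIV \<partial>count_space UNIV)"
  proof (intro nn_integral_cong)
    fix c :: "'a list set"
    show "(\<Sum>\<xi>\<in>c. g \<xi>) * indicator (discrete_loops E) c = (\<integral>\<^sup>+\<xi>. ?h (c, \<xi>) \<partial>count_space UNIV)"
    proof (cases "c \<in> discrete_loops E")
      case True
      then have "finite c" using fin by (auto simp: discrete_loops_def)
      moreover have "?h (c, \<xi>) = g \<xi> * indicator c \<xi>" for \<xi> using True by (simp add: indicator_def)
      ultimately show ?thesis using True
        by (simp add: nn_integral_count_space_indicator[symmetric] nn_integral_count_space_finite)
    qed simp
  qed
  also have "\<dots> = (\<integral>\<^sup>+\<xi>. \<integral>\<^sup>+c. ?h (c, \<xi>) \<partial>count_space UNIV \<partial>count_space UNIV)"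
    unfolding nn_integral_fst_count_space nn_integral_snd_count_space ..
  also have "\<dots> = (\<integral>\<^sup>+\<xi>. g \<xi> * indicator {\<xi>. based_loop E \<xi>} \<xi> \<partial>count_space UNIV)"
  proof (intro nn_integral_cong)
    fix \<xi> :: "'a list"
    have *: "c \<in> discrete_loops E \<and> \<xi> \<in> c \<longleftrightarrow> based_loop E \<xi> \<and> c = shift_class \<xi>" for c
    proof
      assume "c \<in> discrete_loops E \<and> \<xi> \<in> c"
      then obtain \<eta> j where "based_loop E \<eta>" "c = shift_class \<eta>" "\<xi> = rotate j \<eta>"
        by (auto simp: discrete_loops_def shift_class_def)
      then show "based_loop E \<xi> \<and> c = shift_class \<xi>"
        by (simp add: based_loop_rotate shift_class_rotate)
    next
      assume *: "based_loop E \<xi> \<and> c = shift_class \<xi>"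
      moreover have "\<xi> \<in> shift_class \<xi>" unfolding shift_class_def by (rule range_eqI[of _ _ 0]) simp
      ultimately show "c \<in> discrete_loops E \<and> \<xi> \<in> c" by (auto simp: discrete_loops_def)
    qed
    have "?h (c, \<xi>) = g \<xi> * indicator {\<xi>. based_loop E \<xi>} \<xi> * indicator {shift_class \<xi>} c" for c
      using * by (simp add: indicator_def)
    then have "(\<integral>\<^sup>+c. ?h (c, \<xi>) \<partial>count_space UNIV) =
        (\<integral>\<^sup>+c. g \<xi> * indicator {\<xi>. based_loop E \<xi>} \<xi> * indicator {shift_class \<xi>} c \<partial>count_space UNIV)"
      by (simp only:)
    then show "(\<integral>\<^sup>+c. ?h (c, \<xi>) \<partial>count_space UNIV) = g \<xi> * indicator {\<xi>. based_loop E \<xi>} \<xi>"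
      by (simp add: nn_integral_cmult_indicator)
  qed
  finally show ?thesis .
qed

context killed_network
begin

lemma discrete_loops_representative:
  assumes "c \<in> discrete_loops E"
  shows "based_loop E (SOME \<xi>. \<xi> \<in> c)" "c = shift_class (SOME \<xi>. \<xi> \<in> c)"
proof -
  obtain \<eta> where \<eta>: "based_loop E \<eta>" "c = shift_class \<eta>" using assms by (auto simp: discrete_loops_def)
  have "\<eta> \<in> c" unfolding \<eta>(2) shift_class_def by (rule range_eqI[of _ _ 0]) simp
  then have "(SOME \<xi>. \<xi> \<in> c) \<in> c" by (rule someI)
  then obtain j where "(SOME \<xi>. \<xi> \<in> c) = rotate j \<eta>" unfolding \<eta>(2) shift_class_def by blast
  then show "based_loop E (SOME \<xi>. \<xi> \<in> c)" "c = shift_class (SOME \<xi>. \<xi> \<in> c)"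
    using \<eta> by (simp_all add: based_loop_rotate shift_class_rotate)
qed

text \<open>A class has length / multiplicity members, so its factor 1 / multiplicity is the sum of
  1 / length over them. Summing over all based loops of length n gives tr(Q^n) / n.\<close>

lemma sum_loop_weights:
  assumes Q: "\<And>x y. 0 \<le> Q x y" and le: "\<And>x y. Q x y \<le> tr x y"
  shows "(\<integral>\<^sup>+c. ennreal (1 / real (loop_multiplicity E (SOME \<xi>. \<xi> \<in> c)) * cyclic_prod Q (SOME \<xi>. \<xi> \<in> c))
    \<partial>count_space (discrete_loops E)) = ennreal (loop_mass_total Q)"
proof -
  note fin = card_shift_class[OF no_loop_edge]
  have cp: "0 \<le> cyclic_prod Q \<xi>" for \<xi> unfolding cyclic_prod_def by (intro prod_nonneg) (auto simp: Q)
  have Q0: "Q x y = 0" if "\<not> E x y" for x y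
    using Q[of x y] le[of x y] C_nonedge[OF that] by (simp add: transition_def)
  define g where "g \<xi> = ennreal (cyclic_prod Q \<xi> / real (length \<xi>))" for \<xi>
  have "(\<integral>\<^sup>+c. ennreal (1 / real (loop_multiplicity E (SOME \<xi>. \<xi> \<in> c)) * cyclic_prod Q (SOME \<xi>. \<xi> \<in> c))
      \<partial>count_space (discrete_loops E)) = (\<integral>\<^sup>+c. (\<Sum>\<xi>\<in>c. g \<xi>) \<partial>count_space (discrete_loops E))"
  proof (intro nn_integral_cong, simp)
    fix c assume c: "c \<in> discrete_loops E"
    define \<xi> where "\<xi> = (SOME \<xi>. \<xi> \<in> c)"
    have \<xi>: "based_loop E \<xi>" "c = shift_class \<xi>"
      using discrete_loops_representative[OF c] by (simp_all add: \<xi>_def)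
    have "g \<eta> = g \<xi>" if "\<eta> \<in> c" for \<eta>
      using that unfolding \<xi>(2) by (auto simp: shift_class_def g_def cyclic_prod_rotate)
    then have "(\<Sum>\<eta>\<in>c. g \<eta>) = of_nat (card c) * g \<xi>" by simp
    also have "\<dots> = ennreal (real (card c) * (cyclic_prod Q \<xi> / real (length \<xi>)))"
      by (simp add: g_def ennreal_of_nat_eq_real_of_nat ennreal_mult'[symmetric])
    also have "real (length \<xi>) = real (card c) * real (loop_multiplicity E \<xi>)"
      using arg_cong[OF fin(2)[OF \<xi>(1)], of real] \<xi>(2) by simp
    also have "real (card c) * (cyclic_prod Q \<xi> / (real (card c) * real (loop_multiplicity E \<xi>))) =
        cyclic_prod Q \<xi> / real (loop_multiplicity E \<xi>)"
      using fin(2)[OF \<xi>(1)] \<xi> by (cases "card c = 0") (auto simp: based_loop_def)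
    finally show "ennreal (cyclic_prod Q \<xi> / real (loop_multiplicity E \<xi>)) = (\<Sum>\<eta>\<in>c. g \<eta>)" ..
  qed
  also have "\<dots> = (\<integral>\<^sup>+\<xi>. g \<xi> * indicator {\<xi>. based_loop E \<xi>} \<xi> \<partial>count_space UNIV)"
    by (rule nn_integral_shift_classes[OF fin(1)])
  also have "\<dots> = (\<integral>\<^sup>+\<xi>. (\<Sum>n. g \<xi> * indicator {\<xi>. based_loop E \<xi>} \<xi> * indicator {\<xi>. length \<xi> = n} \<xi>) \<partial>count_space UNIV)"
  proof (intro nn_integral_cong)
    fix \<xi> :: "'v list"
    have "(\<Sum>n. g \<xi> * indicator {\<xi>. based_loop E \<xi>} \<xi> * indicator {\<xi>. length \<xi> = n} \<xi>) =
        (\<Sum>n\<in>{length \<xi>}. g \<xi> * indicator {\<xi>. based_loop E \<xi>} \<xi> * indicator {\<xi>. length \<xi> = n} \<xi>)"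
      by (rule suminf_finite) auto
    then show "g \<xi> * indicator {\<xi>. based_loop E \<xi>} \<xi> =
        (\<Sum>n. g \<xi> * indicator {\<xi>. based_loop E \<xi>} \<xi> * indicator {\<xi>. length \<xi> = n} \<xi>)" by simp
  qed
  also have "\<dots> = (\<Sum>n. \<integral>\<^sup>+\<xi>. g \<xi> * indicator {\<xi>. based_loop E \<xi>} \<xi> * indicator {\<xi>. length \<xi> = n} \<xi> \<partial>count_space UNIV)"
    by (rule nn_integral_suminf) auto
  also have "\<dots> = (\<Sum>n. ennreal ((\<Sum>a\<in>UNIV. mpow Q n a a) / real n))"
  proof (intro suminf_cong)
    fix n
    have finl: "finite {\<xi> :: 'v list. length \<xi> = n}" using finite_lists_length_eq[of "UNIV :: 'v set" n] by simp
    have "(\<integral>\<^sup>+\<xi>. g \<xi> * indicator {\<xi>. based_loop E \<xi>} \<xi> * indicator {\<xi>. length \<xi> = n} \<xi> \<partial>count_space UNIV) =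
        (\<Sum>\<xi> | length \<xi> = n. g \<xi> * indicator {\<xi>. based_loop E \<xi>} \<xi>)"
      using finl by (simp add: nn_integral_count_space_indicator[symmetric] nn_integral_count_space_finite)
    \<comment> \<open>Lists that are not based loops contribute 0: some cyclic step is not an edge,
      where Q vanishes. A single vertex would step along a loop-edge, and the empty list is divided
      by its length 0.\<close>
    also have "\<dots> = (\<Sum>\<xi> | length \<xi> = n. g \<xi>)"
    proof (intro sum.cong refl)
      fix \<xi> :: "'v list" assume \<xi>: "\<xi> \<in> {\<xi>. length \<xi> = n}"
      show "g \<xi> * indicator {\<xi>. based_loop E \<xi>} \<xi> = g \<xi>"
      proof (cases "based_loop E \<xi> \<or> \<xi> = []")
        case False
        have "\<exists>i<length \<xi>. \<not> E (\<xi> ! i) (\<xi> ! (Suc i mod length \<xi>))"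
        proof (cases "2 \<le> length \<xi>")
          case False2: False
          then have "length \<xi> = 1" using False by (cases \<xi>; cases "tl \<xi>") auto
          then show ?thesis using no_loop_edge by auto
        qed (use False in \<open>auto simp: based_loop_def\<close>)
        then have "cyclic_prod Q \<xi> = 0" unfolding cyclic_prod_def by (intro prod_zero) (auto intro: Q0)
        then show ?thesis by (simp add: g_def)
      qed (auto simp: g_def)
    qed
    also have "\<dots> = ennreal ((\<Sum>\<xi> | length \<xi> = n. cyclic_prod Q \<xi>) / real n)"
      by (simp add: g_def sum_ennreal cp sum_divide_distrib)
    \<comment> \<open>For n = 0 the numerators are 1 and the number of vertices, but both quotients
      are divisions by 0.\<close>
    also have "(\<Sum>\<xi> | length \<xi> = n. cyclic_prod Q \<xi>) / real n = (\<Sum>a\<in>UNIV. mpow Q n a a) / real n"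
      by (cases n) (auto simp: trace_mpow_Suc simp del: mpow.simps)
    finally show "(\<integral>\<^sup>+\<xi>. g \<xi> * indicator {\<xi>. based_loop E \<xi>} \<xi> * indicator {\<xi>. length \<xi> = n} \<xi> \<partial>count_space UNIV) =
      ennreal ((\<Sum>a\<in>UNIV. mpow Q n a a) / real n)" .
  qed
  also have "\<dots> = ennreal (loop_mass_total Q)"
    using loop_mass_total_sums[OF Q le] mpow_nonneg[of Q, OF Q]
    by (intro suminf_ennreal_eq) (auto intro!: sum_nonneg divide_nonneg_nonneg)
  finally show ?thesis .
qed

end

section \<open>Integrals over the loop measure\<close>

lemma space_loop_space: "space (loop_space E) = loops E"
  unfolding loop_space_def by (rule space_measure_of) (auto simp: loop_sets_def)

lemma measurable_timed_loop:
  assumes "\<xi> \<in> skeletons E"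
  shows "timed_loop \<xi> \<in> measurable (time_vectors (length \<xi>)) (loop_space E)"
proof (rule measurableI)
  show "timed_loop \<xi> t \<in> space (loop_space E)" for t
    using assms by (auto simp: space_loop_space loops_def)
  fix A assume "A \<in> sets (loop_space E)"
  then have "{t \<in> space (time_vectors (length \<xi>)). timed_loop \<xi> t \<in> A} \<in> sets (time_vectors (length \<xi>))"
    using assms by (auto simp: sets_loop_space loop_sets_def)
  then show "timed_loop \<xi> -` A \<inter> space (time_vectors (length \<xi>)) \<in> sets (time_vectors (length \<xi>))"
    by (simp add: vimage_def Int_def conj_commute)
qed

text \<open>\<open>loop_sets\<close> is a quotient structure, so measurability is tested on the
  holding times of each skeleton.\<close>

lemma measurable_loop_spaceI:
  fixes g :: "('v \<times> real) list set \<Rightarrow> 'b::topological_space"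
  assumes "\<And>\<xi>. \<xi> \<in> skeletons E \<Longrightarrow> (\<lambda>t. g (timed_loop \<xi> t)) \<in> borel_measurable (time_vectors (length \<xi>))"
  shows "g \<in> borel_measurable (loop_space E)"
proof (rule measurableI)
  fix B :: "'b set" assume B: "B \<in> sets borel"
  have "{t \<in> space (time_vectors (length \<xi>)). timed_loop \<xi> t \<in> g -` B \<inter> loops E} \<in> sets (time_vectors (length \<xi>))"
    if "\<xi> \<in> skeletons E" for \<xi>
  proof -
    have "{t \<in> space (time_vectors (length \<xi>)). timed_loop \<xi> t \<in> g -` B \<inter> loops E} =
        (\<lambda>t. g (timed_loop \<xi> t)) -` B \<inter> space (time_vectors (length \<xi>))"
      using that by (auto simp: loops_def)
    then show ?thesis using measurable_sets[OF assms[OF that] B] by simp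
  qed
  then show "g -` B \<inter> space (loop_space E) \<in> sets (loop_space E)"
    by (auto simp: space_loop_space sets_loop_space loop_sets_def)
qed simp

lemma the_elem_shift_class:
  assumes "\<And>j. f (rotate j l) = f l"
  shows "the_elem (f ` shift_class l) = f l"
proof -
  have "f ` shift_class l = {f l}" using assms by (auto simp: shift_class_def image_image)
  then show ?thesis by simp
qed

lemma time_at_timed_loop:
  "time_at x (timed_loop \<xi> t) = (\<Sum>i<length \<xi>. if \<xi> ! i = x then t i else 0)"
proof -
  define l where "l = map (\<lambda>i. (\<xi> ! i, t i)) [0..<length \<xi>]"
  have "sum_list (map g (rotate j l)) = sum_list (map g l)" for g :: "'a \<times> real \<Rightarrow> real" and j
  proof -
    have "sum_list (map g (rotate j l)) =
        sum_list (map g (take (j mod length l) l)) + sum_list (map g (drop (j mod length l) l))"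
      by (simp add: rotate_drop_take)
    also have "\<dots> = sum_list (map g (take (j mod length l) l @ drop (j mod length l) l))"
      by (simp only: map_append sum_list_append)
    finally show ?thesis by simp
  qed
  then have "time_at x (timed_loop \<xi> t) = (\<Sum>(y, t)\<leftarrow>l. if y = x then t else 0)"
    unfolding time_at_def timed_loop_def l_def[symmetric] by (intro the_elem_shift_class)
  also have "\<dots> = (\<Sum>i\<leftarrow>[0..<length \<xi>]. if \<xi> ! i = x then t i else 0)"
    by (simp add: l_def comp_def)
  also have "\<dots> = (\<Sum>i<length \<xi>. if \<xi> ! i = x then t i else 0)"
    by (simp add: interv_sum_list_conv_sum_set_nat atLeast0LessThan)
  finally show ?thesis .
qed

lemma jumps_timed_loop:
  "jumps x y (timed_loop \<xi> t) = (if length \<xi> < 2 then 0 else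
    card {i. i < length \<xi> \<and> \<xi> ! i = x \<and> \<xi> ! (Suc i mod length \<xi>) = y})"
proof -
  define l where "l = map (\<lambda>i. (\<xi> ! i, t i)) [0..<length \<xi>]"
  define J where "J l = {i. i < length l \<and> fst (l ! i) = x \<and> fst (l ! (Suc i mod length l)) = y}"
    for l :: "('a \<times> real) list"
  have "card (J (rotate j l)) = card (J l)" for j
  proof -
    have bij: "bij_betw (\<lambda>i. (j + i) mod length l) {..<length l} {..<length l}" by (rule bij_betw_shift_mod)
    have lt: "(j + i) mod length l < length l" if "i < length l" for i
      using that by (intro mod_less_divisor) auto
    have "J l = (\<lambda>i. (j + i) mod length l) ` J (rotate j l)"
    proof (intro set_eqI iffI)
      fix k assume k: "k \<in> J l"
      then have "k \<in> (\<lambda>i. (j + i) mod length l) ` {..<length l}"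
        unfolding bij_betw_imp_surj_on[OF bij] by (simp add: J_def)
      then obtain i where i: "i < length l" "k = (j + i) mod length l" by blast
      then show "k \<in> (\<lambda>i. (j + i) mod length l) ` J (rotate j l)"
        using k by (intro image_eqI[of _ _ i]) (auto simp: J_def nth_rotate nth_rotate_Suc_mod)
    next
      fix k assume "k \<in> (\<lambda>i. (j + i) mod length l) ` J (rotate j l)"
      then show "k \<in> J l" using lt by (auto simp: J_def nth_rotate nth_rotate_Suc_mod)
    qed
    moreover have "inj_on (\<lambda>i. (j + i) mod length l) (J (rotate j l))"
      by (rule inj_on_subset[OF bij_betw_imp_inj_on[OF bij]]) (auto simp: J_def)
    ultimately show ?thesis by (simp add: card_image)
  qed
  then have "jumps x y (timed_loop \<xi> t) = (if length l < 2 then 0 else card (J l))"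
    unfolding jumps_def timed_loop_def l_def[symmetric] J_def[symmetric]
    by (intro the_elem_shift_class) simp
  moreover have "J l = {i. i < length \<xi> \<and> \<xi> ! i = x \<and> \<xi> ! (Suc i mod length \<xi>) = y}"
  proof -
    have "Suc i mod length \<xi> < length \<xi>" if "i < length \<xi>" for i
      using that by (intro mod_less_divisor) auto
    then show ?thesis by (auto simp: J_def l_def)
  qed
  ultimately show ?thesis by (simp add: l_def)
qed

lemma measurable_time_at: "time_at x \<in> borel_measurable (loop_space E)"
  by (rule measurable_loop_spaceI) (simp add: time_at_timed_loop time_vectors_def)

lemma measurable_jumps: "(\<lambda>c. of_nat (jumps x y c) :: ennreal) \<in> borel_measurable (loop_space E)"
  by (rule measurable_loop_spaceI) (simp add: jumps_timed_loop)

lemma sets_trivial_loops: "sets (trivial_loops E x) = loop_sets E"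
  and sets_exponential_times: "sets (exponential_times E \<xi>) = loop_sets E"
  by (simp_all add: trivial_loops_def exponential_times_def sets_loop_space)

text \<open>The loop measure is given by its values on sets only, so the formula is extended from
  indicators by the standard induction. The supremum step uses monotone convergence twice: in the
  holding times and in the sum over discrete loops.\<close>

lemma nn_integral_loop_measure:
  assumes "f \<in> borel_measurable (loop_space E)"
  shows "(\<integral>\<^sup>+c. f c \<partial>loop_measure E P) = (\<Sum>x\<in>UNIV. \<integral>\<^sup>+c. f c \<partial>trivial_loops E x) +
    (\<integral>\<^sup>+c. ennreal (loop_weight E P (SOME \<xi>. \<xi> \<in> c)) * (\<integral>\<^sup>+c. f c \<partial>exponential_times E (SOME \<xi>. \<xi> \<in> c))
      \<partial>count_space (discrete_loops E))"
proof -
  have sp: "space (loop_measure E P) = loops E" "space (trivial_loops E x) = loops E"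
    "space (exponential_times E \<xi>) = loops E" for x \<xi>
    using sets_eq_imp_space_eq[of _ "loop_space E"]
    by (simp_all add: sets_loop_measure sets_trivial_loops sets_exponential_times sets_loop_space space_loop_space)
  note ms = measurable_cong_sets[OF _ refl, of _ "loop_space E"]
  have meas: "borel_measurable (loop_measure E P) = borel_measurable (loop_space E)"
    "borel_measurable (trivial_loops E x) = borel_measurable (loop_space E)"
    "borel_measurable (exponential_times E \<xi>) = borel_measurable (loop_space E)" for x \<xi>
    by (intro ms, simp add: sets_loop_measure sets_trivial_loops sets_exponential_times sets_loop_space)+
  show ?thesis
    using assms
  proof (induction rule: borel_measurable_induct)
    case (cong f g)
    have "(\<integral>\<^sup>+c. f c \<partial>N) = (\<integral>\<^sup>+c. g c \<partial>N)" if "space N = loops E" for N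
      using cong that by (intro nn_integral_cong) (auto simp: space_loop_space)
    then show ?case using cong(4) by (simp add: sp)
  next
    case (set A)
    then show ?case
      by (simp add: sets_loop_space sets_loop_measure sets_trivial_loops sets_exponential_times
          emeasure_loop_measure loop_mass_def Let_def)
  next
    case (mult u a)
    have I: "(\<integral>\<^sup>+c. a * u c \<partial>N) = a * (\<integral>\<^sup>+c. u c \<partial>N)"
      if "borel_measurable N = (borel_measurable (loop_space E) :: (_ \<Rightarrow> ennreal) set)" for N
      using mult(2) that by (intro nn_integral_cmult) simp
    have J: "(\<integral>\<^sup>+c. w c * (a * v c) \<partial>count_space D) = a * (\<integral>\<^sup>+c. w c * v c \<partial>count_space D)"
      for w v :: "'a list set \<Rightarrow> ennreal" and D
      by (subst nn_integral_cmult[symmetric]) (simp_all add: mult.left_commute)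
    show ?case
      by (simp only: I[OF meas(1)] I[OF meas(2)] I[OF meas(3)] J mult(4) distrib_left sum_distrib_left)
  next
    case (add u v)
    have I: "(\<integral>\<^sup>+c. v c + u c \<partial>N) = (\<integral>\<^sup>+c. v c \<partial>N) + (\<integral>\<^sup>+c. u c \<partial>N)"
      if "borel_measurable N = (borel_measurable (loop_space E) :: (_ \<Rightarrow> ennreal) set)" for N
      using add(1,3) that by (intro nn_integral_add) simp_all
    have J: "(\<integral>\<^sup>+c. w c * (p c + q c) \<partial>count_space D) =
        (\<integral>\<^sup>+c. w c * p c \<partial>count_space D) + (\<integral>\<^sup>+c. w c * q c \<partial>count_space D)"
      for w p q :: "'a list set \<Rightarrow> ennreal" and D
      by (subst nn_integral_add[symmetric]) (simp_all add: distrib_left)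
    show ?case
      by (simp only: I[OF meas(1)] I[OF meas(2)] I[OF meas(3)] J add.IH sum.distrib) (simp only: add_ac)
  next
    case (seq U)
    have lim: "(\<lambda>i. \<integral>\<^sup>+c. U i c \<partial>N) \<longlonglongrightarrow> (\<integral>\<^sup>+c. Sup (range U) c \<partial>N)"
      if "borel_measurable N = (borel_measurable (loop_space E) :: (_ \<Rightarrow> ennreal) set)" for N
    proof (rule nn_integral_LIMSEQ)
      show "U i \<in> borel_measurable N" for i using seq(1) that by simp
      have "(\<lambda>i. U i c) \<longlonglongrightarrow> (SUP i. U i c)" for c
        using seq(3) by (intro LIMSEQ_SUP) (auto simp: incseq_def le_fun_def)
      then show "(\<lambda>i. U i c) \<longlonglongrightarrow> Sup (range U) c" for c by (simp add: image_comp)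
    qed (rule seq(3))
    have mono: "(\<integral>\<^sup>+c. U i c \<partial>N) \<le> (\<integral>\<^sup>+c. U j c \<partial>N)" if "i \<le> j" for i j N
      using incseqD[OF seq(3) that] by (intro nn_integral_mono) (auto simp: le_fun_def)
    have "(\<lambda>i. (\<Sum>x\<in>UNIV. \<integral>\<^sup>+c. U i c \<partial>trivial_loops E x) +
        (\<integral>\<^sup>+c. ennreal (loop_weight E P (SOME \<xi>. \<xi> \<in> c)) * (\<integral>\<^sup>+c. U i c \<partial>exponential_times E (SOME \<xi>. \<xi> \<in> c))
          \<partial>count_space (discrete_loops E))) \<longlonglongrightarrow>
        (\<Sum>x\<in>UNIV. \<integral>\<^sup>+c. Sup (range U) c \<partial>trivial_loops E x) +
        (\<integral>\<^sup>+c. ennreal (loop_weight E P (SOME \<xi>. \<xi> \<in> c)) * (\<integral>\<^sup>+c. Sup (range U) c \<partial>exponential_times E (SOME \<xi>. \<xi> \<in> c))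
          \<partial>count_space (discrete_loops E))"
    proof (intro tendsto_add tendsto_sum lim meas nn_integral_LIMSEQ)
      show "incseq (\<lambda>i c. ennreal (loop_weight E P (SOME \<xi>. \<xi> \<in> c)) * (\<integral>\<^sup>+c. U i c \<partial>exponential_times E (SOME \<xi>. \<xi> \<in> c)))"
        by (auto simp: incseq_def le_fun_def intro!: mult_left_mono mono)
      show "(\<lambda>i. ennreal (loop_weight E P (SOME \<xi>. \<xi> \<in> c)) * (\<integral>\<^sup>+c. U i c \<partial>exponential_times E (SOME \<xi>. \<xi> \<in> c))) \<longlonglongrightarrow>
          ennreal (loop_weight E P (SOME \<xi>. \<xi> \<in> c)) * (\<integral>\<^sup>+c. Sup (range U) c \<partial>exponential_times E (SOME \<xi>. \<xi> \<in> c))" for c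
        by (intro ennreal_tendsto_cmult lim meas) simp
    qed simp
    moreover have "(\<lambda>i. \<integral>\<^sup>+c. U i c \<partial>loop_measure E P) \<longlonglongrightarrow> (\<integral>\<^sup>+c. Sup (range U) c \<partial>loop_measure E P)"
      by (rule lim[OF meas(1)])
    ultimately show ?case unfolding seq.IH by (rule LIMSEQ_unique[rotated])
  qed
qed

lemma nn_integral_exp_Ioi:
  assumes "0 < l"
  shows "(\<integral>\<^sup>+t. ennreal (exp (- (l * t))) * indicator {0<..} t \<partial>lborel) = ennreal (1 / l)"
proof -
  have "(\<integral>\<^sup>+t. ennreal (exp (- (l * t))) * indicator {0<..} t \<partial>lborel) =
      (\<integral>\<^sup>+t. ennreal (1 / l) * ennreal (exponential_density l t) \<partial>lborel)"
    using AE_lborel_singleton[of "0::real"]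
  proof (intro nn_integral_cong_AE, eventually_elim)
    case (elim t)
    show ?case
      using elim assms by (auto simp: erlang_density_def indicator_def mult_ac simp flip: ennreal_mult')
  qed
  also have "\<dots> = ennreal (1 / l) * (\<integral>\<^sup>+t. ennreal (exponential_density l t) \<partial>lborel)"
    by (rule nn_integral_cmult) simp
  also have "(\<integral>\<^sup>+t. ennreal (exponential_density l t) \<partial>lborel) = 1"
    using prob_space.emeasure_space_1[OF prob_space_exponential_density[OF assms]]
    by (simp add: emeasure_density)
  finally show ?thesis by simp
qed

text \<open>The integrand (e^(-t) - e^(-(1+c)t)) / t is the integral of e^(-(1+a)t) over a in
  [0, c]; Tonelli leaves the integral of 1 / (1 + a). The factor 1 - e^(-ct) tames the infinite mass
  at small t.\<close>

lemma frullani_exp: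
  assumes c: "0 \<le> c"
  shows "(\<integral>\<^sup>+t. ennreal (if 0 < t then exp (- t) / t else 0) * ennreal (1 - exp (- (c * t))) \<partial>lborel) = ennreal (ln (1 + c))"
proof -
  have "(\<integral>\<^sup>+t. ennreal (if 0 < t then exp (- t) / t else 0) * ennreal (1 - exp (- (c * t))) \<partial>lborel) =
      (\<integral>\<^sup>+t. (\<integral>\<^sup>+a. ennreal (exp (- ((1 + a) * t))) * indicator {0<..} t * indicator {0..c} a \<partial>lborel) \<partial>lborel)"
  proof (rule nn_integral_cong)
    fix t :: real
    show "ennreal (if 0 < t then exp (- t) / t else 0) * ennreal (1 - exp (- (c * t))) =
        (\<integral>\<^sup>+a. ennreal (exp (- ((1 + a) * t))) * indicator {0<..} t * indicator {0..c} a \<partial>lborel)"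
    proof (cases "0 < t")
      case True
      have "(\<integral>\<^sup>+a. ennreal (exp (- ((1 + a) * t))) * indicator {0..c} a \<partial>lborel) =
          ennreal (- exp (- ((1 + c) * t)) / t - - exp (- ((1 + 0) * t)) / t)"
        using True c by (intro nn_integral_FTC_Icc) (auto intro!: derivative_eq_intros)
      also have "\<dots> = ennreal (exp (- t) / t * (1 - exp (- (c * t))))"
        using True by (simp add: field_simps exp_add[symmetric])
      also have "\<dots> = ennreal (exp (- t) / t) * ennreal (1 - exp (- (c * t)))"
        using True by (intro ennreal_mult') simp
      finally show ?thesis using True by simp
    qed simp
  qed
  also have "\<dots> = (\<integral>\<^sup>+a. (\<integral>\<^sup>+t. ennreal (exp (- ((1 + a) * t))) * indicator {0<..} t * indicator {0..c} a \<partial>lborel) \<partial>lborel)"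
    by (rule lborel_pair.Fubini') measurable
  also have "\<dots> = (\<integral>\<^sup>+a. ennreal (1 / (1 + a)) * indicator {0..c} a \<partial>lborel)"
  proof (rule nn_integral_cong)
    fix a :: real
    show "(\<integral>\<^sup>+t. ennreal (exp (- ((1 + a) * t))) * indicator {0<..} t * indicator {0..c} a \<partial>lborel) =
        ennreal (1 / (1 + a)) * indicator {0..c} a"
      by (cases "a \<in> {0..c}") (auto simp: nn_integral_exp_Ioi)
  qed
  also have "\<dots> = ennreal (ln (1 + c) - ln (1 + 0))"
    using c by (intro nn_integral_FTC_Icc) (auto intro!: derivative_eq_intros)
  finally show ?thesis by simp
qed

section \<open>The Laplace transform of the edge and occupation fields\<close>

text \<open>Trades a sum over pairs of vertices, weighted by jump counts, for a sum along the steps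
  of a loop.\<close>

lemma sum_mult_card_eq:
  fixes m :: "'a::finite \<Rightarrow> 'b::finite \<Rightarrow> nat" and n :: nat
  shows "(\<Sum>x\<in>UNIV. \<Sum>y\<in>UNIV. m x y * card {i. i < n \<and> a i = x \<and> b i = y}) = (\<Sum>i<n. m (a i) (b i))"
proof -
  have card: "card {i. i < n \<and> a i = x \<and> b i = y} = (\<Sum>i<n. of_bool (a i = x) * of_bool (b i = y))" for x y
  proof -
    have "{i. i < n \<and> a i = x \<and> b i = y} = {..<n} \<inter> {i. a i = x \<and> b i = y}" by auto
    then have "card {i. i < n \<and> a i = x \<and> b i = y} = (\<Sum>i<n. if a i = x \<and> b i = y then 1 else 0)"
      by (simp add: sum.If_cases)
    also have "\<dots> = (\<Sum>i<n. of_bool (a i = x) * of_bool (b i = y))" by (intro sum.cong) auto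
    finally show ?thesis .
  qed
  have "(\<Sum>x\<in>UNIV. \<Sum>y\<in>UNIV. m x y * card {i. i < n \<and> a i = x \<and> b i = y}) =
      (\<Sum>x\<in>UNIV. \<Sum>i<n. \<Sum>y\<in>UNIV. m x y * (of_bool (a i = x) * of_bool (b i = y)))"
    unfolding card sum_distrib_left by (intro sum.cong refl sum.swap)
  also have "\<dots> = (\<Sum>i<n. \<Sum>x\<in>UNIV. \<Sum>y\<in>UNIV. m x y * (of_bool (a i = x) * of_bool (b i = y)))"
    by (rule sum.swap)
  also have "\<dots> = (\<Sum>i<n. m (a i) (b i))"
  proof (intro sum.cong refl)
    fix i
    have "(\<Sum>y\<in>UNIV. m x y * (of_bool (a i = x) * of_bool (b i = y))) = (if a i = x then m x (b i) else 0)" for x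
      by (simp add: of_bool_def if_distrib cong: if_cong)
    then show "(\<Sum>x\<in>UNIV. \<Sum>y\<in>UNIV. m x y * (of_bool (a i = x) * of_bool (b i = y))) = m (a i) (b i)"
      by simp
  qed
  finally show ?thesis .
qed

lemma nn_integral_exponential:
  assumes "0 \<le> c"
  shows "(\<integral>\<^sup>+t. ennreal (exp (- (c * t))) \<partial>density lborel (exponential_density 1)) = ennreal (1 / (1 + c))"
proof -
  have "(\<integral>\<^sup>+t. ennreal (exp (- (c * t))) \<partial>density lborel (exponential_density 1)) =
      (\<integral>\<^sup>+t. ennreal (exponential_density 1 t) * ennreal (exp (- (c * t))) \<partial>lborel)"
    by (rule nn_integral_density) auto
  also have "\<dots> = (\<integral>\<^sup>+t. ennreal (exp (- ((1 + c) * t))) * indicator {0<..} t \<partial>lborel)"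
    using AE_lborel_singleton[of "0::real"]
  proof (intro nn_integral_cong_AE, eventually_elim)
    case (elim t)
    show ?case
      using elim
      by (auto simp: erlang_density_def indicator_def distrib_right exp_add[symmetric] simp flip: ennreal_mult')
  qed
  also have "\<dots> = ennreal (1 / (1 + c))" using assms by (intro nn_integral_exp_Ioi) simp
  finally show ?thesis .
qed

lemma measurable_trivial_loop: "(\<lambda>t. timed_loop [x] (\<lambda>_. t)) \<in> measurable borel (loop_space E)"
proof -
  \<comment> \<open>A constant function on all naturals is not extensional, so it is not a point of
    \<open>time_vectors\<close>; only index 0 is read, so it may be restricted.\<close>
  have "timed_loop [x] (\<lambda>_. t) = timed_loop [x] (\<lambda>i\<in>{..<1}. t)" for t by (simp add: timed_loop_def)
  moreover have "(\<lambda>t. \<lambda>i\<in>{..<1}. t) \<in> measurable borel (time_vectors (length [x]))"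
    unfolding time_vectors_def by (simp add: measurable_restrict)
  moreover have "timed_loop [x] \<in> measurable (time_vectors (length [x])) (loop_space E)"
    by (rule measurable_timed_loop) (simp add: skeletons_def)
  ultimately show ?thesis using measurable_compose by fastforce
qed

lemma measurable_timed_loop_exponential:
  assumes "based_loop E \<xi>"
  shows "timed_loop \<xi> \<in> measurable (PiM {..<length \<xi>} (\<lambda>_. density lborel (exponential_density 1))) (loop_space E)"
proof -
  have "sets (PiM {..<length \<xi>} (\<lambda>_. density lborel (exponential_density 1))) = sets (time_vectors (length \<xi>))"
    unfolding time_vectors_def by (intro sets_PiM_cong) auto
  then show ?thesis
    using measurable_timed_loop[of \<xi> E] assms by (simp add: skeletons_def cong: measurable_cong_sets)
qed

section \<open>Laplace transforms under the loop measure\<close>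

context killed_network
begin

text \<open>Its integral against a configuration is the combination of edge and occupation fields
  with natural coefficients, whose exponential is a monomial in the encoded fields.\<close>

definition functional :: "('v \<Rightarrow> 'v \<Rightarrow> nat) \<Rightarrow> ('v \<Rightarrow> nat) \<Rightarrow> ('v \<times> real) list set \<Rightarrow> ennreal" where
  "functional m n c = (\<Sum>x\<in>UNIV. \<Sum>y\<in>UNIV. of_nat (m x y) * of_nat (jumps x y c)) +
     (\<Sum>x\<in>UNIV. of_nat (n x) * (ennreal (time_at x c) / ennreal (wt x)))"

text \<open>The factor 1 / (1 + n_x / lambda_x) is the expectation of exp(-n_x T / lambda_x) for a
  holding time T of mean 1, charged to the vertex that the jump leaves.\<close>

definition damped :: "('v \<Rightarrow> 'v \<Rightarrow> nat) \<Rightarrow> ('v \<Rightarrow> nat) \<Rightarrow> 'v \<Rightarrow> 'v \<Rightarrow> real" where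
  "damped m n x y = tr x y * (exp (- real (m x y)) * (1 / (1 + real (n x) / wt x)))"

lemma damping_bounds:
  "0 \<le> real (n x) / wt x" "0 \<le> exp (- real k) * (1 / (1 + real (n x) / wt x))"
  "exp (- real k) * (1 / (1 + real (n x) / wt x)) \<le> 1"
proof -
  show 1: "0 \<le> real (n x) / wt x" using vertex_weight_pos[of x] by simp
  then show "0 \<le> exp (- real k) * (1 / (1 + real (n x) / wt x))" by simp
  have "exp (- real k) * (1 / (1 + real (n x) / wt x)) \<le> 1 * 1"
    using 1 by (intro mult_mono) auto
  then show "exp (- real k) * (1 / (1 + real (n x) / wt x)) \<le> 1" by simp
qed

lemma damped_bounds: "0 \<le> damped m n x y" "damped m n x y \<le> tr x y"
  unfolding damped_def
  by (rule mult_nonneg_nonneg[OF transition_nonneg damping_bounds(2)])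
    (rule mult_left_le[OF damping_bounds(3) transition_nonneg])

lemma measurable_functional: "functional m n \<in> borel_measurable (loop_space E)"
proof -
  note measurable_jumps [measurable] measurable_time_at [measurable]
  show ?thesis unfolding functional_def[abs_def] by measurable
qed

lemma functional_trivial:
  assumes "0 < t"
  shows "functional m n (timed_loop [x] (\<lambda>_. t)) = ennreal (real (n x) / wt x * t)"
proof -
  have "(\<Sum>y\<in>UNIV. of_nat (n y) * (ennreal (time_at y (timed_loop [x] (\<lambda>_. t))) / ennreal (wt y))) =
      (\<Sum>y\<in>UNIV. if x = y then of_nat (n y) * (ennreal t / ennreal (wt y)) else 0)"
    by (intro sum.cong) (auto simp: time_at_timed_loop)
  also have "\<dots> = of_nat (n x) * (ennreal t / ennreal (wt x))" by simp
  also have "\<dots> = ennreal (real (n x) / wt x * t)"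
    using assms vertex_weight_pos[of x]
    by (simp add: divide_ennreal ennreal_of_nat_eq_real_of_nat flip: ennreal_mult')
  finally show ?thesis by (simp add: functional_def jumps_timed_loop)
qed

text \<open>Jumps and times are regrouped by position, so the exponential factors along the loop.
  Nonnegative times matter: \<open>ennreal\<close> truncates negative sums, which would destroy
  additivity.\<close>

lemma functional_timed_loop:
  assumes \<xi>: "based_loop E \<xi>" and t: "\<And>i. i < length \<xi> \<Longrightarrow> 0 \<le> t i"
  shows "enexp (functional m n (timed_loop \<xi> t)) =
    (\<Prod>i<length \<xi>. exp (- real (m (\<xi> ! i) (\<xi> ! (Suc i mod length \<xi>)))) * exp (- (real (n (\<xi> ! i)) / wt (\<xi> ! i) * t i)))"
proof -
  have len: "\<not> length \<xi> < 2" using \<xi> by (simp add: based_loop_def)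
  have "(\<Sum>x\<in>UNIV. \<Sum>y\<in>UNIV. of_nat (m x y) * of_nat (jumps x y (timed_loop \<xi> t))) =
      (of_nat (\<Sum>x\<in>UNIV. \<Sum>y\<in>UNIV. m x y * card {i. i < length \<xi> \<and> \<xi> ! i = x \<and> \<xi> ! (Suc i mod length \<xi>) = y}) :: ennreal)"
    using len by (simp add: jumps_timed_loop)
  also have "\<dots> = of_nat (\<Sum>i<length \<xi>. m (\<xi> ! i) (\<xi> ! (Suc i mod length \<xi>)))"
    by (subst sum_mult_card_eq) (rule refl)
  finally have J: "(\<Sum>x\<in>UNIV. \<Sum>y\<in>UNIV. of_nat (m x y) * of_nat (jumps x y (timed_loop \<xi> t))) =
    (of_nat (\<Sum>i<length \<xi>. m (\<xi> ! i) (\<xi> ! (Suc i mod length \<xi>))) :: ennreal)" .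
  have "(\<Sum>x\<in>UNIV. of_nat (n x) * (ennreal (time_at x (timed_loop \<xi> t)) / ennreal (wt x))) =
      (\<Sum>x\<in>UNIV. ennreal (\<Sum>i<length \<xi>. if \<xi> ! i = x then real (n x) / wt x * t i else 0))"
  proof (intro sum.cong refl)
    fix x
    have nn: "0 \<le> (\<Sum>i<length \<xi>. if \<xi> ! i = x then t i else 0)" using t by (intro sum_nonneg) auto
    have "of_nat (n x) * (ennreal (time_at x (timed_loop \<xi> t)) / ennreal (wt x)) =
        ennreal (real (n x) / wt x * (\<Sum>i<length \<xi>. if \<xi> ! i = x then t i else 0))"
      using nn vertex_weight_pos[of x] unfolding time_at_timed_loop
      by (simp add: divide_ennreal ennreal_of_nat_eq_real_of_nat flip: ennreal_mult')
    also have "real (n x) / wt x * (\<Sum>i<length \<xi>. if \<xi> ! i = x then t i else 0) =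
        (\<Sum>i<length \<xi>. if \<xi> ! i = x then real (n x) / wt x * t i else 0)"
      unfolding sum_distrib_left by (intro sum.cong) auto
    finally show "of_nat (n x) * (ennreal (time_at x (timed_loop \<xi> t)) / ennreal (wt x)) =
      ennreal (\<Sum>i<length \<xi>. if \<xi> ! i = x then real (n x) / wt x * t i else 0)" .
  qed
  also have "\<dots> = ennreal (\<Sum>x\<in>UNIV. \<Sum>i<length \<xi>. if \<xi> ! i = x then real (n x) / wt x * t i else 0)"
  proof (intro sum_ennreal sum_nonneg)
    fix x i assume "i \<in> {..<length \<xi>}"
    then have "0 \<le> real (n x) / wt x * t i" using t by (intro mult_nonneg_nonneg damping_bounds) auto
    then show "0 \<le> (if \<xi> ! i = x then real (n x) / wt x * t i else 0)" by (simp only: order_refl split: if_split) blast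
  qed
  also have "(\<Sum>x\<in>UNIV. \<Sum>i<length \<xi>. if \<xi> ! i = x then real (n x) / wt x * t i else 0) =
      (\<Sum>i<length \<xi>. real (n (\<xi> ! i)) / wt (\<xi> ! i) * t i)"
    by (subst sum.swap) simp
  finally have T: "(\<Sum>x\<in>UNIV. of_nat (n x) * (ennreal (time_at x (timed_loop \<xi> t)) / ennreal (wt x))) =
      ennreal (\<Sum>i<length \<xi>. real (n (\<xi> ! i)) / wt (\<xi> ! i) * t i)" .
  have nn: "0 \<le> (\<Sum>i<length \<xi>. real (n (\<xi> ! i)) / wt (\<xi> ! i) * t i)"
    using t damping_bounds(1) by (intro sum_nonneg mult_nonneg_nonneg) auto
  show ?thesis
    unfolding functional_def J T enexp_add enexp_of_nat enexp_ennreal[OF nn] prod.distrib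
    by (simp add: exp_sum[symmetric] sum_negf)
qed

text \<open>Independence of the holding times turns the expectation into the product of the damping
  factors met along the loop.\<close>

lemma laplace_exponential_times:
  assumes \<xi>: "based_loop E \<xi>"
  shows "(\<integral>\<^sup>+c. ennreal (1 - enexp (functional m n c)) \<partial>exponential_times E \<xi>) =
    ennreal (1 - (\<Prod>i<length \<xi>. exp (- real (m (\<xi> ! i) (\<xi> ! (Suc i mod length \<xi>)))) *
      (1 / (1 + real (n (\<xi> ! i)) / wt (\<xi> ! i)))))"
    (is "_ = ennreal (1 - (\<Prod>i<_. ?e i * (1 / (1 + ?c i))))")
proof -
  define D where "D = density lborel (\<lambda>t. ennreal (exponential_density 1 t))"
  define T where "T = PiM {..<length \<xi>} (\<lambda>_. D)"
  have D: "prob_space D" unfolding D_def by (rule prob_space_exponential_density) simp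
  interpret product_prob_space "\<lambda>_. D" "{..<length \<xi>}"
    by (simp add: product_prob_space_def product_prob_space_axioms_def product_sigma_finite_def D prob_space_imp_sigma_finite)
  have T: "prob_space T" unfolding T_def by (rule prob_space_PiM) (rule D)
  have tm: "timed_loop \<xi> \<in> measurable T (loop_space E)"
    unfolding T_def D_def by (rule measurable_timed_loop_exponential[OF \<xi>])
  have meas: "(\<lambda>c. ennreal (1 - enexp (functional m n c))) \<in> borel_measurable (loop_space E)"
    "(\<lambda>c. ennreal (enexp (functional m n c))) \<in> borel_measurable (loop_space E)"
    using measurable_functional[of m n] by measurable
  note mT = measurable_compose[OF tm meas(2)]
  have "(\<integral>\<^sup>+c. ennreal (1 - enexp (functional m n c)) \<partial>exponential_times E \<xi>) =
      (\<integral>\<^sup>+t. ennreal (1 - enexp (functional m n (timed_loop \<xi> t))) \<partial>T)"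
    unfolding exponential_times_def D_def[symmetric] T_def[symmetric] by (rule nn_integral_distr[OF tm]) (simp add: meas)
  also have "\<dots> = (\<integral>\<^sup>+t. 1 - ennreal (enexp (functional m n (timed_loop \<xi> t))) \<partial>T)"
    by (intro nn_integral_cong) (simp add: ennreal_minus[symmetric])
  also have "\<dots> = (\<integral>\<^sup>+t. 1 \<partial>T) - (\<integral>\<^sup>+t. ennreal (enexp (functional m n (timed_loop \<xi> t))) \<partial>T)"
  proof (rule nn_integral_diff)
    have "(\<integral>\<^sup>+t. ennreal (enexp (functional m n (timed_loop \<xi> t))) \<partial>T) \<le> (\<integral>\<^sup>+t. 1 \<partial>T)"
      by (intro nn_integral_mono) simp
    also have "\<dots> = 1" using prob_space.emeasure_space_1[OF T] by simp
    finally show "(\<integral>\<^sup>+t. ennreal (enexp (functional m n (timed_loop \<xi> t))) \<partial>T) \<noteq> \<infinity>"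
      by (auto simp: top_unique)
  qed (use mT in auto)
  also have "(\<integral>\<^sup>+t. 1 \<partial>T) = 1" using prob_space.emeasure_space_1[OF T] by simp
  also have "(\<integral>\<^sup>+t. ennreal (enexp (functional m n (timed_loop \<xi> t))) \<partial>T) =
      (\<integral>\<^sup>+t. (\<Prod>i<length \<xi>. ennreal (?e i) * ennreal (exp (- (?c i * t i)))) \<partial>T)"
  proof (rule nn_integral_cong_AE)
    \<comment> \<open>The factorization along the loop holds only for nonnegative times, which the
      exponential law guarantees almost surely.\<close>
    have "AE t in D. 0 \<le> t"
      unfolding D_def by (subst AE_density) (auto simp: erlang_density_def)
    then have "AE t in T. 0 \<le> t i" if "i \<in> {..<length \<xi>}" for i
      unfolding T_def using that D by (intro AE_PiM_component) auto
    then have "AE t in T. \<forall>i\<in>{..<length \<xi>}. 0 \<le> t i"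
      by (intro AE_finite_allI) auto
    then show "AE t in T. ennreal (enexp (functional m n (timed_loop \<xi> t))) =
        (\<Prod>i<length \<xi>. ennreal (?e i) * ennreal (exp (- (?c i * t i))))"
    proof eventually_elim
      case (elim t)
      then have "enexp (functional m n (timed_loop \<xi> t)) = (\<Prod>i<length \<xi>. ?e i * exp (- (?c i * t i)))"
        by (intro functional_timed_loop[OF \<xi>]) auto
      then show ?case by (simp add: prod_ennreal ennreal_mult'[symmetric])
    qed
  qed
  also have "\<dots> = (\<Prod>i<length \<xi>. \<integral>\<^sup>+t. ennreal (?e i) * ennreal (exp (- (?c i * t))) \<partial>D)"
    unfolding T_def by (rule product_nn_integral_prod) (auto simp: D_def)
  also have "\<dots> = (\<Prod>i<length \<xi>. ennreal (?e i * (1 / (1 + ?c i))))"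
  proof (intro prod.cong refl)
    fix i
    have "(\<integral>\<^sup>+t. ennreal (?e i) * ennreal (exp (- (?c i * t))) \<partial>D) =
        ennreal (?e i) * (\<integral>\<^sup>+t. ennreal (exp (- (?c i * t))) \<partial>D)"
      by (rule nn_integral_cmult) (simp add: D_def)
    also have "\<dots> = ennreal (?e i) * ennreal (1 / (1 + ?c i))"
      unfolding D_def by (subst nn_integral_exponential) (auto intro: damping_bounds)
    also have "\<dots> = ennreal (?e i * (1 / (1 + ?c i)))" by (rule ennreal_mult'[symmetric]) simp
    finally show "(\<integral>\<^sup>+t. ennreal (?e i) * ennreal (exp (- (?c i * t))) \<partial>D) = ennreal (?e i * (1 / (1 + ?c i)))" .
  qed
  also have "\<dots> = ennreal (\<Prod>i<length \<xi>. ?e i * (1 / (1 + ?c i)))"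
    by (rule prod_ennreal) (rule damping_bounds)
  also have "1 - \<dots> = ennreal (1 - (\<Prod>i<length \<xi>. ?e i * (1 / (1 + ?c i))))"
  proof -
    have "0 \<le> (\<Prod>i<length \<xi>. ?e i * (1 / (1 + ?c i)))" by (intro prod_nonneg ballI damping_bounds)
    then show ?thesis by (simp only: ennreal_minus flip: ennreal_1)
  qed
  finally show ?thesis .
qed

lemma laplace_trivial_loops:
  "(\<integral>\<^sup>+c. ennreal (1 - enexp (functional m n c)) \<partial>trivial_loops E x) = ennreal (ln (1 + real (n x) / wt x))"
proof -
  define d where "d t = ennreal (if 0 < t then exp (- t) / t else 0)" for t :: real
  have d: "d \<in> borel_measurable lborel" unfolding d_def[abs_def] by measurable
  have meas: "(\<lambda>c. ennreal (1 - enexp (functional m n c))) \<in> borel_measurable (loop_space E)"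
    using measurable_functional[of m n] by measurable
  have tm: "(\<lambda>t. timed_loop [x] (\<lambda>_. t)) \<in> measurable (density lborel d) (loop_space E)"
    using measurable_trivial_loop[of x E] by (simp cong: measurable_cong_sets)
  have "(\<integral>\<^sup>+c. ennreal (1 - enexp (functional m n c)) \<partial>trivial_loops E x) =
      (\<integral>\<^sup>+t. ennreal (1 - enexp (functional m n (timed_loop [x] (\<lambda>_. t)))) \<partial>density lborel d)"
    unfolding trivial_loops_def d_def[symmetric] by (rule nn_integral_distr[OF tm]) (simp add: meas)
  also have "\<dots> = (\<integral>\<^sup>+t. d t * ennreal (1 - enexp (functional m n (timed_loop [x] (\<lambda>_. t)))) \<partial>lborel)"
    using measurable_compose[OF measurable_trivial_loop[of x E] meas]
    by (intro nn_integral_density d) simp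
  also have "\<dots> = (\<integral>\<^sup>+t. d t * ennreal (1 - exp (- (real (n x) / wt x * t))) \<partial>lborel)"
  proof (rule nn_integral_cong)
    fix t
    show "d t * ennreal (1 - enexp (functional m n (timed_loop [x] (\<lambda>_. t)))) =
        d t * ennreal (1 - exp (- (real (n x) / wt x * t)))"
    proof (cases "0 < t")
      case True
      have "0 \<le> real (n x) / wt x * t" using True damping_bounds(1) by (intro mult_nonneg_nonneg) auto
      then show ?thesis unfolding functional_trivial[OF True] by (simp only: enexp_ennreal)
    qed (simp add: d_def)
  qed
  also have "\<dots> = ennreal (ln (1 + real (n x) / wt x))"
    unfolding d_def by (rule frullani_exp) (rule damping_bounds)
  finally show ?thesis .
qed

text \<open>The loop weight times one minus its damping is the weight for P minus the weight for the
  damped matrix. Both totals are finite, which legitimates the subtraction in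
  \<open>ennreal\<close>; trivial loops add the logarithms.\<close>

lemma laplace_loop_measure:
  "(\<integral>\<^sup>+c. ennreal (1 - enexp (functional m n c)) \<partial>loop_measure E (transition C \<kappa>)) =
    ennreal ((\<Sum>x\<in>UNIV. ln (1 + real (n x) / wt x)) +
      (loop_mass_total (\<lambda>x y. tr x y) - loop_mass_total (damped m n)))"
proof -
  have meas: "(\<lambda>c. ennreal (1 - enexp (functional m n c))) \<in> borel_measurable (loop_space E)"
    using measurable_functional[of m n] by measurable
  let ?P = "\<lambda>x y. tr x y"
  let ?w = "\<lambda>Q c. 1 / real (loop_multiplicity E (SOME \<xi>. \<xi> \<in> c)) * cyclic_prod Q (SOME \<xi>. \<xi> \<in> c)"
  have le: "loop_mass_total (damped m n) \<le> loop_mass_total ?P"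
    by (rule sums_le[OF _ loop_mass_total_sums[OF damped_bounds] loop_mass_total_sums[OF transition_nonneg order_refl]])
      (intro divide_right_mono sum_mono mpow_mono damped_bounds; simp)
  have cp: "0 \<le> cyclic_prod (damped m n) \<xi>" for \<xi>
    unfolding cyclic_prod_def by (intro prod_nonneg ballI damped_bounds)
  have "(\<integral>\<^sup>+c. ennreal (loop_weight E (transition C \<kappa>) (SOME \<xi>. \<xi> \<in> c)) *
        (\<integral>\<^sup>+c. ennreal (1 - enexp (functional m n c)) \<partial>exponential_times E (SOME \<xi>. \<xi> \<in> c))
      \<partial>count_space (discrete_loops E)) =
      (\<integral>\<^sup>+c. ennreal (?w ?P c) - ennreal (?w (damped m n) c) \<partial>count_space (discrete_loops E))"
  proof (rule nn_integral_cong)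
    fix c assume "c \<in> space (count_space (discrete_loops E))"
    then have c: "c \<in> discrete_loops E" by simp
    define \<xi> where "\<xi> = (SOME \<xi>. \<xi> \<in> c)"
    have \<xi>: "based_loop E \<xi>" unfolding \<xi>_def by (rule discrete_loops_representative[OF c])
    define R where "R = (\<Prod>i<length \<xi>. exp (- real (m (\<xi> ! i) (\<xi> ! (Suc i mod length \<xi>)))) *
      (1 / (1 + real (n (\<xi> ! i)) / wt (\<xi> ! i))))"
    have w: "loop_weight E (transition C \<kappa>) \<xi> = 1 / real (loop_multiplicity E \<xi>) * cyclic_prod ?P \<xi>"
      by (simp add: loop_weight_def cyclic_prod_def)
    have PR: "cyclic_prod ?P \<xi> * R = cyclic_prod (damped m n) \<xi>"
      unfolding cyclic_prod_def R_def damped_def prod.distrib by simp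
    have "ennreal (loop_weight E (transition C \<kappa>) \<xi>) *
        (\<integral>\<^sup>+c. ennreal (1 - enexp (functional m n c)) \<partial>exponential_times E \<xi>) =
        ennreal (1 / real (loop_multiplicity E \<xi>) * cyclic_prod ?P \<xi> * (1 - R))"
      unfolding laplace_exponential_times[OF \<xi>] R_def[symmetric] w
      by (rule ennreal_mult'[symmetric]) (intro mult_nonneg_nonneg; simp add: cyclic_prod_def prod_nonneg transition_nonneg)
    also have "1 / real (loop_multiplicity E \<xi>) * cyclic_prod ?P \<xi> * (1 - R) =
        1 / real (loop_multiplicity E \<xi>) * cyclic_prod ?P \<xi> - 1 / real (loop_multiplicity E \<xi>) * cyclic_prod (damped m n) \<xi>"
      unfolding PR[symmetric] by (simp only: right_diff_distrib mult_1_right mult.assoc)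
    also have "ennreal \<dots> = ennreal (1 / real (loop_multiplicity E \<xi>) * cyclic_prod ?P \<xi>) -
        ennreal (1 / real (loop_multiplicity E \<xi>) * cyclic_prod (damped m n) \<xi>)"
      by (rule ennreal_minus[symmetric]) (intro mult_nonneg_nonneg cp, simp)
    finally show "ennreal (loop_weight E (transition C \<kappa>) (SOME \<xi>. \<xi> \<in> c)) *
        (\<integral>\<^sup>+c. ennreal (1 - enexp (functional m n c)) \<partial>exponential_times E (SOME \<xi>. \<xi> \<in> c)) =
        ennreal (?w ?P c) - ennreal (?w (damped m n) c)"
      unfolding \<xi>_def .
  qed
  also have "\<dots> = (\<integral>\<^sup>+c. ennreal (?w ?P c) \<partial>count_space (discrete_loops E)) -
      (\<integral>\<^sup>+c. ennreal (?w (damped m n) c) \<partial>count_space (discrete_loops E))"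
  proof (rule nn_integral_diff)
    show "(\<integral>\<^sup>+c. ennreal (?w (damped m n) c) \<partial>count_space (discrete_loops E)) \<noteq> \<infinity>"
      by (subst sum_loop_weights[OF damped_bounds]) simp
    have "cyclic_prod (damped m n) \<xi> \<le> cyclic_prod ?P \<xi>" for \<xi>
      unfolding cyclic_prod_def by (intro prod_mono conjI damped_bounds)
    then show "AE c in count_space (discrete_loops E). ennreal (?w (damped m n) c) \<le> ennreal (?w ?P c)"
      by (intro always_eventually allI ennreal_leI mult_left_mono) auto
  qed auto
  also have "\<dots> = ennreal (loop_mass_total ?P - loop_mass_total (damped m n))"
  proof -
    have "0 \<le> loop_mass_total (damped m n)"
      by (rule sums_le[OF _ sums_zero loop_mass_total_sums[OF damped_bounds]])
        (intro divide_nonneg_nonneg sum_nonneg mpow_nonneg damped_bounds, simp)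
    then show ?thesis
      by (subst sum_loop_weights[OF damped_bounds], subst sum_loop_weights[OF transition_nonneg order_refl])
        (rule ennreal_minus)
  qed
  finally have L: "(\<integral>\<^sup>+c. ennreal (loop_weight E (transition C \<kappa>) (SOME \<xi>. \<xi> \<in> c)) *
        (\<integral>\<^sup>+c. ennreal (1 - enexp (functional m n c)) \<partial>exponential_times E (SOME \<xi>. \<xi> \<in> c))
      \<partial>count_space (discrete_loops E)) = ennreal (loop_mass_total ?P - loop_mass_total (damped m n))" .
  have ln: "0 \<le> ln (1 + real (n x) / wt x)" for x using damping_bounds(1)[of n x] by (intro ln_ge_zero) simp
  show ?thesis
    unfolding nn_integral_loop_measure[OF meas] L laplace_trivial_loops
    using le ln by (simp add: sum_ennreal sum_nonneg ennreal_plus)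
qed

text \<open>In the exponential of Campbell's formula the logarithms become the factors 1 / (1 + n_x
  / lambda_x), and the total for P becomes det(I - P). The left side is a moment of the encoded
  fields.\<close>

lemma laplace_fields:
  assumes M: "prob_space M" and L: "loop_ensemble M E C \<kappa> 1 L"
  shows "(\<integral>\<^sup>+\<omega>. ennreal ((\<Prod>x\<in>UNIV. \<Prod>y\<in>UNIV. enexp (edge_field (L \<omega>) x y) ^ m x y) *
      (\<Prod>x\<in>UNIV. enexp (occupation_field C \<kappa> (L \<omega>) x) ^ n x)) \<partial>M) =
    ennreal (det (mat 1 - transition C \<kappa>) * (\<Prod>x\<in>UNIV. 1 / (1 + real (n x) / wt x)) *
      exp (loop_mass_total (damped m n)))"
proof -
  let ?\<nu> = "loop_measure E (transition C \<kappa>)"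
  have PP: "poisson_process M ?\<nu> L"
    using L by (simp add: loop_ensemble_def)
  have bm: "borel_measurable N = (borel_measurable (loop_space E) :: (_ \<Rightarrow> ennreal) set)"
    if "sets N = loop_sets E" for N
    using that by (intro measurable_cong_sets) (simp_all add: sets_loop_space)
  have field: "(\<integral>\<^sup>+c. functional m n c \<partial>L \<omega>) =
      (\<Sum>x\<in>UNIV. \<Sum>y\<in>UNIV. of_nat (m x y) * edge_field (L \<omega>) x y) +
      (\<Sum>x\<in>UNIV. of_nat (n x) * occupation_field C \<kappa> (L \<omega>) x)" if "\<omega> \<in> space M" for \<omega>
  proof -
    have sets: "sets (L \<omega>) = loop_sets E"
      using sets_poisson[OF M PP that] by (simp add: sets_loop_measure)
    have [measurable]: "(\<lambda>c. of_nat (jumps x y c) :: ennreal) \<in> borel_measurable (L \<omega>)" for x y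
      unfolding bm[OF sets] by (rule measurable_jumps)
    have [measurable]: "(\<lambda>c. ennreal (time_at x c)) \<in> borel_measurable (L \<omega>)" for x
      unfolding bm[OF sets] using measurable_time_at[of x E] by measurable
    show ?thesis
      unfolding functional_def edge_field_def occupation_field_def
      by (simp add: nn_integral_add nn_integral_sum nn_integral_cmult nn_integral_divide)
  qed
  have "(\<integral>\<^sup>+\<omega>. ennreal ((\<Prod>x\<in>UNIV. \<Prod>y\<in>UNIV. enexp (edge_field (L \<omega>) x y) ^ m x y) *
      (\<Prod>x\<in>UNIV. enexp (occupation_field C \<kappa> (L \<omega>) x) ^ n x)) \<partial>M) =
      (\<integral>\<^sup>+\<omega>. ennreal (enexp (\<integral>\<^sup>+c. functional m n c \<partial>L \<omega>)) \<partial>M)"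
    by (intro nn_integral_cong) (simp add: field enexp_add enexp_sum enexp_mult_of_nat)
  also have "\<dots> = ennreal (enexp (\<integral>\<^sup>+c. ennreal (1 - enexp (functional m n c)) \<partial>?\<nu>))"
    by (rule laplace_poisson[OF M PP]) (simp add: bm sets_loop_measure measurable_functional)
  also have "\<dots> = ennreal (exp (- ((\<Sum>x\<in>UNIV. ln (1 + real (n x) / wt x)) +
      (loop_mass_total (\<lambda>x y. tr x y) - loop_mass_total (damped m n)))))"
  proof -
    have ln: "0 \<le> ln (1 + real (n x) / wt x)" for x using damping_bounds(1)[of n x] by (intro ln_ge_zero) simp
    have le: "loop_mass_total (damped m n) \<le> loop_mass_total (\<lambda>x y. tr x y)"
      by (rule sums_le[OF _ loop_mass_total_sums[OF damped_bounds] loop_mass_total_sums[OF transition_nonneg order_refl]])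
        (intro divide_right_mono sum_mono mpow_mono damped_bounds; simp)
    show ?thesis
      unfolding laplace_loop_measure using ln le by (subst enexp_ennreal) (auto intro!: add_nonneg_nonneg sum_nonneg)
  qed
  also have "exp (- ((\<Sum>x\<in>UNIV. ln (1 + real (n x) / wt x)) +
      (loop_mass_total (\<lambda>x y. tr x y) - loop_mass_total (damped m n)))) =
      det (mat 1 - transition C \<kappa>) * (\<Prod>x\<in>UNIV. 1 / (1 + real (n x) / wt x)) * exp (loop_mass_total (damped m n))"
  proof -
    have "exp (- (\<Sum>x\<in>UNIV. ln (1 + real (n x) / wt x))) = (\<Prod>x\<in>UNIV. 1 / (1 + real (n x) / wt x))"
      unfolding sum_negf[symmetric] exp_sum[OF finite]
    proof (intro prod.cong refl)
      fix x
      have "0 < 1 + real (n x) / wt x" using damping_bounds(1)[of n x] by linarith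
      then show "exp (- ln (1 + real (n x) / wt x)) = 1 / (1 + real (n x) / wt x)"
        by (simp only: exp_minus exp_ln inverse_eq_divide)
    qed
    moreover have "exp (- (a + (b - c))) = exp (- b) * exp (- a) * exp c" for a b c :: real
      by (simp add: exp_add[symmetric])
    ultimately show ?thesis unfolding det_transition by simp
  qed
  finally show ?thesis .
qed

end

section \<open>Identification of the joint law\<close>

lemma nn_integral_lborel_vec_prod:
  fixes f :: "'n::finite \<Rightarrow> real \<Rightarrow> ennreal"
  assumes "\<And>i. f i \<in> borel_measurable borel"
  shows "(\<integral>\<^sup>+\<rho>. (\<Prod>i\<in>UNIV. f i (\<rho> $ i)) \<partial>(lborel :: (real^'n) measure)) = (\<Prod>i\<in>UNIV. \<integral>\<^sup>+t. f i t \<partial>lborel)"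
proof -
  \<comment> \<open>The product formula for Lebesgue measure is indexed by basis vectors;
    \<open>idx\<close> turns one back into its coordinate.\<close>
  define idx where "idx b = (THE i. b = axis i (1::real))" for b :: "real^'n"
  have idx: "idx (axis i 1) = i" for i by (simp add: idx_def axis_eq_axis)
  have basis: "(Basis :: (real^'n) set) = (\<lambda>i. axis i 1) ` UNIV" by (auto simp: Basis_vec_def)
  have inj: "inj (\<lambda>i. axis i (1::real) :: real^'n)" by (auto simp: inj_def axis_eq_axis)
  have "(\<integral>\<^sup>+\<rho>. (\<Prod>b\<in>Basis. f (idx b) (\<rho> \<bullet> b)) \<partial>(lborel :: (real^'n) measure)) =
      (\<Prod>b\<in>(Basis :: (real^'n) set). \<integral>\<^sup>+t. f (idx b) t \<partial>lborel)"
    using assms by (intro nn_integral_lborel_prod) auto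
  then show ?thesis unfolding basis by (simp add: prod.reindex[OF inj] idx inner_axis)
qed

text \<open>Exponential tilting: an Erlang density of rate l times e^(-ct) is a multiple of the one
  of rate l + c, and the multiple is the ratio of the normalizing constants.\<close>

lemma nn_integral_erlang_density_exp:
  assumes "0 < l" "0 \<le> c"
  shows "(\<integral>\<^sup>+t. ennreal (erlang_density k l t * exp (- (c * t))) \<partial>lborel) = ennreal ((l / (l + c)) ^ Suc k)"
proof -
  have pos: "0 < l + c" using assms by simp
  have K: "0 \<le> (l / (l + c)) ^ Suc k" using assms by (intro zero_le_power) simp
  have eq: "erlang_density k l t * exp (- (c * t)) = (l / (l + c)) ^ Suc k * erlang_density k (l + c) t" for t
  proof -
    have "(l / (l + c)) ^ Suc k * (l + c) ^ Suc k = l ^ Suc k"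
      using pos by (simp only: power_mult_distrib[symmetric]) simp
    moreover have "exp (- (l + c) * t) = exp (- l * t) * exp (- (c * t))"
      by (simp add: exp_add[symmetric] algebra_simps)
    ultimately have *: "(l / (l + c)) ^ Suc k * ((l + c) ^ Suc k * t ^ k * exp (- (l + c) * t) / fact k) =
        l ^ Suc k * t ^ k * exp (- l * t) / fact k * exp (- (c * t))"
      by (metis (no_types, opaque_lifting) mult.assoc times_divide_eq_left times_divide_eq_right)
    show ?thesis
      unfolding erlang_density_def by (cases "t < 0") (simp, simp only: * if_False)
  qed
  have "(\<integral>\<^sup>+t. ennreal (erlang_density k l t * exp (- (c * t))) \<partial>lborel) =
      ennreal ((l / (l + c)) ^ Suc k) * (\<integral>\<^sup>+t. ennreal (erlang_density k (l + c) t) \<partial>lborel)"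
    unfolding eq ennreal_mult'[OF K] by (rule nn_integral_cmult) simp
  also have "(\<integral>\<^sup>+t. ennreal (erlang_density k (l + c) t) \<partial>lborel) = 1"
    using prob_space.emeasure_space_1[OF prob_space_erlang_density[OF pos, of k]]
    by (simp add: emeasure_density)
  finally show ?thesis by simp
qed

lemma borel_measurable_vec_lambda:
  fixes f :: "'n::finite \<Rightarrow> 'a \<Rightarrow> real"
  assumes "\<And>i. f i \<in> borel_measurable M"
  shows "(\<lambda>\<omega>. \<chi> i. f i \<omega>) \<in> borel_measurable M"
proof (rule borel_measurable_euclidean_space[THEN iffD2], rule ballI)
  fix b :: "real^'n" assume "b \<in> Basis"
  then obtain i where "b = axis i 1" by (auto simp: Basis_vec_def)
  then show "(\<lambda>\<omega>. (\<chi> i. f i \<omega>) \<bullet> b) \<in> borel_measurable M" using assms by (simp add: inner_axis)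
qed

lemma measurable_vec_nth [measurable (raw)]:
  fixes f :: "'a \<Rightarrow> real^'n::finite"
  assumes "f \<in> borel_measurable M"
  shows "(\<lambda>x. f x $ i) \<in> borel_measurable M"
  by (rule measurable_compose[OF assms]) (intro borel_measurable_continuous_onI continuous_intros)

lemma prod_UNIV_Plus_pairs:
  fixes g :: "'a::finite + 'b::finite \<times> 'c::finite \<Rightarrow> real"
  shows "(\<Prod>i\<in>UNIV. g i) = (\<Prod>x\<in>UNIV. g (Inl x)) * (\<Prod>x\<in>UNIV. \<Prod>y\<in>UNIV. g (Inr (x, y)))"
  unfolding UNIV_Plus_UNIV[symmetric]
  by (subst prod.Plus) (simp_all add: prod.cartesian_product comp_def case_prod_unfold)

text \<open>
  A pair of an edge field and an occupation field, with values possibly infinite, is encoded as a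
  point of the unit cube; this makes its law accessible through moments.
\<close>

definition encode :: "('v::finite \<Rightarrow> 'v \<Rightarrow> ennreal) \<Rightarrow> ('v \<Rightarrow> ennreal) \<Rightarrow> real^('v + 'v \<times> 'v)" where
  "encode e h = (\<chi> i. case i of Inl x \<Rightarrow> enexp (h x) | Inr (x, y) \<Rightarrow> enexp (e x y))"

lemma encode_nth [simp]: "encode e h $ Inl x = enexp (h x)" "encode e h $ Inr (x, y) = enexp (e x y)"
  by (simp_all add: encode_def)

lemma encode_cube: "\<forall>i. 0 \<le> encode e h $ i \<and> encode e h $ i \<le> 1"
proof
  show "0 \<le> encode e h $ i \<and> encode e h $ i \<le> 1" for i by (cases i) auto
qed

lemma prod_encode:
  "(\<Prod>i\<in>UNIV. encode e h $ i ^ p i) =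
    (\<Prod>x\<in>UNIV. \<Prod>y\<in>UNIV. enexp (e x y) ^ p (Inr (x, y))) * (\<Prod>x\<in>UNIV. enexp (h x) ^ p (Inl x))"
  by (simp add: prod_UNIV_Plus_pairs mult.commute)

lemma measurable_encode:
  fixes e :: "'w \<Rightarrow> 'v::finite \<Rightarrow> 'v \<Rightarrow> ennreal" and h :: "'w \<Rightarrow> 'v \<Rightarrow> ennreal"
  assumes "\<And>x y. (\<lambda>\<omega>. e \<omega> x y) \<in> borel_measurable N" "\<And>x. (\<lambda>\<omega>. h \<omega> x) \<in> borel_measurable N"
  shows "(\<lambda>\<omega>. encode (e \<omega>) (h \<omega>)) \<in> borel_measurable N"
  unfolding encode_def
proof (rule borel_measurable_vec_lambda)
  fix i :: "'v + 'v \<times> 'v"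
  note assms [measurable]
  show "(\<lambda>\<omega>. case i of Inl x \<Rightarrow> enexp (h \<omega> x) | Inr (x, y) \<Rightarrow> enexp (e \<omega> x y)) \<in> borel_measurable N"
    by (cases i) auto
qed

lemma AE_distr_encode_cube:
  assumes "(\<lambda>\<omega>. encode (e \<omega>) (h \<omega>)) \<in> borel_measurable N"
  shows "AE u in distr N borel (\<lambda>\<omega>. encode (e \<omega>) (h \<omega>)). \<forall>i. 0 \<le> u $ i \<and> u $ i \<le> 1"
  using assms encode_cube by (subst AE_distr_iff) (auto, measurable)

lemma decode_edge_iff:
  "encode e h \<in> {u. \<forall>x y. u $ Inr (x, y) = exp (- real (k x y))} \<longleftrightarrow> (\<forall>x y. e x y = of_nat (k x y))"
  by (simp add: enexp_of_nat[symmetric] enexp_eq_iff)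

text \<open>Positivity of a coordinate says that the occupation is finite, and - ln then recovers
  it. \<open>B\<close> lies in the nonnegative orthant because \<open>ennreal\<close> identifies
  negative numbers with 0.\<close>

lemma decode_occupation_iff:
  fixes h :: "'v::finite \<Rightarrow> ennreal"
  assumes B: "B \<subseteq> {\<rho>. \<forall>x. 0 \<le> \<rho> $ x}"
  shows "encode e h \<in> {u. (\<forall>x. 0 < u $ Inl x) \<and> (\<chi> x. - ln (u $ Inl x)) \<in> B} \<longleftrightarrow>
    (\<exists>\<rho>\<in>B. \<forall>x. h x = ennreal (\<rho> $ x))"
proof
  assume *: "encode e h \<in> {u. (\<forall>x. 0 < u $ Inl x) \<and> (\<chi> x. - ln (u $ Inl x)) \<in> B}"
  then have fin: "h x \<noteq> \<infinity>" for x by (simp add: enexp_pos_iff)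
  then have "- ln (enexp (h x)) = enn2real (h x)" for x by (simp add: enexp_def)
  then have "(\<chi> x. enn2real (h x)) \<in> B" using * by simp
  moreover have "h x = ennreal (enn2real (h x))" for x using fin[of x] by (simp add: less_top)
  ultimately show "\<exists>\<rho>\<in>B. \<forall>x. h x = ennreal (\<rho> $ x)" by (intro bexI[of _ "\<chi> x. enn2real (h x)"]) simp_all
next
  assume "\<exists>\<rho>\<in>B. \<forall>x. h x = ennreal (\<rho> $ x)"
  then obtain \<rho> where \<rho>: "\<rho> \<in> B" "\<And>x. h x = ennreal (\<rho> $ x)" by blast
  then have "enexp (h x) = exp (- \<rho> $ x)" for x using B by (simp add: enexp_ennreal subset_iff)
  then show "encode e h \<in> {u. (\<forall>x. 0 < u $ Inl x) \<and> (\<chi> x. - ln (u $ Inl x)) \<in> B}"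
    using \<rho>(1) by simp
qed

lemma measurable_decode_sets:
  fixes k :: "'v::finite \<Rightarrow> 'v \<Rightarrow> nat"
  shows "{u :: real^('v + 'v \<times> 'v). \<forall>x y. u $ Inr (x, y) = exp (- real (k x y))} \<in> sets borel"
    and "B \<in> sets (borel :: (real^'v) measure) \<Longrightarrow>
      {u :: real^('v + 'v \<times> 'v). (\<forall>x. 0 < u $ Inl x) \<and> (\<chi> x. - ln (u $ Inl x)) \<in> B} \<in> sets borel"
proof -
  show "{u :: real^('v + 'v \<times> 'v). \<forall>x y. u $ Inr (x, y) = exp (- real (k x y))} \<in> sets borel"
    by measurable
  assume B: "B \<in> sets (borel :: (real^'v) measure)"
  have "(\<lambda>u :: real^('v + 'v \<times> 'v). \<chi> x. - ln (u $ Inl x)) \<in> borel_measurable borel"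
    by (rule borel_measurable_vec_lambda) measurable
  from measurable_sets[OF this B]
  have "{u :: real^('v + 'v \<times> 'v). (\<chi> x. - ln (u $ Inl x)) \<in> B} \<in> sets borel" by (simp add: vimage_def)
  moreover have "{u :: real^('v + 'v \<times> 'v). \<forall>x. 0 < u $ Inl x} \<in> sets borel" by measurable
  ultimately have "{u :: real^('v + 'v \<times> 'v). \<forall>x. 0 < u $ Inl x} \<inter> {u. (\<chi> x. - ln (u $ Inl x)) \<in> B} \<in> sets borel"
    by (rule sets.Int[rotated])
  then show "{u :: real^('v + 'v \<times> 'v). (\<forall>x. 0 < u $ Inl x) \<and> (\<chi> x. - ln (u $ Inl x)) \<in> B} \<in> sets borel"
    by (simp add: Int_def)
qed

section \<open>The candidate law and its moments\<close>

context killed_network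
begin

text \<open>The first two factors are the probability of the network. Given it, the occupations are
  independent Gamma variables of shape k_x + 1 and rate lambda_x; \<open>erlang_density j\<close>
  has shape j + 1 and vanishes on negative arguments.\<close>

definition joint_density :: "('v \<Rightarrow> 'v \<Rightarrow> nat) \<Rightarrow> real^'v \<Rightarrow> real" where
  "joint_density k \<rho> = det (mat 1 - transition C \<kappa>) * (of_bool (eulerian k) * network_weight (\<lambda>x y. tr x y) k) *
     (\<Prod>x\<in>UNIV. erlang_density (vertex_degree k x) (wt x) (\<rho> $ x))"

definition joint_law :: "(('v \<Rightarrow> 'v \<Rightarrow> nat) \<times> (real^'v)) measure" where
  "joint_law = density (count_space UNIV \<Otimes>\<^sub>M lborel) (\<lambda>(k, \<rho>). ennreal (joint_density k \<rho>))"

abbreviation "encode_pair z \<equiv> encode (\<lambda>x y. of_nat (fst z x y)) (\<lambda>x. ennreal (snd z $ x))"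

lemma det_transition_pos: "0 < det (mat 1 - transition C \<kappa>)"
  unfolding det_transition by simp

lemma network_weight_nonneg: "(\<And>x y. 0 \<le> Q x y) \<Longrightarrow> 0 \<le> network_weight Q k"
  unfolding network_weight_def by (intro mult_nonneg_nonneg divide_nonneg_nonneg prod_nonneg) auto

lemma joint_const_nonneg:
  "0 \<le> det (mat 1 - transition C \<kappa>) * (of_bool (eulerian k) * network_weight (\<lambda>x y. tr x y) k)"
  by (intro mult_nonneg_nonneg less_imp_le[OF det_transition_pos] network_weight_nonneg transition_nonneg) simp

lemma measurable_joint_density [measurable]: "joint_density k \<in> borel_measurable borel"
  unfolding joint_density_def[abs_def] by measurable

text \<open>There are countably many networks, so measurability in the pair is checked for each
  network separately.\<close>

lemma nn_integral_joint_law: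
  assumes "\<And>k. (\<lambda>\<rho>. f (k, \<rho>)) \<in> borel_measurable borel"
  shows "(\<integral>\<^sup>+z. f z \<partial>joint_law) =
    (\<integral>\<^sup>+k. (\<integral>\<^sup>+\<rho>. ennreal (joint_density k \<rho>) * f (k, \<rho>) \<partial>lborel) \<partial>count_space UNIV)"
proof -
  have g: "(\<lambda>(k, \<rho>). ennreal (joint_density k \<rho>)) \<in> borel_measurable (count_space UNIV \<Otimes>\<^sub>M lborel)"
    by (rule measurable_pair_measure_countable1) (auto simp: measurable_joint_density)
  have f: "f \<in> borel_measurable (count_space UNIV \<Otimes>\<^sub>M lborel)"
    by (rule measurable_pair_measure_countable1) (auto simp: assms)
  have "(\<integral>\<^sup>+z. f z \<partial>joint_law) =
      (\<integral>\<^sup>+z. (\<lambda>(k, \<rho>). ennreal (joint_density k \<rho>)) z * f z \<partial>(count_space UNIV \<Otimes>\<^sub>M lborel))"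
    unfolding joint_law_def by (rule nn_integral_density[OF g f])
  also have "\<dots> = (\<integral>\<^sup>+k. (\<integral>\<^sup>+\<rho>. ennreal (joint_density k \<rho>) * f (k, \<rho>) \<partial>lborel) \<partial>count_space UNIV)"
    using g f by (subst lborel.nn_integral_fst[symmetric]) (auto intro!: borel_measurable_times_ennreal)
  finally show ?thesis .
qed

lemma integral_joint_density_exp:
  "(\<integral>\<^sup>+\<rho>. ennreal (joint_density k \<rho>) * ennreal (\<Prod>x\<in>UNIV. enexp (ennreal (\<rho> $ x)) ^ n x) \<partial>lborel) =
    ennreal (det (mat 1 - transition C \<kappa>) * (of_bool (eulerian k) * network_weight (\<lambda>x y. tr x y) k) *
      (\<Prod>x\<in>UNIV. (1 / (1 + real (n x) / wt x)) ^ Suc (vertex_degree k x)))"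
proof -
  let ?a = "det (mat 1 - transition C \<kappa>) * (of_bool (eulerian k) * network_weight (\<lambda>x y. tr x y) k)"
  let ?d = "\<lambda>x t. erlang_density (vertex_degree k x) (wt x) t * exp (- (real (n x) * t))"
  have d: "0 \<le> ?d x t" for x t using vertex_weight_pos[of x] by simp
  \<comment> \<open>For negative t the truncation by \<open>ennreal\<close> makes the exponentials
    differ, but the density vanishes there.\<close>
  have e: "erlang_density j l t * enexp (ennreal t) ^ r = erlang_density j l t * exp (- (real r * t))" for j l t r
    by (cases "t < 0") (simp_all add: erlang_density_def enexp_ennreal exp_of_nat_mult[symmetric])
  have "(\<integral>\<^sup>+\<rho>. ennreal (joint_density k \<rho>) * ennreal (\<Prod>x\<in>UNIV. enexp (ennreal (\<rho> $ x)) ^ n x) \<partial>lborel) =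
      (\<integral>\<^sup>+\<rho>. ennreal ?a * (\<Prod>x\<in>UNIV. ennreal (?d x (\<rho> $ x))) \<partial>lborel)"
  proof (rule nn_integral_cong)
    fix \<rho> :: "real^'v"
    have "joint_density k \<rho> * (\<Prod>x\<in>UNIV. enexp (ennreal (\<rho> $ x)) ^ n x) = ?a * (\<Prod>x\<in>UNIV. ?d x (\<rho> $ x))"
      unfolding joint_density_def mult.assoc[of ?a] prod.distrib[symmetric] e ..
    moreover have "0 \<le> joint_density k \<rho>"
      unfolding joint_density_def using vertex_weight_pos
      by (intro mult_nonneg_nonneg[OF joint_const_nonneg] prod_nonneg) (simp add: less_imp_le)
    ultimately show "ennreal (joint_density k \<rho>) * ennreal (\<Prod>x\<in>UNIV. enexp (ennreal (\<rho> $ x)) ^ n x) =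
        ennreal ?a * (\<Prod>x\<in>UNIV. ennreal (?d x (\<rho> $ x)))"
      using joint_const_nonneg by (simp only: prod_ennreal[OF d] ennreal_mult'[symmetric])
  qed
  also have "\<dots> = ennreal ?a * (\<integral>\<^sup>+\<rho>. (\<Prod>x\<in>UNIV. ennreal (?d x (\<rho> $ x))) \<partial>lborel)"
    by (rule nn_integral_cmult) measurable
  also have "(\<integral>\<^sup>+\<rho>. (\<Prod>x\<in>UNIV. ennreal (?d x (\<rho> $ x))) \<partial>lborel) = (\<Prod>x\<in>UNIV. \<integral>\<^sup>+t. ennreal (?d x t) \<partial>lborel)"
    by (rule nn_integral_lborel_vec_prod) measurable
  also have "\<dots> = (\<Prod>x\<in>UNIV. ennreal ((1 / (1 + real (n x) / wt x)) ^ Suc (vertex_degree k x)))"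
  proof (intro prod.cong refl)
    fix x
    have "wt x / (wt x + real (n x)) = 1 / (1 + real (n x) / wt x)"
      using vertex_weight_pos[of x] by (simp add: field_simps)
    then show "(\<integral>\<^sup>+t. ennreal (?d x t) \<partial>lborel) = ennreal ((1 / (1 + real (n x) / wt x)) ^ Suc (vertex_degree k x))"
      using nn_integral_erlang_density_exp[of "wt x" "real (n x)" "vertex_degree k x"] vertex_weight_pos[of x] by simp
  qed
  also have "\<dots> = ennreal (\<Prod>x\<in>UNIV. (1 / (1 + real (n x) / wt x)) ^ Suc (vertex_degree k x))"
    using damping_bounds(1) by (intro prod_ennreal zero_le_power divide_nonneg_nonneg) (auto intro: add_nonneg_nonneg)
  also have "ennreal ?a * \<dots> = ennreal (?a * (\<Prod>x\<in>UNIV. (1 / (1 + real (n x) / wt x)) ^ Suc (vertex_degree k x)))"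
    by (rule ennreal_mult'[symmetric, OF joint_const_nonneg])
  finally show ?thesis .
qed

text \<open>The holding-time factor of an arrow depends only on its tail, so vertex x collects it
  k_x times.\<close>

lemma network_weight_damped:
  "network_weight (damped m n) k = network_weight (\<lambda>x y. tr x y) k *
    (\<Prod>x\<in>UNIV. \<Prod>y\<in>UNIV. exp (- real (k x y)) ^ m x y) * (\<Prod>x\<in>UNIV. (1 / (1 + real (n x) / wt x)) ^ vertex_degree k x)"
proof -
  have "damped m n x y ^ k x y = tr x y ^ k x y * (exp (- real (k x y)) ^ m x y * (1 / (1 + real (n x) / wt x)) ^ k x y)" for x y
    unfolding damped_def power_mult_distrib by (simp add: exp_of_nat_mult[symmetric] mult.commute)
  moreover have "(\<Prod>y\<in>UNIV. (1 / (1 + real (n x) / wt x)) ^ k x y) = (1 / (1 + real (n x) / wt x)) ^ vertex_degree k x" for x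
    unfolding vertex_degree_def by (rule power_sum[symmetric])
  ultimately show ?thesis
    unfolding network_weight_def by (simp only: prod.distrib mult.assoc)
qed

text \<open>Of the k_x + 1 factors in each Gamma transform, k_x are absorbed into the damped network
  weight and one is left outside, matching the trivial loops. The remaining sum over networks is
  MacMahon's.\<close>

lemma moments_joint_law:
  "(\<integral>\<^sup>+z. ennreal (\<Prod>i\<in>UNIV. encode_pair z $ i ^ p i) \<partial>joint_law) =
    ennreal (det (mat 1 - transition C \<kappa>) * (\<Prod>x\<in>UNIV. 1 / (1 + real (p (Inl x)) / wt x)) *
      exp (loop_mass_total (damped (\<lambda>x y. p (Inr (x, y))) (\<lambda>x. p (Inl x)))))"
    (is "_ = ennreal (?c * exp (loop_mass_total (damped ?m ?n)))")
proof -
  let ?E = "\<lambda>k. \<Prod>x\<in>UNIV. \<Prod>y\<in>UNIV. exp (- real (k x y)) ^ ?m x y"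
  have E: "0 \<le> ?E k" for k :: "'v \<Rightarrow> 'v \<Rightarrow> nat" by (intro prod_nonneg ballI zero_le_power) simp
  have c: "0 \<le> ?c"
    using damping_bounds(1)[of ?n] det_transition_pos by (intro mult_nonneg_nonneg prod_nonneg divide_nonneg_nonneg) (auto intro: add_nonneg_nonneg)
  have "(\<integral>\<^sup>+z. ennreal (\<Prod>i\<in>UNIV. encode_pair z $ i ^ p i) \<partial>joint_law) =
      (\<integral>\<^sup>+k. (\<integral>\<^sup>+\<rho>. ennreal (joint_density k \<rho>) * ennreal (\<Prod>i\<in>UNIV. encode_pair (k, \<rho>) $ i ^ p i) \<partial>lborel) \<partial>count_space UNIV)"
    by (rule nn_integral_joint_law) (unfold prod_encode fst_conv snd_conv, measurable)
  also have "\<dots> = (\<integral>\<^sup>+k. ennreal ?c * ennreal (of_bool (eulerian k) * network_weight (damped ?m ?n) k) \<partial>count_space UNIV)"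
  proof (rule nn_integral_cong)
    fix k :: "'v \<Rightarrow> 'v \<Rightarrow> nat"
    let ?D = "\<Prod>x\<in>UNIV. (1 / (1 + real (?n x) / wt x)) ^ Suc (vertex_degree k x)"
    have "(\<integral>\<^sup>+\<rho>. ennreal (joint_density k \<rho>) * ennreal (\<Prod>i\<in>UNIV. encode_pair (k, \<rho>) $ i ^ p i) \<partial>lborel) =
        (\<integral>\<^sup>+\<rho>. ennreal (?E k) * (ennreal (joint_density k \<rho>) * ennreal (\<Prod>x\<in>UNIV. enexp (ennreal (\<rho> $ x)) ^ ?n x)) \<partial>lborel)"
      unfolding prod_encode fst_conv snd_conv enexp_of_nat
      by (intro nn_integral_cong) (simp only: ennreal_mult'[OF E] mult.left_commute)
    also have "\<dots> = ennreal (?E k) * (\<integral>\<^sup>+\<rho>. ennreal (joint_density k \<rho>) * ennreal (\<Prod>x\<in>UNIV. enexp (ennreal (\<rho> $ x)) ^ ?n x) \<partial>lborel)"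
      by (intro nn_integral_cmult) (simp, measurable)
    also have "\<dots> = ennreal (?E k * (det (mat 1 - transition C \<kappa>) *
        (of_bool (eulerian k) * network_weight (\<lambda>x y. tr x y) k) * ?D))"
      unfolding integral_joint_density_exp by (rule ennreal_mult'[OF E, symmetric])
    also have "?E k * (det (mat 1 - transition C \<kappa>) * (of_bool (eulerian k) * network_weight (\<lambda>x y. tr x y) k) * ?D) =
        ?c * (of_bool (eulerian k) * network_weight (damped ?m ?n) k)"
      unfolding network_weight_damped power_Suc prod.distrib by (simp only: mult_ac)
    also have "ennreal \<dots> = ennreal ?c * ennreal (of_bool (eulerian k) * network_weight (damped ?m ?n) k)"
      by (rule ennreal_mult'[OF c])
    finally show "(\<integral>\<^sup>+\<rho>. ennreal (joint_density k \<rho>) * ennreal (\<Prod>i\<in>UNIV. encode_pair (k, \<rho>) $ i ^ p i) \<partial>lborel) =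
      ennreal ?c * ennreal (of_bool (eulerian k) * network_weight (damped ?m ?n) k)" .
  qed
  also have "\<dots> = ennreal ?c * ennreal (exp (loop_mass_total (damped ?m ?n)))"
    by (subst nn_integral_cmult, simp, subst macmahon_exp[OF damped_bounds(1) loop_mass_total_sums[OF damped_bounds]]) (rule refl)
  also have "\<dots> = ennreal (?c * exp (loop_mass_total (damped ?m ?n)))" by (rule ennreal_mult'[OF c, symmetric])
  finally show ?thesis .
qed

lemma measurable_fields:
  assumes M: "prob_space M" and L: "loop_ensemble M E C \<kappa> 1 L"
  shows "(\<lambda>\<omega>. encode (edge_field (L \<omega>)) (occupation_field C \<kappa> (L \<omega>))) \<in> borel_measurable M"
proof (rule measurable_encode)
  let ?\<nu> = "loop_measure E (transition C \<kappa>)"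
  have PP: "poisson_process M ?\<nu> L" using L by (simp add: loop_ensemble_def)
  have bm: "borel_measurable ?\<nu> = (borel_measurable (loop_space E) :: (_ \<Rightarrow> ennreal) set)"
    by (intro measurable_cong_sets) (simp_all add: sets_loop_space sets_loop_measure)
  show "(\<lambda>\<omega>. edge_field (L \<omega>) x y) \<in> borel_measurable M" for x y
    unfolding edge_field_def by (rule measurable_nn_integral_poisson[OF M PP]) (simp add: bm measurable_jumps)
  have "(\<lambda>c. ennreal (time_at x c)) \<in> borel_measurable ?\<nu>" for x
    unfolding bm using measurable_time_at[of x E] by measurable
  from measurable_nn_integral_poisson[OF M PP this]
  show "(\<lambda>\<omega>. occupation_field C \<kappa> (L \<omega>) x) \<in> borel_measurable M" for x
    unfolding occupation_field_def by measurable
qed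

lemma law_of_fields:
  assumes M: "prob_space M" and L: "loop_ensemble M E C \<kappa> 1 L"
  shows "distr M borel (\<lambda>\<omega>. encode (edge_field (L \<omega>)) (occupation_field C \<kappa> (L \<omega>))) =
    distr joint_law borel (\<lambda>z. encode_pair z)"
proof -
  note mM = measurable_fields[OF M L]
  have mJ: "(\<lambda>z. encode_pair z) \<in> borel_measurable joint_law"
  proof (rule measurable_encode)
    have sets: "borel_measurable joint_law = borel_measurable (count_space UNIV \<Otimes>\<^sub>M lborel)"
      unfolding joint_law_def by (intro measurable_cong_sets) simp_all
    show "(\<lambda>z. of_nat (fst z x y) :: ennreal) \<in> borel_measurable joint_law" for x y
      unfolding sets by (rule measurable_pair_measure_countable1) auto
    show "(\<lambda>z. ennreal (snd z $ x)) \<in> borel_measurable joint_law" for x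
      unfolding sets by (rule measurable_pair_measure_countable1) auto
  qed
  let ?A = "distr M borel (\<lambda>\<omega>. encode (edge_field (L \<omega>)) (occupation_field C \<kappa> (L \<omega>)))"
  let ?B = "distr joint_law borel (\<lambda>z. encode_pair z)"
  have moments: "(\<integral>\<^sup>+u. ennreal (\<Prod>i\<in>UNIV. u $ i ^ p i) \<partial>?A) = (\<integral>\<^sup>+u. ennreal (\<Prod>i\<in>UNIV. u $ i ^ p i) \<partial>?B)" for p
  proof -
    have meas: "(\<lambda>u. ennreal (\<Prod>i\<in>UNIV. u $ i ^ p i)) \<in> borel_measurable borel" by measurable
    have "(\<integral>\<^sup>+u. ennreal (\<Prod>i\<in>UNIV. u $ i ^ p i) \<partial>?A) =
        (\<integral>\<^sup>+\<omega>. ennreal (\<Prod>i\<in>UNIV. encode (edge_field (L \<omega>)) (occupation_field C \<kappa> (L \<omega>)) $ i ^ p i) \<partial>M)"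
      by (rule nn_integral_distr[OF mM]) (use meas in simp)
    also have "\<dots> = ennreal (det (mat 1 - transition C \<kappa>) * (\<Prod>x\<in>UNIV. 1 / (1 + real (p (Inl x)) / wt x)) *
        exp (loop_mass_total (damped (\<lambda>x y. p (Inr (x, y))) (\<lambda>x. p (Inl x)))))"
      unfolding prod_encode by (rule laplace_fields[OF M L])
    also have "\<dots> = (\<integral>\<^sup>+z. ennreal (\<Prod>i\<in>UNIV. encode_pair z $ i ^ p i) \<partial>joint_law)"
      by (rule moments_joint_law[symmetric])
    also have "\<dots> = (\<integral>\<^sup>+u. ennreal (\<Prod>i\<in>UNIV. u $ i ^ p i) \<partial>?B)"
      by (rule nn_integral_distr[OF mJ, symmetric]) (use meas in simp)
    finally show ?thesis .
  qed
  have finA: "finite_measure ?A"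
    using prob_space.prob_space_distr[OF M mM] by (rule prob_space.finite_measure)
  \<comment> \<open>Finiteness of the candidate law is read off from the moment with all exponents
    0.\<close>
  have "emeasure ?B (space ?B) = emeasure ?A (space ?A)" using moments[of "\<lambda>_. 0"] by simp
  then have finB: "finite_measure ?B"
    using finite_measure.emeasure_finite[OF finA] by (intro finite_measureI) simp
  show ?thesis
    by (rule measure_eq_of_moments_eq[OF finA _ AE_distr_encode_cube[OF mM] finB _ AE_distr_encode_cube[OF mJ] moments])
      simp_all
qed

lemma emeasure_fields:
  assumes M: "prob_space M" and L: "loop_ensemble M E C \<kappa> 1 L" and S: "S \<in> sets borel"
  shows "emeasure M {\<omega> \<in> space M. encode (edge_field (L \<omega>)) (occupation_field C \<kappa> (L \<omega>)) \<in> S} =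
    (\<integral>\<^sup>+k. (\<integral>\<^sup>+\<rho>. ennreal (joint_density k \<rho>) * indicator S (encode_pair (k, \<rho>)) \<partial>lborel) \<partial>count_space UNIV)"
proof -
  note mM = measurable_fields[OF M L]
  have mk: "(\<lambda>\<rho>. encode_pair (k, \<rho>)) \<in> borel_measurable borel" for k :: "'v \<Rightarrow> 'v \<Rightarrow> nat"
    unfolding fst_conv snd_conv by (rule measurable_encode) measurable
  have mJ: "(\<lambda>z. encode_pair z) \<in> borel_measurable joint_law"
  proof -
    have "borel_measurable joint_law = (borel_measurable (count_space UNIV \<Otimes>\<^sub>M lborel) :: (_ \<Rightarrow> real^('v + 'v \<times> 'v)) set)"
      unfolding joint_law_def by (intro measurable_cong_sets) simp_all
    then show ?thesis using mk by (simp only:) (rule measurable_pair_measure_countable1, auto)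
  qed
  have ind: "indicator S \<in> borel_measurable borel" using S by simp
  have "emeasure M {\<omega> \<in> space M. encode (edge_field (L \<omega>)) (occupation_field C \<kappa> (L \<omega>)) \<in> S} =
      emeasure (distr M borel (\<lambda>\<omega>. encode (edge_field (L \<omega>)) (occupation_field C \<kappa> (L \<omega>)))) S"
    by (subst emeasure_distr[OF mM S]) (simp add: vimage_def Int_def conj_commute)
  also have "\<dots> = (\<integral>\<^sup>+u. indicator S u \<partial>distr joint_law borel (\<lambda>z. encode_pair z))"
    unfolding law_of_fields[OF M L] using S by simp
  also have "\<dots> = (\<integral>\<^sup>+z. indicator S (encode_pair z) \<partial>joint_law)"
    by (rule nn_integral_distr[OF mJ]) (use S in simp)
  also have "\<dots> = (\<integral>\<^sup>+k. (\<integral>\<^sup>+\<rho>. ennreal (joint_density k \<rho>) * indicator S (encode_pair (k, \<rho>)) \<partial>lborel) \<partial>count_space UNIV)"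
    by (rule nn_integral_joint_law) (rule measurable_compose[OF mk ind])
  finally show ?thesis .
qed

text \<open>By the Eulerian condition each square root occurs k_x times at tails and k_x times at
  heads, giving rho_x^k_x. The vertex factorials cancel those of the Erlang densities, lambda_x^k_x
  turns P into C, and the one lambda_x left per vertex combines with det(I - P) into 1 / det
  G.\<close>

lemma joint_density_eq:
  assumes k: "eulerian k" and \<rho>: "\<And>x. 0 \<le> \<rho> $ x"
  shows "joint_density k \<rho> = 1 / det (green C \<kappa>) *
    (\<Prod>x\<in>UNIV. \<Prod>y\<in>UNIV. (sqrt (\<rho> $ x) * C x y * sqrt (\<rho> $ y)) ^ k x y / fact (k x y)) *
    (\<Prod>x\<in>UNIV. exp (- (wt x * \<rho> $ x)))"
proof -
  have wt: "wt x \<noteq> 0" for x using vertex_weight_pos[of x] by simp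
  have inn: "(\<Sum>x\<in>UNIV. k x y) = vertex_degree k y" for y using k by (simp add: eulerian_def vertex_degree_def)
  have out: "(\<Prod>y\<in>UNIV. a ^ k x y) = a ^ vertex_degree k x" for a :: real and x
    unfolding vertex_degree_def by (rule power_sum[symmetric])
  have col: "(\<Prod>x\<in>UNIV. \<Prod>y\<in>UNIV. sqrt (\<rho> $ y) ^ k x y) = (\<Prod>y\<in>UNIV. sqrt (\<rho> $ y) ^ vertex_degree k y)"
    by (subst prod.swap) (simp only: power_sum[symmetric] inn)
  have "(\<Prod>x\<in>UNIV. \<Prod>y\<in>UNIV. (sqrt (\<rho> $ x) * C x y * sqrt (\<rho> $ y)) ^ k x y) =
      (\<Prod>x\<in>UNIV. \<Prod>y\<in>UNIV. C x y ^ k x y) *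
      ((\<Prod>x\<in>UNIV. sqrt (\<rho> $ x) ^ vertex_degree k x) * (\<Prod>x\<in>UNIV. sqrt (\<rho> $ x) ^ vertex_degree k x))"
    by (simp only: power_mult_distrib prod.distrib out col mult_ac)
  moreover have "sqrt (\<rho> $ x) * sqrt (\<rho> $ x) = \<rho> $ x" for x using \<rho>[of x] by simp
  ultimately have sq: "(\<Prod>x\<in>UNIV. \<Prod>y\<in>UNIV. (sqrt (\<rho> $ x) * C x y * sqrt (\<rho> $ y)) ^ k x y) =
      (\<Prod>x\<in>UNIV. \<Prod>y\<in>UNIV. C x y ^ k x y) * (\<Prod>x\<in>UNIV. (\<rho> $ x) ^ vertex_degree k x)"
    by (simp only: prod.distrib[symmetric] power_mult_distrib[symmetric])
  have tr: "(\<Prod>x\<in>UNIV. \<Prod>y\<in>UNIV. tr x y ^ k x y) * (\<Prod>x\<in>UNIV. wt x ^ vertex_degree k x) =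
      (\<Prod>x\<in>UNIV. \<Prod>y\<in>UNIV. C x y ^ k x y)"
    unfolding out[symmetric] prod.distrib[symmetric] power_mult_distrib[symmetric] using wt by (simp add: transition_def)
  have er: "(\<Prod>x\<in>UNIV. erlang_density (vertex_degree k x) (wt x) (\<rho> $ x)) * (\<Prod>x\<in>UNIV. fact (vertex_degree k x)) =
      (\<Prod>x\<in>UNIV. wt x) * (\<Prod>x\<in>UNIV. wt x ^ vertex_degree k x) * (\<Prod>x\<in>UNIV. (\<rho> $ x) ^ vertex_degree k x) *
      (\<Prod>x\<in>UNIV. exp (- (wt x * \<rho> $ x)))"
    unfolding prod.distrib[symmetric]
  proof (intro prod.cong refl)
    fix x
    show "erlang_density (vertex_degree k x) (wt x) (\<rho> $ x) * fact (vertex_degree k x) =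
      wt x * wt x ^ vertex_degree k x * \<rho> $ x ^ vertex_degree k x * exp (- (wt x * \<rho> $ x))"
      using \<rho>[of x] by (simp add: erlang_density_def)
  qed
  have "joint_density k \<rho> = det (mat 1 - transition C \<kappa>) / (\<Prod>x\<in>UNIV. \<Prod>y\<in>UNIV. fact (k x y)) *
      (\<Prod>x\<in>UNIV. \<Prod>y\<in>UNIV. tr x y ^ k x y) *
      ((\<Prod>x\<in>UNIV. erlang_density (vertex_degree k x) (wt x) (\<rho> $ x)) * (\<Prod>x\<in>UNIV. fact (vertex_degree k x)))"
    using k by (simp add: joint_density_def network_weight_def)
  also have "\<dots> = ((\<Prod>x\<in>UNIV. wt x) * det (mat 1 - transition C \<kappa>)) * (
      ((\<Prod>x\<in>UNIV. \<Prod>y\<in>UNIV. tr x y ^ k x y) * (\<Prod>x\<in>UNIV. wt x ^ vertex_degree k x)) *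
      (\<Prod>x\<in>UNIV. (\<rho> $ x) ^ vertex_degree k x) / (\<Prod>x\<in>UNIV. \<Prod>y\<in>UNIV. fact (k x y))) *
      (\<Prod>x\<in>UNIV. exp (- (wt x * \<rho> $ x)))"
    unfolding er by simp
  also have "\<dots> = 1 / det (green C \<kappa>) *
      ((\<Prod>x\<in>UNIV. \<Prod>y\<in>UNIV. (sqrt (\<rho> $ x) * C x y * sqrt (\<rho> $ y)) ^ k x y) / (\<Prod>x\<in>UNIV. \<Prod>y\<in>UNIV. fact (k x y))) *
      (\<Prod>x\<in>UNIV. exp (- (wt x * \<rho> $ x)))"
    unfolding tr sq det_green ..
  finally show ?thesis by (simp only: prod_dividef)
qed

lemma probability_edge_field:
  assumes M: "prob_space M" and L: "loop_ensemble M E C \<kappa> 1 L" and k: "eulerian k"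
  shows "measure M {\<omega> \<in> space M. \<forall>x y. edge_field (L \<omega>) x y = of_nat (k x y)} =
    det (mat 1 - transition C \<kappa>) * network_weight (\<lambda>x y. tr x y) k"
proof -
  let ?S = "{u :: real^('v + 'v \<times> 'v). \<forall>x y. u $ Inr (x, y) = exp (- real (k x y))}"
  have iff: "encode_pair (j, \<rho>) \<in> ?S \<longleftrightarrow> j = k" for j \<rho>
    unfolding decode_edge_iff by (auto simp: fun_eq_iff)
  have "emeasure M {\<omega> \<in> space M. \<forall>x y. edge_field (L \<omega>) x y = of_nat (k x y)} =
      (\<integral>\<^sup>+j. (\<integral>\<^sup>+\<rho>. ennreal (joint_density j \<rho>) * indicator ?S (encode_pair (j, \<rho>)) \<partial>lborel) \<partial>count_space UNIV)"
    using emeasure_fields[OF M L measurable_decode_sets(1)[of k]] unfolding decode_edge_iff .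
  also have "\<dots> = (\<integral>\<^sup>+j. (\<integral>\<^sup>+\<rho>. ennreal (joint_density j \<rho>) \<partial>lborel) * indicator {k} j \<partial>count_space UNIV)"
  proof (rule nn_integral_cong)
    fix j
    have "indicator ?S (encode_pair (j, \<rho>)) = (indicator {k} j :: ennreal)" for \<rho>
      unfolding indicator_def iff by simp
    then show "(\<integral>\<^sup>+\<rho>. ennreal (joint_density j \<rho>) * indicator ?S (encode_pair (j, \<rho>)) \<partial>lborel) =
        (\<integral>\<^sup>+\<rho>. ennreal (joint_density j \<rho>) \<partial>lborel) * indicator {k} j"
      by (simp only:) (rule nn_integral_multc, simp)
  qed
  also have "\<dots> = (\<integral>\<^sup>+\<rho>. ennreal (joint_density k \<rho>) \<partial>lborel)"
    by (simp add: nn_integral_count_space_indicator[symmetric] nn_integral_count_space_finite)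
  also have "\<dots> = ennreal (det (mat 1 - transition C \<kappa>) * network_weight (\<lambda>x y. tr x y) k)"
    \<comment> \<open>Exponents 0 integrate out the occupation field.\<close>
    using integral_joint_density_exp[of k "\<lambda>_. 0"] k by simp
  finally show ?thesis
    using joint_const_nonneg[of k] k by (simp add: measure_def)
qed

lemma probability_fields:
  assumes M: "prob_space M" and L: "loop_ensemble M E C \<kappa> 1 L" and k: "eulerian k"
    and B: "B \<in> sets borel" "B \<subseteq> {\<rho>. \<forall>x. 0 \<le> \<rho> $ x}"
  shows "emeasure M {\<omega> \<in> space M. (\<forall>x y. edge_field (L \<omega>) x y = of_nat (k x y)) \<and>
      (\<exists>\<rho>\<in>B. \<forall>x. occupation_field C \<kappa> (L \<omega>) x = ennreal (\<rho> $ x))} =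
    (\<integral>\<^sup>+\<rho>\<in>B. ennreal (joint_density k \<rho>) \<partial>lborel)"
proof -
  let ?S = "{u :: real^('v + 'v \<times> 'v). \<forall>x y. u $ Inr (x, y) = exp (- real (k x y))}"
  let ?T = "{u :: real^('v + 'v \<times> 'v). (\<forall>x. 0 < u $ Inl x) \<and> (\<chi> x. - ln (u $ Inl x)) \<in> B}"
  have iff: "encode e h \<in> ?S \<inter> ?T \<longleftrightarrow> (\<forall>x y. e x y = of_nat (k x y)) \<and> (\<exists>\<rho>\<in>B. \<forall>x. h x = ennreal (\<rho> $ x))" for e h
    unfolding Int_iff decode_edge_iff decode_occupation_iff[OF B(2)] ..
  have ST: "?S \<inter> ?T \<in> sets borel" by (intro sets.Int measurable_decode_sets B)
  have "emeasure M {\<omega> \<in> space M. (\<forall>x y. edge_field (L \<omega>) x y = of_nat (k x y)) \<and>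
      (\<exists>\<rho>\<in>B. \<forall>x. occupation_field C \<kappa> (L \<omega>) x = ennreal (\<rho> $ x))} =
      (\<integral>\<^sup>+j. (\<integral>\<^sup>+\<rho>. ennreal (joint_density j \<rho>) * indicator (?S \<inter> ?T) (encode_pair (j, \<rho>)) \<partial>lborel) \<partial>count_space UNIV)"
    using emeasure_fields[OF M L ST] unfolding iff .
  also have "\<dots> = (\<integral>\<^sup>+j. (\<integral>\<^sup>+\<rho>\<in>B. ennreal (joint_density j \<rho>) \<partial>lborel) * indicator {k} j \<partial>count_space UNIV)"
  proof (rule nn_integral_cong)
    fix j :: "'v \<Rightarrow> 'v \<Rightarrow> nat"
    have "ennreal (joint_density j \<rho>) * indicator (?S \<inter> ?T) (encode_pair (j, \<rho>)) =
        ennreal (joint_density j \<rho>) * indicator B \<rho> * indicator {k} j" for \<rho>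
    \<comment> \<open>On the orthant the encoding is injective; outside it negative coordinates are
      truncated to 0, but the density vanishes.\<close>
    proof (cases "\<forall>x. 0 \<le> \<rho> $ x")
      case True
      have "(\<exists>\<rho>'\<in>B. \<forall>x. ennreal (\<rho> $ x) = ennreal (\<rho>' $ x)) \<longleftrightarrow> \<rho> \<in> B"
      proof
        assume "\<exists>\<rho>'\<in>B. \<forall>x. ennreal (\<rho> $ x) = ennreal (\<rho>' $ x)"
        then obtain \<rho>' where \<rho>': "\<rho>' \<in> B" "\<And>x. ennreal (\<rho> $ x) = ennreal (\<rho>' $ x)" by blast
        then have "\<rho> $ x = \<rho>' $ x" for x using True B(2) by (auto simp: subset_iff)
        then have "\<rho> = \<rho>'" by (simp add: vec_eq_iff)
        then show "\<rho> \<in> B" using \<rho>'(1) by simp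
      qed blast
      moreover have "(\<forall>x y. (of_nat (j x y) :: ennreal) = of_nat (k x y)) \<longleftrightarrow> j = k" by (auto simp: fun_eq_iff)
      ultimately have "encode_pair (j, \<rho>) \<in> ?S \<inter> ?T \<longleftrightarrow> \<rho> \<in> B \<and> j = k" unfolding iff fst_conv snd_conv by blast
      then show ?thesis by (simp only: indicator_def) simp
    next
      case False
      then obtain x where "\<rho> $ x < 0" by (auto simp: not_le)
      then have "(\<Prod>x\<in>UNIV. erlang_density (vertex_degree j x) (wt x) (\<rho> $ x)) = 0"
        by (intro prod_zero) (auto simp: erlang_density_def intro!: exI[of _ x])
      then have "joint_density j \<rho> = 0" unfolding joint_density_def by (simp only: mult_zero_right)
      then show ?thesis by simp
    qed
    then show "(\<integral>\<^sup>+\<rho>. ennreal (joint_density j \<rho>) * indicator (?S \<inter> ?T) (encode_pair (j, \<rho>)) \<partial>lborel) =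
        (\<integral>\<^sup>+\<rho>\<in>B. ennreal (joint_density j \<rho>) \<partial>lborel) * indicator {k} j"
      by (simp only:) (rule nn_integral_multc, use B(1) in simp)
  qed
  also have "\<dots> = (\<integral>\<^sup>+\<rho>\<in>B. ennreal (joint_density k \<rho>) \<partial>lborel)"
    by (simp add: nn_integral_count_space_indicator[symmetric] nn_integral_count_space_finite)
  finally show ?thesis .
qed

end

text \<open>The infinitesimal identity in ii) is read as equality of measures on Borel sets of the
  nonnegative orthant. Holding times of mean 1 divided by lambda_x have rate lambda_x, hence the
  factor exp(-lambda_x rho_x). With (1/2) exp(-lambda_x rho_x / 2) in its place, as in the English
  formula, integrating out rho would give the probability in i) times the product of 2^k_x.\<close>

theorem proposition3p1:
  fixes M :: "'w measure"
    and E :: "'v::finite \<Rightarrow> 'v \<Rightarrow> bool"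
    and C :: "'v \<Rightarrow> 'v \<Rightarrow> real"
    and \<kappa> :: "'v \<Rightarrow> real"
    and L :: "'w \<Rightarrow> ('v \<times> real) list set measure"
  assumes "killed_network E C \<kappa>"
    and "prob_space M"
    and "loop_ensemble M E C \<kappa> 1 L"
  shows "(\<forall>k. network E k \<longrightarrow> eulerian k \<longrightarrow>
           measure M {\<omega> \<in> space M. \<forall>x y. edge_field (L \<omega>) x y = of_nat (k x y)} =
             det (mat 1 - transition C \<kappa>) *
             ((\<Prod>x\<in>UNIV. fact (vertex_degree k x)) / (\<Prod>x\<in>UNIV. \<Prod>y\<in>UNIV. fact (k x y))) *
             (\<Prod>x\<in>UNIV. \<Prod>y\<in>UNIV. (transition C \<kappa> $ x $ y) ^ k x y))
       \<and> (\<forall>k B. network E k \<longrightarrow> eulerian k \<longrightarrow>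
           B \<in> sets (borel :: (real^'v) measure) \<longrightarrow> B \<subseteq> {\<rho>. \<forall>x. 0 \<le> \<rho> $ x} \<longrightarrow>
           emeasure M {\<omega> \<in> space M. (\<forall>x y. edge_field (L \<omega>) x y = of_nat (k x y)) \<and>
               (\<exists>\<rho>\<in>B. \<forall>x. occupation_field C \<kappa> (L \<omega>) x = ennreal (\<rho> $ x))} =
             (\<integral>\<^sup>+\<rho>\<in>B. ennreal (1 / det (green C \<kappa>) *
                (\<Prod>x\<in>UNIV. \<Prod>y\<in>UNIV.
                   (sqrt (\<rho> $ x) * C x y * sqrt (\<rho> $ y)) ^ k x y / fact (k x y)) *
                (\<Prod>x\<in>UNIV. exp (- (vertex_weight C \<kappa> x * \<rho> $ x)))) \<partial>lborel))"
proof -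
  interpret killed_network E C \<kappa> by (rule assms(1))
  show ?thesis
  proof (intro conjI allI impI)
    fix k :: "'v \<Rightarrow> 'v \<Rightarrow> nat" assume k: "eulerian k"
    show "measure M {\<omega> \<in> space M. \<forall>x y. edge_field (L \<omega>) x y = of_nat (k x y)} =
        det (mat 1 - transition C \<kappa>) *
        ((\<Prod>x\<in>UNIV. fact (vertex_degree k x)) / (\<Prod>x\<in>UNIV. \<Prod>y\<in>UNIV. fact (k x y))) *
        (\<Prod>x\<in>UNIV. \<Prod>y\<in>UNIV. (transition C \<kappa> $ x $ y) ^ k x y)"
      unfolding probability_edge_field[OF assms(2,3) k] network_weight_def by (rule mult.assoc[symmetric])
  next
    fix k :: "'v \<Rightarrow> 'v \<Rightarrow> nat" and B :: "(real^'v) set"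
    assume k: "eulerian k" and B: "B \<in> sets borel" "B \<subseteq> {\<rho>. \<forall>x. 0 \<le> \<rho> $ x}"
    show "emeasure M {\<omega> \<in> space M. (\<forall>x y. edge_field (L \<omega>) x y = of_nat (k x y)) \<and>
          (\<exists>\<rho>\<in>B. \<forall>x. occupation_field C \<kappa> (L \<omega>) x = ennreal (\<rho> $ x))} =
        (\<integral>\<^sup>+\<rho>\<in>B. ennreal (1 / det (green C \<kappa>) *
          (\<Prod>x\<in>UNIV. \<Prod>y\<in>UNIV. (sqrt (\<rho> $ x) * C x y * sqrt (\<rho> $ y)) ^ k x y / fact (k x y)) *
          (\<Prod>x\<in>UNIV. exp (- (vertex_weight C \<kappa> x * \<rho> $ x)))) \<partial>lborel)"
      unfolding probability_fields[OF assms(2,3) k B]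
    proof (rule nn_integral_cong)
      fix \<rho> :: "real^'v"
      show "ennreal (joint_density k \<rho>) * indicator B \<rho> = ennreal (1 / det (green C \<kappa>) *
          (\<Prod>x\<in>UNIV. \<Prod>y\<in>UNIV. (sqrt (\<rho> $ x) * C x y * sqrt (\<rho> $ y)) ^ k x y / fact (k x y)) *
          (\<Prod>x\<in>UNIV. exp (- (vertex_weight C \<kappa> x * \<rho> $ x)))) * indicator B \<rho>"
      proof (cases "\<rho> \<in> B")
        case True
        then have "0 \<le> \<rho> $ x" for x using B(2) by auto
        from joint_density_eq[OF k this] show ?thesis by (simp only:)
      qed simp
    qed
  qed
qed

end
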